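(* Let $\alpha\in(0,1)$ and $\lambda>0$. If $(P^{[1]}_{\ell}(\lambda))\sim\mathbb{P}^{[1]}_{\alpha}(\lambda)$, then the sequence $(\tilde{P}_{\ell}(\lambda))$ obtained by size-biased sampling from $(P^{[1]}_{\ell}(\lambda))$ can be represented (in joint distribution) as $\tilde{P}_{k}(\lambda)=(1-W_{k})\prod_{l=1}^{k-1}W_{l}$, $k\ge1$, with the following properties. (i) The $(W_{k})$ are generally dependent random variables represented as $$W_{k}=\left[\beta^{(k)}_{1-\alpha,\alpha}\,\frac{1-R_{k}(\lambda)}{R_{k}(\lambda)}+1\right]^{-1},$$ for $(\beta^{(k)}_{1-\alpha,\alpha})_{k\ge1}$ i.i.d. $\mathrm{Beta}(1-\alpha,\alpha)$ variables independent of the sequence $(R_{k}(\lambda))_{k\ge1}$, where $$R_{k}(\lambda)=\left(\frac{\tilde{G}_{k-1}+\lambda^{\alpha}}{\tilde{G}_{k}+\lambda^{\alpha}}\right)^{1/\alpha},\qquad \tilde G_k=\sum_{i=1}^k\mathbf{e}_i,\quad\tilde G_0=0,$$ and $(\mathbf{e}_i)$ are i.i.d. exponential$(1)$ random variables. (ii) Hence, given $(R_{1}(\lambda)=r_{1},R_{2}(\lambda)=r_{2},\ldots)$, the $(W_{k})$ are conditionally independent. In particular, $W_{k}$ given $R_{1}(\lambda)=r_{1},\ldots,R_{k-1}(\lambda)=r_{k-1},R_{k}(\lambda)=r$ is equal in distribution to $1/(\beta^{(k)}_{1-\alpha,\alpha}[(1-r)/r]+1)$, with density $$\frac{1}{\Gamma(1-\alpha)\Gamma(\alpha)}\,w^{-1}(1-w)^{-\alpha}(w-r)^{\alpha-1}r^{1-\alpha},\qquad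 0<r<w<1.$$
   Context: $S_\alpha$ is the positive $\alpha$-stable random variable with $\mathbb{E}[e^{-\lambda S_\alpha}]=e^{-\lambda^\alpha}$ and density $f_\alpha$. Let $(A_k)$ be the ranked jumps on $[0,1]$ of a stable subordinator with L\'evy density $\alpha s^{-\alpha-1}/\Gamma(1-\alpha)$, so $\sum_kA_k=S_\alpha$; $\mathrm{PD}(\alpha,0)$ is the law of $(A_\ell/S_\alpha,\ell\ge1)$ and $\mathrm{PD}(\alpha|t)$ is its conditional law given $S_\alpha=t$. Then $$\mathbb{P}^{[1]}_{\alpha}(\lambda)=\frac{\lambda^{1-\alpha}}{\alpha}e^{\lambda^{\alpha}}\int_{0}^{\infty}\mathrm{PD}(\alpha|t)\,t\,e^{-\lambda t}f_{\alpha}(t)\,dt,$$ which is the conditional law of $(P_\ell)\sim\mathrm{PD}(\alpha,0)$ given $N_{S_\alpha}(\lambda)=1$, where, given $S_\alpha$ and $(P_\ell)$, $N_{S_\alpha}(\lambda)$ is Poisson with mean $\lambda S_\alpha$. Size-biased sampling from a random mass partition $(P_\ell)$ means sampling masses without replacement, successively, with probability proportional to size: $\tilde P_1=P_i$ with conditional probability $P_i$, then $\tilde P_2$ is chosen from the remaining masses with probability proportional to mass, etc. *)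

theory Defs
  imports "HOL-Probability.Probability"
begin

text \<open>Sequences are indexed from 0: index \<open>k\<close> here is index \<open>k + 1\<close> in the usual notation for
  ranked jumps, mass partitions, size-biased picks and stick-breaking factors.\<close>

abbreviation seq_space :: "(nat \<Rightarrow> real) measure" where
  "seq_space \<equiv> PiM UNIV (\<lambda>_. borel)"

subsection \<open>Conditioning\<close>

abbreviation generated_by :: "'w measure \<Rightarrow> 'a measure \<Rightarrow> ('w \<Rightarrow> 'a) \<Rightarrow> 'w measure" where
  "generated_by M N Y \<equiv> vimage_algebra (space M) Y N"

text \<open>\<open>K\<close> is a regular conditional law of \<open>Y\<close> given \<open>T\<close>; such a \<open>K\<close> is determined only up to a null set
  of values of \<open>T\<close>.\<close>

definition regular_conditional_law ::
  "'w measure \<Rightarrow> 'a measure \<Rightarrow> ('w \<Rightarrow> 'a) \<Rightarrow> 'b measure \<Rightarrow> ('w \<Rightarrow> 'b) \<Rightarrow> ('b \<Rightarrow> 'a measure) \<Rightarrow> bool" where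
  "regular_conditional_law M N Y L T K \<longleftrightarrow>
     Y \<in> measurable M N \<and> T \<in> measurable M L \<and> K \<in> measurable L (prob_algebra N) \<and>
     (\<forall>B\<in>sets N. \<forall>C\<in>sets L.
        emeasure M {\<omega> \<in> space M. Y \<omega> \<in> B \<and> T \<omega> \<in> C} =
        (\<integral>\<^sup>+ t. emeasure (K t) B * indicator C t \<partial>distr M L T))"

definition cond_indep_vars ::
  "'w measure \<Rightarrow> 'w measure \<Rightarrow> ('i \<Rightarrow> 'a measure) \<Rightarrow> ('i \<Rightarrow> 'w \<Rightarrow> 'a) \<Rightarrow> 'i set \<Rightarrow> bool" where
  "cond_indep_vars M F N Y I \<longleftrightarrow>
     (\<forall>i\<in>I. Y i \<in> measurable M (N i)) \<and>
     (\<forall>J. finite J \<and> J \<subseteq> I \<longrightarrow> (\<forall>B. (\<forall>i\<in>J. B i \<in> sets (N i)) \<longrightarrow>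
        (AE \<omega> in M.
           real_cond_exp M F (indicator {\<omega> \<in> space M. \<forall>i\<in>J. Y i \<omega> \<in> B i}) \<omega> =
           (\<Prod>i\<in>J. real_cond_exp M F (indicator {\<omega> \<in> space M. Y i \<omega> \<in> B i}) \<omega>))))"

subsection \<open>The stable subordinator and its ranked jumps\<close>

text \<open>A simple Poisson point process \<open>Z\<close>, given as a random set of points, with intensity \<open>\<mu>\<close>.  Since
  \<open>card\<close> is \<open>0\<close> on infinite sets, almost sure finiteness is required separately.\<close>

definition poisson_point_process :: "'w measure \<Rightarrow> 'e measure \<Rightarrow> ('w \<Rightarrow> 'e set) \<Rightarrow> bool" where
  "poisson_point_process M \<mu> Z \<longleftrightarrow>
     (\<forall>B\<in>sets \<mu>. emeasure \<mu> B < \<infinity> \<longrightarrow>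
        (AE \<omega> in M. finite (Z \<omega> \<inter> B)) \<and>
        (\<lambda>\<omega>. card (Z \<omega> \<inter> B)) \<in> measurable M (count_space UNIV) \<and>
        (\<forall>n. measure M {\<omega> \<in> space M. card (Z \<omega> \<inter> B) = n} =
             measure \<mu> B ^ n / fact n * exp (- measure \<mu> B))) \<and>
     (\<forall>B :: nat \<Rightarrow> 'e set.
        (\<forall>i. B i \<in> sets \<mu> \<and> emeasure \<mu> (B i) < \<infinity>) \<and> disjoint_family B \<longrightarrow>
        prob_space.indep_vars M (\<lambda>_. count_space UNIV) (\<lambda>i \<omega>. card (Z \<omega> \<inter> B i)) UNIV)"

definition jump :: "(real \<Rightarrow> real) \<Rightarrow> real \<Rightarrow> real" where
  "jump x t = x t - Lim (at_left t) x"

definition jump_points :: "(real \<Rightarrow> real) \<Rightarrow> (real \<times> real) set" where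
  "jump_points x = {(t, s). 0 < t \<and> 0 < s \<and> jump x t = s}"

text \<open>A driftless subordinator with Levy density \<open>\<rho>\<close>, in Levy--Ito form: a nondecreasing
  right-continuous process, started at 0 and equal to the sum of its jumps, whose jump times and sizes
  form a Poisson point process on \<open>[0,\<infinity>) \<times> (0,\<infinity>)\<close> with intensity \<open>dt \<rho>(s) ds\<close>.\<close>

definition subordinator :: "'w measure \<Rightarrow> (real \<Rightarrow> real) \<Rightarrow> (real \<Rightarrow> 'w \<Rightarrow> real) \<Rightarrow> bool" where
  "subordinator M \<rho> X \<longleftrightarrow>
     prob_space M \<and>
     (\<forall>t\<ge>0. X t \<in> borel_measurable M) \<and>
     (AE \<omega> in M. X 0 \<omega> = 0 \<and> mono_on {0..} (\<lambda>t. X t \<omega>) \<and>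
        (\<forall>t\<ge>0. continuous (at_right t) (\<lambda>u. X u \<omega>)) \<and>
        (\<forall>t\<ge>0. (jump (\<lambda>u. X u \<omega>) has_sum X t \<omega>) {0<..t})) \<and>
     poisson_point_process M
       (density lborel (\<lambda>(t, s). indicator {0..} t * indicator {0<..} s * ennreal (\<rho> s)))
       (\<lambda>\<omega>. jump_points (\<lambda>t. X t \<omega>))"

definition stable_levy_density :: "real \<Rightarrow> real \<Rightarrow> real" where
  "stable_levy_density \<alpha> s = \<alpha> * s powr (- \<alpha> - 1) / Gamma (1 - \<alpha>)"

definition ranked_jumps :: "(real \<Rightarrow> real) \<Rightarrow> (nat \<Rightarrow> real) \<Rightarrow> bool" where
  "ranked_jumps x a \<longleftrightarrow>
     decseq a \<and>
     (\<exists>\<tau>. bij_betw \<tau> UNIV {t \<in> {0..1}. (t, jump x t) \<in> jump_points x} \<and> (\<forall>k. a k = jump x (\<tau> k)))"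

definition positive_stable :: "'w measure \<Rightarrow> real \<Rightarrow> ('w \<Rightarrow> real) \<Rightarrow> bool" where
  "positive_stable M \<alpha> S \<longleftrightarrow>
     S \<in> borel_measurable M \<and> (AE \<omega> in M. 0 < S \<omega>) \<and>
     (\<forall>\<theta>\<ge>0. (\<integral>\<omega>. exp (- \<theta> * S \<omega>) \<partial>M) = exp (- (\<theta> powr \<alpha>)))"

subsection \<open>The law of the mass partition and size-biased sampling\<close>

text \<open>\<open>f\<close> stands for the stable density and \<open>K t\<close> for PD\<open>(\<alpha>|t)\<close>.\<close>

definition P1_law ::
  "real \<Rightarrow> real \<Rightarrow> (real \<Rightarrow> real) \<Rightarrow> (real \<Rightarrow> (nat \<Rightarrow> real) measure) \<Rightarrow> (nat \<Rightarrow> real) measure" where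
  "P1_law \<alpha> lam f K =
     scale_measure (ennreal (lam powr (1 - \<alpha>) / \<alpha> * exp (lam powr \<alpha>)))
       (Giry_Monad.bind
         (density lborel (\<lambda>t. indicator {0<..} t * ennreal (t * exp (- lam * t) * f t))) K)"

text \<open>\<open>I k\<close> is the index in the mass partition \<open>P\<close> of the mass picked at step \<open>k\<close>: conditionally on \<open>P\<close>
  and on the earlier picks, each remaining index is chosen with probability proportional to its
  mass.  \<open>Pt\<close> is the resulting sequence of picked masses.\<close>

definition size_biased_sample ::
  "'w measure \<Rightarrow> ('w \<Rightarrow> nat \<Rightarrow> real) \<Rightarrow> (nat \<Rightarrow> 'w \<Rightarrow> nat) \<Rightarrow> ('w \<Rightarrow> nat \<Rightarrow> real) \<Rightarrow> bool" where
  "size_biased_sample M P I Pt \<longleftrightarrow>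
     (\<forall>k. I k \<in> measurable M (count_space UNIV)) \<and>
     (\<forall>k i. AE \<omega> in M.
        real_cond_exp M
          (generated_by M (seq_space \<Otimes>\<^sub>M PiM {..<k} (\<lambda>_. count_space UNIV))
             (\<lambda>\<omega>. (P \<omega>, \<lambda>l\<in>{..<k}. I l \<omega>)))
          (indicator {\<omega> \<in> space M. I k \<omega> = i}) \<omega> =
        (if i \<in> (\<lambda>l. I l \<omega>) ` {..<k} then 0
         else P \<omega> i / (\<Sum>\<^sub>\<infinity>j\<in>- (\<lambda>l. I l \<omega>) ` {..<k}. P \<omega> j))) \<and>
     (\<forall>\<omega>\<in>space M. \<forall>k. Pt \<omega> k = P \<omega> (I k \<omega>))"

subsection \<open>The stick-breaking factors\<close>

definition beta_density :: "real \<Rightarrow> real \<Rightarrow> real \<Rightarrow> real" where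
  "beta_density a b x =
     (if 0 < x \<and> x < 1 then x powr (a - 1) * (1 - x) powr (b - 1) / Beta a b else 0)"

definition arrival :: "(nat \<Rightarrow> 'w \<Rightarrow> real) \<Rightarrow> nat \<Rightarrow> 'w \<Rightarrow> real" where
  "arrival e k \<omega> = (\<Sum>i<k. e i \<omega>)"

definition R_ratio :: "real \<Rightarrow> real \<Rightarrow> (nat \<Rightarrow> 'w \<Rightarrow> real) \<Rightarrow> nat \<Rightarrow> 'w \<Rightarrow> real" where
  "R_ratio \<alpha> lam e k \<omega> =
     ((arrival e k \<omega> + lam powr \<alpha>) / (arrival e (Suc k) \<omega> + lam powr \<alpha>)) powr (1 / \<alpha>)"

definition stick_factor :: "real \<Rightarrow> real \<Rightarrow> real" where
  "stick_factor b r = 1 / (b * ((1 - r) / r) + 1)"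

definition stick_factor_density :: "real \<Rightarrow> real \<Rightarrow> real \<Rightarrow> real" where
  "stick_factor_density \<alpha> r w =
     (if r < w \<and> w < 1
      then 1 / (Gamma (1 - \<alpha>) * Gamma \<alpha>) *
           w powr (- 1) * (1 - w) powr (- \<alpha>) * (w - r) powr (\<alpha> - 1) * r powr (1 - \<alpha>)
      else 0)"

end

theory Submission
  imports Defs
begin

text \<open>
Put \<open>c(\<lambda>) = \<lambda>\<^sup>1\<^sup>-\<^sup>\<alpha> exp(\<lambda>\<^sup>\<alpha>) / \<alpha>\<close>.  Averaging the conditional laws shows that the law of the mass
partition is the law of the normalized jumps \<open>A\<^sub>k / S\<close> after the change of measure with density
\<open>c(\<lambda>) S exp(- \<lambda> S)\<close> (\<open>P1_law_eq_tilted_law\<close>); call it \<open>T\<^sub>\<lambda>\<close>.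

The reason for the theorem is that the family \<open>(T\<^sub>\<lambda>)\<close> is closed under size-biased deletion
(\<open>size_biased_pick_recursion\<close>): after a size-biased pick from \<open>T\<^sub>\<lambda>\<close> the renormalized remainder
has law \<open>T\<^sub>U\<close> given a new random tilt \<open>U\<close>, and the surviving fraction of the total mass is \<open>stick_factor \<beta> (\<lambda> / U)\<close>, where \<open>U\<^sup>\<alpha> - \<lambda>\<^sup>\<alpha>\<close> is
standard exponential and \<open>\<beta>\<close>, of law Beta\<open>(1 - \<alpha>, \<alpha>)\<close>, is independent of \<open>U\<close> and of the remainder.
Indeed, the probability of picking a jump \<open>s\<close> is \<open>s\<close> divided by the total of all jumps, which cancels the
factor of the tilt that is linear in the total.  By the Mecke formula, therefore, the picked jump \<open>s\<close> and the
configuration of the others, whose sum is now called \<open>S\<close>, have joint density proportional to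
\<open>s\<^sup>-\<^sup>\<alpha> exp(- \<lambda> (s + S))\<close> with respect to \<open>ds\<close> and the law of the
configuration.  With the ratio \<open>x = s / S\<close> in place of \<open>s\<close> the density is
\<open>x\<^sup>-\<^sup>\<alpha> S\<^sup>1\<^sup>-\<^sup>\<alpha> exp(- y S)\<close>, where \<open>y = \<lambda> (1 + x)\<close>.  By a gamma integral,
\<open>S\<^sup>1\<^sup>-\<^sup>\<alpha> exp(- y S)\<close> is the mixture of the tilts \<open>S exp(- u S)\<close> over \<open>u > y\<close> with weight proportional to
\<open>(u - y)\<^sup>\<alpha>\<^sup>-\<^sup>1\<close> (\<open>powr_exp_mixture\<close>): the remainder sees only \<open>u\<close>, and the density of \<open>(x, u)\<close> splits into the
law of \<open>U\<close> and, for \<open>b = x \<lambda> / (u - \<lambda>)\<close>, the beta density (\<open>tilted_pick_mixture\<close>).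

Iteration gives \<open>U\<^sub>k = (\<lambda>\<^sup>\<alpha> + e\<^sub>1 + \<dots> + e\<^sub>k)\<^sup>1\<^sup>/\<^sup>\<alpha>\<close> and the ratios \<open>R\<^sub>k = U\<^sub>k\<^sub>-\<^sub>1 / U\<^sub>k\<close>.  Both sides of the
asserted identity in law are therefore solutions of one recursion in the number of picks,
\<open>factors_in\<close>: for the partition see \<open>picks_in_tilted_law\<close>, for the product formula see \<open>factors_law\<close>.
That the sampling scheme realizes iterated size-biased deletion is \<open>survivals_law\<close>; the surviving fractions
\<open>1 - p\<^sub>k / (1 - p\<^sub>1 - \<dots> - p\<^sub>k\<^sub>-\<^sub>1)\<close> of the picked masses \<open>p\<^sub>1, p\<^sub>2, \<dots>\<close>, rather than the masses themselves,
are compared with the factors, because deletion of the first pick only shifts them.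

The conditional statements hold because the \<open>\<beta>\<^sub>k\<close> are independent of each other and of the ratios
(\<open>factors_joint\<close>).  The factors are dependent because a small \<open>W\<^sub>1\<close> forces \<open>U\<^sub>1\<close> to be large, which makes
\<open>R\<^sub>2\<close> likely to be close to 1, and \<open>W\<^sub>2 \<ge> R\<^sub>2\<close> (\<open>factors_not_indep\<close>).
\<close>

section \<open>Deletion from ranked sequences\<close>

lemma seq_measurableI:
  assumes "\<And>i. (\<lambda>x. f x i) \<in> borel_measurable M"
  shows "f \<in> measurable M seq_space"
  using assms by (intro measurable_PiM_single') auto

lemma seq_measurable_coord: "(\<lambda>a. a i) \<in> borel_measurable seq_space"
  by (rule measurable_component_singleton) simp

lemma space_seq_space [simp]: "space seq_space = UNIV"
  by (simp add: space_PiM)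

text \<open>Events \<open>{c. \<forall>j\<in>F. y j \<le> c j}\<close> are closed under intersection and generate the product
\<open>\<sigma>\<close>-algebra.  They suit ranked sequences, for which \<open>y \<le> c j\<close> says that more than \<open>j\<close> terms are at least \<open>y\<close>.\<close>

lemma seq_space_eqI_ge:
  fixes \<mu> \<nu> :: "(nat \<Rightarrow> real) measure"
  assumes \<mu>: "sets \<mu> = sets seq_space" and \<nu>: "sets \<nu> = sets seq_space"
    and fin: "emeasure \<mu> UNIV \<noteq> \<infinity>"
    and eq: "\<And>F y. finite F \<Longrightarrow> emeasure \<mu> {c. \<forall>j\<in>F. y j \<le> c j} = emeasure \<nu> {c. \<forall>j\<in>F. y j \<le> c j}"
  shows "\<mu> = \<nu>"
proof -
  define E where "E = {{c. \<forall>j\<in>F. y j \<le> c j} | (F :: nat set) (y :: nat \<Rightarrow> real). finite F}"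
  have UNIV_E: "UNIV \<in> E"
    unfolding E_def by (rule CollectI, rule exI[of _ "{}"]) auto
  have "Int_stable E"
  proof (rule Int_stableI)
    fix a b assume "a \<in> E" "b \<in> E"
    then obtain F y G z where a: "a = {c. \<forall>j\<in>F. y j \<le> c j}" "finite F"
      and b: "b = {c. \<forall>j\<in>G. z j \<le> c j}" "finite G"
      unfolding E_def by auto
    define w where "w j = (if j \<in> F then if j \<in> G then max (y j) (z j) else y j else z j)" for j
    have "a \<inter> b = {c. \<forall>j\<in>F \<union> G. w j \<le> c j}"
      unfolding a b w_def by auto
    then show "a \<inter> b \<in> E"
      unfolding E_def using a(2) b(2) by blast
  qed
  have gen: "sets seq_space = sigma_sets UNIV E"
  proof (intro equalityI)
    have "(\<lambda>c. c) \<in> measurable (sigma UNIV E) seq_space"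
    proof (rule seq_measurableI)
      fix i
      have "{w \<in> UNIV. a \<le> w i} \<in> sigma_sets UNIV E" for a :: real
      proof -
        have "{w \<in> UNIV. a \<le> w i} = {c. \<forall>j\<in>{i}. (\<lambda>_. a) j \<le> c j}" by auto
        then show ?thesis
          unfolding E_def by (intro sigma_sets.Basic CollectI exI[of _ "{i}"] exI[of _ "\<lambda>_. a"]) auto
      qed
      then show "(\<lambda>x. x i) \<in> borel_measurable (sigma UNIV E)"
        by (subst borel_measurable_iff_ge) (auto simp: space_measure_of_conv)
    qed
    from measurable_sets[OF this] show "sets seq_space \<subseteq> sigma_sets UNIV E"
      by (auto simp: space_measure_of_conv)
    have "E \<subseteq> sets seq_space"
    proof
      fix a assume "a \<in> E"
      then obtain F :: "nat set" and y :: "nat \<Rightarrow> real"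
        where a: "a = {c \<in> space seq_space. \<forall>j\<in>F. y j \<le> c j}" and [measurable]: "finite F"
        unfolding E_def by auto
      show "a \<in> sets seq_space" unfolding a by measurable
    qed
    from sets.sigma_sets_subset[OF this] show "sigma_sets UNIV E \<subseteq> sets seq_space"
      by simp
  qed
  show ?thesis
  proof (rule measure_eqI_generator_eq[where E = E and \<Omega> = UNIV and A = "\<lambda>_. UNIV"])
    show "emeasure \<mu> X = emeasure \<nu> X" if "X \<in> E" for X
      using that eq unfolding E_def by auto
  qed (use \<open>Int_stable E\<close> gen \<mu> \<nu> fin UNIV_E in auto)
qed

text \<open>The increasing bijection from the indices to those other than \<open>k\<close>.\<close>

definition skip :: "nat \<Rightarrow> nat \<Rightarrow> nat" where
  "skip k j = (if j < k then j else Suc j)"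

text \<open>Deletion keeps a decreasing sequence decreasing, so that a ranked sequence with one of its points
removed is again a ranked sequence and no space of point configurations is needed.\<close>

definition del :: "nat \<Rightarrow> (nat \<Rightarrow> 'a) \<Rightarrow> nat \<Rightarrow> 'a" where
  "del k a j = a (skip k j)"

definition cnt :: "'a set \<Rightarrow> (nat \<Rightarrow> 'a) \<Rightarrow> nat" where
  "cnt B a = card {k. a k \<in> B}"

lemma inj_skip: "inj (skip k)"
  by (auto simp: inj_def skip_def split: if_splits)

lemma range_skip: "range (skip k) = - {k}"
proof -
  have "j \<in> range (skip k)" if "j \<noteq> k" for j
    by (rule image_eqI[of _ _ "if j < k then j else j - 1"]) (use that in \<open>auto simp: skip_def\<close>)
  then show ?thesis by (auto simp: skip_def)
qed

lemma del_measurable [measurable]: "del k \<in> measurable seq_space seq_space"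
  unfolding del_def by (intro seq_measurableI) measurable

lemma cnt_measurable [measurable]:
  assumes [measurable]: "B \<in> sets borel"
  shows "cnt B \<in> measurable seq_space (count_space UNIV)"
proof -
  have "{a \<in> space seq_space. i \<in> {k. a k \<in> B}} \<in> sets seq_space" for i
  proof -
    have "(\<lambda>a. a i) -` B \<inter> space seq_space \<in> sets seq_space"
      by (rule measurable_sets[OF seq_measurable_coord]) fact
    then show ?thesis by (simp add: vimage_def)
  qed
  then show ?thesis unfolding cnt_def[abs_def] by (rule measurable_card)
qed

lemma cnt_del:
  assumes "finite {j. a j \<in> B}"
  shows "cnt B a = cnt B (del k a) + (if a k \<in> B then 1 else 0)"
proof -
  have "{j. a j \<in> B} = skip k ` {j. del k a j \<in> B} \<union> (if a k \<in> B then {k} else {})"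
    (is "_ = ?I \<union> ?K")
  proof (intro set_eqI iffI)
    fix j assume j: "j \<in> {j. a j \<in> B}"
    show "j \<in> ?I \<union> ?K"
    proof (cases "j = k")
      case False
      then have "j \<in> range (skip k)" by (simp add: range_skip)
      then obtain i where "j = skip k i" by blast
      with j show ?thesis by (auto simp: del_def)
    qed (use j in auto)
  qed (auto simp: del_def split: if_splits)
  moreover have "?I \<inter> ?K = {}" using range_skip[of k] by auto
  moreover have "finite ?I" using assms calculation(1) by (metis finite_Un)
  ultimately have "card {j. a j \<in> B} = card ?I + card ?K"
    by (metis card_Un_disjoint finite.emptyI finite.insertI)
  then show ?thesis
    by (simp add: cnt_def card_image inj_on_subset[OF inj_skip])
qed

definition ranked :: "(nat \<Rightarrow> real) \<Rightarrow> bool" where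
  "ranked a \<longleftrightarrow> decseq a \<and> (\<forall>k. 0 < a k) \<and> a \<longlonglongrightarrow> 0"

lemma ranked_finite:
  assumes "ranked a" "0 < b" "B \<subseteq> {b..}"
  shows "finite {k. a k \<in> B}"
proof -
  from assms(1,2) have "eventually (\<lambda>k. a k < b) sequentially"
    unfolding ranked_def by (auto dest: order_tendstoD)
  then obtain n where "\<And>k. n \<le> k \<Longrightarrow> a k < b" by (auto simp: eventually_sequentially)
  then have "{k. a k \<in> B} \<subseteq> {..<n}"
    using assms(3) by (auto simp: subset_iff) (meson leD leI)
  then show ?thesis by (rule finite_subset) simp
qed

lemma ranked_ge_iff:
  assumes a: "ranked a" and "0 < y"
  shows "y \<le> a j \<longleftrightarrow> j < cnt {y..} a"
proof -
  have fin: "finite {k. y \<le> a k}" using ranked_finite[OF assms, of "{y..}"] by simp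
  have dec: "i \<le> k \<Longrightarrow> a k \<le> a i" for i k using a by (auto simp: ranked_def decseq_def)
  show ?thesis
  proof
    assume "y \<le> a j"
    then have "{..j} \<subseteq> {k. y \<le> a k}" using dec by (force intro: order_trans)
    from card_mono[OF fin this] show "j < cnt {y..} a" by (simp add: cnt_def)
  next
    assume *: "j < cnt {y..} a"
    show "y \<le> a j"
    proof (rule ccontr)
      assume n: "\<not> y \<le> a j"
      have "{k. y \<le> a k} \<subseteq> {..<j}"
      proof
        fix k assume "k \<in> {k. y \<le> a k}"
        then have "\<not> j \<le> k" using n dec[of j k] by auto
        then show "k \<in> {..<j}" by simp
      qed
      from card_mono[OF _ this] * show False by (simp add: cnt_def)
    qed
  qed
qed

lemma ranked_del: "ranked a \<Longrightarrow> ranked (del k a)"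
proof -
  assume a: "ranked a"
  have "decseq (del k a)"
    using a by (auto simp: ranked_def decseq_def del_def skip_def)
  moreover have "filterlim (skip k) at_top sequentially"
    by (rule filterlim_at_top_mono[OF filterlim_ident]) (auto simp: skip_def)
  then have "(\<lambda>j. a (skip k j)) \<longlonglongrightarrow> 0"
    using a filterlim_compose unfolding ranked_def by blast
  ultimately show ?thesis
    using a by (auto simp: ranked_def del_def[abs_def])
qed

lemma cnt_Union:
  assumes "finite \<J>" "disjoint \<J>" "\<And>B. B \<in> \<J> \<Longrightarrow> finite {k. a k \<in> B}"
  shows "cnt (\<Union>\<J>) a = (\<Sum>B\<in>\<J>. cnt B a)"
proof -
  have "{k. a k \<in> \<Union>\<J>} = (\<Union>B\<in>\<J>. {k. a k \<in> B})" by auto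
  moreover have "card (\<Union>B\<in>\<J>. {k. a k \<in> B}) = (\<Sum>B\<in>\<J>. card {k. a k \<in> B})"
    by (rule card_UN_disjoint) (use assms in \<open>auto simp: disjoint_def\<close>)
  ultimately show ?thesis by (simp add: cnt_def)
qed

text \<open>Finitely many thresholds cut the half-line into cells, a cell being the set of points that lie above
exactly the same thresholds.  Numbers of points above the thresholds are then sums of numbers of points in
disjoint sets.  The cell below all thresholds is left out, since its intensity may be infinite.\<close>

lemma threshold_cells:
  fixes T :: "real set"
  assumes "finite T" "\<And>t. t \<in> T \<Longrightarrow> 0 < t"
  obtains \<J> where "finite \<J>" "disjoint \<J>"
    "\<And>B. B \<in> \<J> \<Longrightarrow> B \<in> sets borel" "\<And>B. B \<in> \<J> \<Longrightarrow> \<exists>b>0. B \<subseteq> {b..}"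
    "\<And>t. t \<in> T \<Longrightarrow> {t..} = \<Union>{B \<in> \<J>. B \<subseteq> {t..}}"
proof -
  define cell where "cell J = {s. {t \<in> T. t \<le> s} = J}" for J
  define \<J> where "\<J> = cell ` (Pow T - {{}})"
  show thesis
  proof (rule that[of \<J>])
    show "finite \<J>" using assms by (simp add: \<J>_def)
    show "disjoint \<J>" by (auto simp: \<J>_def cell_def disjoint_def)
    show "B \<in> sets borel" if B: "B \<in> \<J>" for B
    proof -
      obtain J where J: "B = cell J" "J \<subseteq> T" using B by (auto simp: \<J>_def)
      have "cell J = {s. \<forall>t\<in>T. (t \<in> J \<longrightarrow> t \<le> s) \<and> (t \<notin> J \<longrightarrow> s < t)}"
        unfolding cell_def using J(2) by (auto simp: set_eq_iff not_le)
      also have "\<dots> \<in> sets borel" using assms(1) by measurable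
      finally show ?thesis by (simp add: J)
    qed
    show "\<exists>b>0. B \<subseteq> {b..}" if "B \<in> \<J>" for B
    proof -
      obtain J t where J: "B = cell J" "t \<in> J" "t \<in> T" using \<open>B \<in> \<J>\<close> by (auto simp: \<J>_def)
      then show ?thesis using assms(2)[of t] by (auto simp: cell_def)
    qed
    show "{t..} = \<Union>{B \<in> \<J>. B \<subseteq> {t..}}" if t: "t \<in> T" for t
    proof (intro equalityI subsetI)
      fix s assume "s \<in> {t..}"
      then have "s \<in> cell {u \<in> T. u \<le> s}" "t \<in> {u \<in> T. u \<le> s}" using t by (auto simp: cell_def)
      moreover from this(2) have "cell {u \<in> T. u \<le> s} \<subseteq> {t..}" by (auto simp: cell_def)
      ultimately show "s \<in> \<Union>{B \<in> \<J>. B \<subseteq> {t..}}" using t by (auto simp: \<J>_def)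
    qed auto
  qed
qed

section \<open>The Mecke formula for ranked Poisson points\<close>

text \<open>The points of a Poisson process with intensity \<open>\<nu>\<close> on \<open>(0,\<infinity>)\<close>, of finite mass away from 0,
in decreasing order.\<close>

locale ranked_poisson = prob_space M for M :: "'a measure" +
  fixes \<nu> :: "real measure" and A :: "nat \<Rightarrow> 'a \<Rightarrow> real"
  assumes sets_intensity [measurable_cong, simp]: "sets \<nu> = sets borel"
    and intensity_nonpos: "emeasure \<nu> {..0} = 0"
    and intensity_finite: "\<And>b. 0 < b \<Longrightarrow> emeasure \<nu> {b..} < \<infinity>"
    and A_measurable [measurable]: "\<And>k. A k \<in> borel_measurable M"
    and A_ranked: "AE \<omega> in M. ranked (\<lambda>k. A k \<omega>)"
    and counts: "\<And>\<J> n. finite \<J> \<Longrightarrow> disjoint \<J> \<Longrightarrow>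
      (\<And>B. B \<in> \<J> \<Longrightarrow> B \<in> sets borel \<and> (\<exists>b>0. B \<subseteq> {b..})) \<Longrightarrow>
      prob {\<omega> \<in> space M. \<forall>B\<in>\<J>. cnt B (\<lambda>k. A k \<omega>) = n B} =
      (\<Prod>B\<in>\<J>. measure \<nu> B ^ n B / fact (n B) * exp (- measure \<nu> B))"
begin

lemma A_seq_measurable [measurable]: "(\<lambda>\<omega> k. A k \<omega>) \<in> measurable M seq_space"
  by (intro seq_measurableI) simp

lemma space_intensity [simp]: "space \<nu> = UNIV"
  using sets_eq_imp_space_eq[OF sets_intensity] by simp

lemma nn_integral_counts:
  fixes \<phi> :: "(real set \<Rightarrow> nat) \<Rightarrow> ennreal"
  assumes \<J>: "finite \<J>" "disjoint \<J>"
      "\<And>B. B \<in> \<J> \<Longrightarrow> B \<in> sets borel" "\<And>B. B \<in> \<J> \<Longrightarrow> \<exists>b>0. B \<subseteq> {b..}"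
  shows "(\<integral>\<^sup>+ \<omega>. \<phi> (\<lambda>B\<in>\<J>. cnt B (\<lambda>k. A k \<omega>)) \<partial>M) =
    (\<integral>\<^sup>+ n. \<phi> n * ennreal (\<Prod>B\<in>\<J>. measure \<nu> B ^ n B / fact (n B) * exp (- measure \<nu> B))
      \<partial>count_space (PiE \<J> (\<lambda>_. UNIV)))"
proof -
  let ?c = "\<lambda>\<omega>. \<lambda>B\<in>\<J>. cnt B (\<lambda>k. A k \<omega>)"
  let ?S = "PiE \<J> (\<lambda>_. UNIV :: nat set)"
  let ?E = "\<lambda>n. {\<omega> \<in> space M. \<forall>B\<in>\<J>. cnt B (\<lambda>k. A k \<omega>) = n B}"
  have cS: "?c \<omega> \<in> ?S" for \<omega> by auto
  have E: "?E n \<in> sets M" for n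
  proof -
    have [measurable]: "(\<lambda>\<omega>. cnt B (\<lambda>k. A k \<omega>)) \<in> measurable M (count_space UNIV)" if "B \<in> \<J>" for B
      by (rule measurable_compose[OF A_seq_measurable cnt_measurable]) (rule \<J>(3)[OF that])
    show ?thesis using \<J>(1) by measurable
  qed
  have "\<phi> (?c \<omega>) = (\<integral>\<^sup>+ n. \<phi> n * indicator (?E n) \<omega> \<partial>count_space ?S)" if "\<omega> \<in> space M" for \<omega>
  proof -
    have *: "indicator (?E n) \<omega> = (indicator {?c \<omega>} n :: ennreal)" if "n \<in> ?S" for n
    proof -
      have "n = ?c \<omega> \<longleftrightarrow> (\<forall>B\<in>\<J>. cnt B (\<lambda>k. A k \<omega>) = n B)"
        using that by (auto simp: PiE_def extensional_def fun_eq_iff restrict_def)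
      then show ?thesis using \<open>\<omega> \<in> space M\<close> by (simp add: indicator_def)
    qed
    have "(\<integral>\<^sup>+ n. \<phi> n * indicator (?E n) \<omega> \<partial>count_space ?S)
        = (\<integral>\<^sup>+ n. \<phi> n * indicator {?c \<omega>} n \<partial>count_space ?S)"
      by (intro nn_integral_cong) (simp add: *)
    also have "\<dots> = \<phi> (?c \<omega>)"
      by (subst nn_integral_indicator_singleton) (use cS[of \<omega>] in auto)
    finally show ?thesis by simp
  qed
  then have "(\<integral>\<^sup>+ \<omega>. \<phi> (?c \<omega>) \<partial>M) = (\<integral>\<^sup>+ \<omega>. (\<integral>\<^sup>+ n. \<phi> n * indicator (?E n) \<omega> \<partial>count_space ?S) \<partial>M)"
    by (intro nn_integral_cong)
  also have "\<dots> = (\<integral>\<^sup>+ n. (\<integral>\<^sup>+ \<omega>. \<phi> n * indicator (?E n) \<omega> \<partial>M) \<partial>count_space ?S)"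
    using E \<J>(1) by (intro nn_integral_count_space_nn_integral countable_PiE) auto
  also have "\<dots> = (\<integral>\<^sup>+ n. \<phi> n * ennreal (prob (?E n)) \<partial>count_space ?S)"
    by (intro nn_integral_cong, subst nn_integral_cmult_indicator) (use E in \<open>auto simp: emeasure_eq_measure\<close>)
  also have "\<dots> = (\<integral>\<^sup>+ n. \<phi> n * ennreal (\<Prod>B\<in>\<J>. measure \<nu> B ^ n B / fact (n B) * exp (- measure \<nu> B))
      \<partial>count_space ?S)"
    by (intro nn_integral_cong) (simp add: counts[OF \<J>(1,2)] \<J>)
  finally show ?thesis .
qed

text \<open>For a Poisson variable \<open>n\<close> with mean \<open>m\<close>, size-biasing adds one: \<open>E (n \<phi>(n - 1)) = m E \<phi>(n)\<close>, because
\<open>(k + 1) m\<^sup>k\<^sup>+\<^sup>1 / (k + 1)! = m m\<^sup>k / k!\<close>.  The same holds for one coordinate of a vector of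
independent Poisson counts.\<close>

lemma counts_size_bias:
  fixes D :: "(real set \<Rightarrow> nat) \<Rightarrow> bool"
  assumes \<J>: "finite \<J>" "disjoint \<J>"
      "\<And>B. B \<in> \<J> \<Longrightarrow> B \<in> sets borel" "\<And>B. B \<in> \<J> \<Longrightarrow> \<exists>b>0. B \<subseteq> {b..}"
    and J: "J \<in> \<J>"
  defines "c \<equiv> \<lambda>\<omega>. \<lambda>B\<in>\<J>. cnt B (\<lambda>k. A k \<omega>)"
  shows "(\<integral>\<^sup>+ \<omega>. of_nat (c \<omega> J) * of_bool (D ((c \<omega>)(J := c \<omega> J - 1))) \<partial>M) =
    emeasure \<nu> J * (\<integral>\<^sup>+ \<omega>. of_bool (D (c \<omega>)) \<partial>M)"
proof -
  let ?S = "PiE \<J> (\<lambda>_. UNIV :: nat set)"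
  let ?q = "\<lambda>B k. measure \<nu> B ^ k / fact k * exp (- measure \<nu> B)"
  let ?p = "\<lambda>n. \<Prod>B\<in>\<J>. ?q B (n B)"
  let ?\<phi> = "\<lambda>n. of_nat (n J) * of_bool (D (n(J := n J - 1))) :: ennreal"
  define g where "g n = n(J := Suc (n J))" for n :: "real set \<Rightarrow> nat"
  have fin: "emeasure \<nu> J < \<infinity>"
  proof -
    obtain b where "0 < b" "J \<subseteq> {b..}" using \<J>(4)[OF J] by auto
    then show ?thesis
      using emeasure_mono[of J "{b..}" \<nu>] intensity_finite[of b] by (auto simp: less_top[symmetric] top_unique)
  qed
  have p0: "0 \<le> ?p n" for n by (intro prod_nonneg) auto
  have pg: "real (Suc (n J)) * ?p (g n) = measure \<nu> J * ?p n" for n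
  proof -
    \<comment> \<open>The factor from the counts other than that of \<open>J\<close>.\<close>
    define r where "r = (\<Prod>B\<in>\<J>-{J}. ?q B (n B))"
    have 1: "?p (g n) = ?q J (Suc (n J)) * r"
      unfolding r_def by (subst prod.remove[OF \<J>(1) J]) (auto simp: g_def intro!: prod.cong)
    have 2: "?p n = ?q J (n J) * r"
      unfolding r_def by (rule prod.remove[OF \<J>(1) J])
    have 3: "real (Suc (n J)) * ?q J (Suc (n J)) = measure \<nu> J * ?q J (n J)"
    proof -
      have "(fact (Suc m) :: real) = real (Suc m) * fact m" for m by simp
      then show ?thesis by (simp add: divide_simps del: fact_Suc of_nat_Suc)
    qed
    have "real (Suc (n J)) * ?p (g n) = (real (Suc (n J)) * ?q J (Suc (n J))) * r"
      unfolding 1 by (rule mult.assoc[symmetric])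
    also have "\<dots> = measure \<nu> J * ?p n"
      unfolding 3 2 by (rule mult.assoc)
    finally show ?thesis .
  qed
  \<comment> \<open>Summands with \<open>n J = 0\<close> vanish, and raising the count of \<open>J\<close> by one reaches all others.\<close>
  have bij: "bij_betw g ?S {n \<in> ?S. 0 < n J}"
  proof (rule bij_betwI[where g = "\<lambda>n. n(J := n J - 1)"])
    show "g \<in> ?S \<rightarrow> {n \<in> ?S. 0 < n J}"
      using J by (auto simp: g_def PiE_def extensional_def)
    show "(\<lambda>n. n(J := n J - 1)) \<in> {n \<in> ?S. 0 < n J} \<rightarrow> ?S"
      using J by (auto simp: PiE_def extensional_def)
  qed (auto simp: g_def)
  have "(\<integral>\<^sup>+ \<omega>. ?\<phi> (c \<omega>) \<partial>M) = (\<integral>\<^sup>+ n. ?\<phi> n * ennreal (?p n) \<partial>count_space ?S)"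
    unfolding c_def by (rule nn_integral_counts[OF \<J>])
  also have "\<dots> = (\<integral>\<^sup>+ n. ?\<phi> n * ennreal (?p n) \<partial>count_space {n \<in> ?S. 0 < n J})"
    by (rule nn_integral_count_space_eq) auto
  also have "\<dots> = (\<integral>\<^sup>+ n. ?\<phi> (g n) * ennreal (?p (g n)) \<partial>count_space ?S)"
    by (rule nn_integral_bij_count_space[OF bij, symmetric])
  also have "\<dots> = (\<integral>\<^sup>+ n. emeasure \<nu> J * (of_bool (D n) * ennreal (?p n)) \<partial>count_space ?S)"
  proof (intro nn_integral_cong)
    fix n
    have "?\<phi> (g n) * ennreal (?p (g n)) = of_bool (D n) * (ennreal (real (Suc (n J))) * ennreal (?p (g n)))"
      by (simp add: g_def mult.assoc mult.commute mult.left_commute ennreal_of_nat_eq_real_of_nat)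
    also have "ennreal (real (Suc (n J))) * ennreal (?p (g n)) = emeasure \<nu> J * ennreal (?p n)"
      using pg[of n] p0 fin
      by (simp add: ennreal_mult'[symmetric] emeasure_eq_ennreal_measure ennreal_mult[symmetric] del: of_nat_Suc)
    finally show "?\<phi> (g n) * ennreal (?p (g n)) = emeasure \<nu> J * (of_bool (D n) * ennreal (?p n))"
      by (simp only: mult.left_commute[of "emeasure \<nu> J"])
  qed
  also have "\<dots> = emeasure \<nu> J * (\<integral>\<^sup>+ n. of_bool (D n) * ennreal (?p n) \<partial>count_space ?S)"
    by (rule nn_integral_cmult) simp
  also have "(\<integral>\<^sup>+ n. of_bool (D n) * ennreal (?p n) \<partial>count_space ?S) = (\<integral>\<^sup>+ \<omega>. of_bool (D (c \<omega>)) \<partial>M)"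
    unfolding c_def by (rule nn_integral_counts[OF \<J>, symmetric])
  finally show ?thesis .
qed

text \<open>The Mecke formula on the generating events: deleting a point of the cell \<open>J\<close> lowers the count of \<open>J\<close>
by one and leaves the other counts, so \<open>counts_size_bias\<close> applies cell by cell.\<close>

lemma Mecke_thresholds:
  fixes y :: "nat \<Rightarrow> real"
  assumes b: "0 < b" and F: "finite F"
  shows "(\<integral>\<^sup>+ \<omega>. (\<Sum>k. of_bool (b \<le> A k \<omega> \<and> (\<forall>j\<in>F. y j \<le> del k (\<lambda>k. A k \<omega>) j))) \<partial>M) =
    emeasure \<nu> {b..} * (\<integral>\<^sup>+ \<omega>. of_bool (\<forall>j\<in>F. y j \<le> A j \<omega>) \<partial>M)"
proof -
  \<comment> \<open>Thresholds \<open>y j \<le> 0\<close> impose nothing, since the points are positive.\<close>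
  obtain \<J> where \<J>: "finite \<J>" "disjoint \<J>"
    "\<And>B. B \<in> \<J> \<Longrightarrow> B \<in> sets borel" "\<And>B. B \<in> \<J> \<Longrightarrow> \<exists>b>0. B \<subseteq> {b..}"
    "\<And>t. t \<in> insert b {t \<in> y ` F. 0 < t} \<Longrightarrow> {t..} = \<Union>{B \<in> \<J>. B \<subseteq> {t..}}"
    by (rule threshold_cells[of "insert b {t \<in> y ` F. 0 < t}"]) (use b F in auto)
  define K where "K = {B \<in> \<J>. B \<subseteq> {b..}}"
  have K: "finite K" "K \<subseteq> \<J>" using \<J>(1) by (auto simp: K_def)
  have Kb: "{b..} = \<Union>K" unfolding K_def by (rule \<J>(5)) simp
  define C where "C a = (\<lambda>B\<in>\<J>. cnt B a)" for a :: "nat \<Rightarrow> real"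
  define D where "D n \<longleftrightarrow> (\<forall>j\<in>F. 0 < y j \<longrightarrow> j < (\<Sum>B\<in>{B \<in> \<J>. B \<subseteq> {y j..}}. n B))"
    for n :: "real set \<Rightarrow> nat"
  have finB: "finite {k. a k \<in> B}" if "ranked a" "B \<in> \<J>" for a B
    using \<J>(4)[OF that(2)] ranked_finite[OF that(1)] by blast
  have DC: "(\<forall>j\<in>F. y j \<le> a j) \<longleftrightarrow> D (C a)" if a: "ranked a" for a
  proof -
    have "y j \<le> a j \<longleftrightarrow> (0 < y j \<longrightarrow> j < (\<Sum>B\<in>{B \<in> \<J>. B \<subseteq> {y j..}}. C a B))" if "j \<in> F" for j
    proof (cases "0 < y j")
      case True
      have "cnt {y j..} a = cnt (\<Union>{B \<in> \<J>. B \<subseteq> {y j..}}) a"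
        using \<J>(5)[of "y j"] True \<open>j \<in> F\<close> by (intro arg_cong2[where f = cnt] refl) auto
      also have "\<dots> = (\<Sum>B\<in>{B \<in> \<J>. B \<subseteq> {y j..}}. cnt B a)"
        by (rule cnt_Union) (use \<J>(1,2) finB[OF a] in \<open>auto simp: disjoint_def\<close>)
      also have "\<dots> = (\<Sum>B\<in>{B \<in> \<J>. B \<subseteq> {y j..}}. C a B)"
        by (intro sum.cong) (auto simp: C_def)
      finally show ?thesis using ranked_ge_iff[OF a True] True by simp
    next
      case False
      moreover have "0 < a j" using a by (simp add: ranked_def)
      ultimately show ?thesis by simp
    qed
    then show ?thesis unfolding D_def by blast
  qed
  have del: "C (del k a) = (C a)(J := C a J - 1)" if a: "ranked a" and J: "J \<in> \<J>" "a k \<in> J" for a J k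
  proof
    fix B
    show "C (del k a) B = ((C a)(J := C a J - 1)) B"
    proof (cases "B \<in> \<J>")
      case True
      have "B = J \<or> a k \<notin> B" using \<J>(2) True J by (auto simp: disjoint_def)
      then show ?thesis using cnt_del[OF finB[OF a True], of k] True J by (auto simp: C_def)
    qed (use J in \<open>auto simp: C_def\<close>)
  qed
  have main: "(\<Sum>k. of_bool (b \<le> a k \<and> (\<forall>j\<in>F. y j \<le> del k a j)) :: ennreal) =
      (\<Sum>J\<in>K. of_nat (C a J) * of_bool (D ((C a)(J := C a J - 1))))" if a: "ranked a" for a
  proof -
    have "(of_bool (b \<le> a k \<and> (\<forall>j\<in>F. y j \<le> del k a j)) :: ennreal) =
      (\<Sum>J\<in>K. indicator J (a k) * of_bool (D ((C a)(J := C a J - 1))))" for k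
    proof -
      have "(of_bool (b \<le> a k \<and> (\<forall>j\<in>F. y j \<le> del k a j)) :: ennreal) =
          indicator (\<Union>(id ` K)) (a k) * of_bool (D (C (del k a)))"
        using DC[OF ranked_del[OF a], of k] Kb by (auto simp: indicator_def)
      also have "indicator (\<Union>(id ` K)) (a k) = (\<Sum>J\<in>K. indicator J (a k) :: ennreal)"
        by (subst indicator_UN_disjoint)
           (use K \<J>(2) in \<open>auto simp: disjoint_family_on_def disjoint_def\<close>)
      also have "\<dots> * of_bool (D (C (del k a))) =
          (\<Sum>J\<in>K. indicator J (a k) * of_bool (D ((C a)(J := C a J - 1))))"
        unfolding sum_distrib_right
        by (intro sum.cong refl) (use del[OF a] K in \<open>auto simp: indicator_def\<close>)
      finally show ?thesis .
    qed
    then have "(\<Sum>k. of_bool (b \<le> a k \<and> (\<forall>j\<in>F. y j \<le> del k a j)) :: ennreal) =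
        (\<Sum>k. \<Sum>J\<in>K. indicator J (a k) * of_bool (D ((C a)(J := C a J - 1))))"
      by simp
    also have "\<dots> = (\<Sum>J\<in>K. \<Sum>k. indicator J (a k) * of_bool (D ((C a)(J := C a J - 1))))"
      by (rule suminf_sum) simp
    also have "\<dots> = (\<Sum>J\<in>K. of_nat (C a J) * of_bool (D ((C a)(J := C a J - 1))))"
    proof (intro sum.cong refl)
      fix J assume J: "J \<in> K"
      have "(\<Sum>k. indicator J (a k) :: ennreal) = (\<Sum>k\<in>{k. a k \<in> J}. indicator J (a k))"
        by (rule suminf_finite) (use finB[OF a] J K in auto)
      also have "\<dots> = of_nat (C a J)"
        using J K by (simp add: C_def cnt_def subset_eq)
      finally show "(\<Sum>k. indicator J (a k) * of_bool (D ((C a)(J := C a J - 1)))) =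
          (of_nat (C a J) * of_bool (D ((C a)(J := C a J - 1))) :: ennreal)"
        by (simp add: ennreal_suminf_multc)
    qed
    finally show ?thesis .
  qed
  have cm: "(\<lambda>\<omega>. cnt B (\<lambda>k. A k \<omega>)) \<in> measurable M (count_space UNIV)" if "B \<in> \<J>" for B
    by (rule measurable_compose[OF A_seq_measurable cnt_measurable]) (rule \<J>(3)[OF that])
  have DM: "(\<lambda>\<omega>. of_nat (C (\<lambda>k. A k \<omega>) J) *
      of_bool (D ((C (\<lambda>k. A k \<omega>))(J := C (\<lambda>k. A k \<omega>) J - 1))) :: ennreal) \<in> borel_measurable M"
    if J: "J \<in> \<J>" for J
  proof -
    have [measurable]: "(\<lambda>\<omega>. C (\<lambda>k. A k \<omega>) B) \<in> measurable M (count_space UNIV)" if "B \<in> \<J>" for B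
      using cm[OF that] that by (simp add: C_def)
    have 1: "(\<lambda>\<omega>. ((C (\<lambda>k. A k \<omega>))(J := C (\<lambda>k. A k \<omega>) J - 1)) B) \<in> measurable M (count_space UNIV)"
      if "B \<in> \<J>" for B
    proof (cases "B = J")
      case True
      show ?thesis unfolding True using J by simp
    next
      case False
      then show ?thesis using that by simp
    qed
    have 2: "Measurable.pred M (\<lambda>\<omega>. j < (\<Sum>B\<in>{B \<in> \<J>. B \<subseteq> {y j..}}. ((C (\<lambda>k. A k \<omega>))(J := C (\<lambda>k. A k \<omega>) J - 1)) B))" for j
    proof -
      have "(\<lambda>\<omega>. (\<Sum>B\<in>{B \<in> \<J>. B \<subseteq> {y j..}}. ((C (\<lambda>k. A k \<omega>))(J := C (\<lambda>k. A k \<omega>) J - 1)) B))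
          \<in> borel_measurable M"
        by (intro borel_measurable_sum measurable_compose[OF 1]) auto
      then show ?thesis by measurable
    qed
    have "Measurable.pred M (\<lambda>\<omega>. D ((C (\<lambda>k. A k \<omega>))(J := C (\<lambda>k. A k \<omega>) J - 1)))"
      unfolding D_def using F 2 by (intro pred_intros_finite) auto
    moreover note J
    ultimately show ?thesis by measurable
  qed
  have "(\<integral>\<^sup>+ \<omega>. (\<Sum>k. of_bool (b \<le> A k \<omega> \<and> (\<forall>j\<in>F. y j \<le> del k (\<lambda>k. A k \<omega>) j))) \<partial>M) =
      (\<integral>\<^sup>+ \<omega>. (\<Sum>J\<in>K. of_nat (C (\<lambda>k. A k \<omega>) J) *
        of_bool (D ((C (\<lambda>k. A k \<omega>))(J := C (\<lambda>k. A k \<omega>) J - 1)))) \<partial>M)"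
    by (rule nn_integral_cong_AE, use A_ranked in eventually_elim) (simp add: main)
  also have "\<dots> = (\<Sum>J\<in>K. \<integral>\<^sup>+ \<omega>. of_nat (C (\<lambda>k. A k \<omega>) J) *
        of_bool (D ((C (\<lambda>k. A k \<omega>))(J := C (\<lambda>k. A k \<omega>) J - 1))) \<partial>M)"
    by (rule nn_integral_sum) (use DM K in auto)
  also have "\<dots> = (\<Sum>J\<in>K. emeasure \<nu> J * (\<integral>\<^sup>+ \<omega>. of_bool (D (C (\<lambda>k. A k \<omega>))) \<partial>M))"
    using K unfolding C_def by (intro sum.cong refl counts_size_bias[OF \<J>(1-4)]) auto
  also have "\<dots> = (\<Sum>J\<in>K. emeasure \<nu> J) * (\<integral>\<^sup>+ \<omega>. of_bool (D (C (\<lambda>k. A k \<omega>))) \<partial>M)"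
    by (simp add: sum_distrib_right)
  also have "(\<Sum>J\<in>K. emeasure \<nu> J) = emeasure \<nu> {b..}"
    unfolding Kb using sum_emeasure[of id K \<nu>] K \<J>(2,3)
    by (auto simp: disjoint_family_on_def disjoint_def subset_eq image_subset_iff)
  also have "(\<integral>\<^sup>+ \<omega>. of_bool (D (C (\<lambda>k. A k \<omega>))) \<partial>M) = (\<integral>\<^sup>+ \<omega>. of_bool (\<forall>j\<in>F. y j \<le> A j \<omega>) \<partial>M)"
    by (rule nn_integral_cong_AE, use A_ranked in eventually_elim) (simp add: DC)
  finally show ?thesis .
qed

text \<open>Points below \<open>\<epsilon>\<close> are ignored to make both sides finite, as the uniqueness of measures requires.
A point and the remaining sequence are coded as one sequence with the point in front.\<close>

lemma Mecke_cutoff: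
  fixes h :: "real \<times> (nat \<Rightarrow> real) \<Rightarrow> ennreal"
  assumes h [measurable]: "h \<in> borel_measurable (borel \<Otimes>\<^sub>M seq_space)" and \<epsilon>: "0 < \<epsilon>"
  shows "(\<integral>\<^sup>+ z. h (A (snd z) (fst z), del (snd z) (\<lambda>k. A k (fst z))) * indicator {\<epsilon>..} (A (snd z) (fst z))
      \<partial>(M \<Otimes>\<^sub>M count_space UNIV)) =
    (\<integral>\<^sup>+ z. h (fst z, \<lambda>k. A k (snd z)) * indicator {\<epsilon>..} (fst z) \<partial>(\<nu> \<Otimes>\<^sub>M M))"
proof -
  interpret C: sigma_finite_measure "count_space (UNIV :: nat set)"
    by (rule sigma_finite_measure_count_space)
  have [measurable]: "(\<lambda>z. A (snd z) (fst z)) \<in> borel_measurable (M \<Otimes>\<^sub>M count_space UNIV)"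
    by (rule measurable_compose_countable'[where I = UNIV and g = snd]) auto
  have [measurable]: "(\<lambda>z. del (snd z) (\<lambda>k. A k (fst z))) \<in> measurable (M \<Otimes>\<^sub>M count_space UNIV) seq_space"
    by (rule measurable_compose_countable'[where I = UNIV and g = snd]) auto
  define cons :: "real \<times> (nat \<Rightarrow> real) \<Rightarrow> nat \<Rightarrow> real" where "cons = (\<lambda>(s, a). case_nat s a)"
  have cons [measurable]: "cons \<in> measurable (borel \<Otimes>\<^sub>M seq_space) seq_space"
  proof (rule seq_measurableI)
    show "(\<lambda>z. cons z i) \<in> borel_measurable (borel \<Otimes>\<^sub>M seq_space)" for i
      using measurable_compose[OF measurable_snd seq_measurable_coord]
      by (cases i) (auto simp: cons_def case_prod_beta')
  qed
  define uncons :: "(nat \<Rightarrow> real) \<Rightarrow> real \<times> (nat \<Rightarrow> real)" where "uncons c = (c 0, \<lambda>j. c (Suc j))" for c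
  have uncons [measurable]: "uncons \<in> measurable seq_space (borel \<Otimes>\<^sub>M seq_space)"
    unfolding uncons_def by (intro measurable_Pair seq_measurableI) auto
  have uncons_cons [simp]: "uncons (cons z) = z" for z
    by (cases z) (simp add: uncons_def cons_def)
  define d1 :: "'a \<times> nat \<Rightarrow> ennreal" where "d1 z = indicator {\<epsilon>..} (A (snd z) (fst z))" for z
  define d2 :: "real \<times> 'a \<Rightarrow> ennreal" where "d2 z = indicator {\<epsilon>..} (fst z)" for z
  define m1 where "m1 z = cons (A (snd z) (fst z), del (snd z) (\<lambda>k. A k (fst z)))" for z
  define m2 where "m2 z = cons (fst z, \<lambda>k. A k (snd z))" for z :: "real \<times> 'a"
  have [measurable]: "d1 \<in> borel_measurable (M \<Otimes>\<^sub>M count_space UNIV)"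
      "d2 \<in> borel_measurable (\<nu> \<Otimes>\<^sub>M M)" "m1 \<in> measurable (M \<Otimes>\<^sub>M count_space UNIV) seq_space"
      "m2 \<in> measurable (\<nu> \<Otimes>\<^sub>M M) seq_space"
    unfolding d1_def d2_def m1_def m2_def by measurable
  define \<mu>1 where "\<mu>1 = distr (density (M \<Otimes>\<^sub>M count_space UNIV) d1) seq_space m1"
  define \<mu>2 where "\<mu>2 = distr (density (\<nu> \<Otimes>\<^sub>M M) d2) seq_space m2"
  have i1: "integral\<^sup>N \<mu>1 f = (\<integral>\<^sup>+ z. f (m1 z) * d1 z \<partial>(M \<Otimes>\<^sub>M count_space UNIV))"
    if [measurable]: "f \<in> borel_measurable seq_space" for f
    unfolding \<mu>1_def by (simp add: nn_integral_distr nn_integral_density mult.commute)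
  have i2: "integral\<^sup>N \<mu>2 f = (\<integral>\<^sup>+ z. f (m2 z) * d2 z \<partial>(\<nu> \<Otimes>\<^sub>M M))"
    if [measurable]: "f \<in> borel_measurable seq_space" for f
    unfolding \<mu>2_def by (simp add: nn_integral_distr nn_integral_density mult.commute)
  have e1: "emeasure \<mu>1 {c. \<forall>j\<in>F. y j \<le> c j} =
      emeasure \<nu> {max \<epsilon> (if 0 \<in> F then y 0 else \<epsilon>)..} * (\<integral>\<^sup>+ \<omega>. of_bool (\<forall>j\<in>Suc -` F. y (Suc j) \<le> A j \<omega>) \<partial>M)"
    and e2: "emeasure \<mu>2 {c. \<forall>j\<in>F. y j \<le> c j} =
      emeasure \<nu> {max \<epsilon> (if 0 \<in> F then y 0 else \<epsilon>)..} * (\<integral>\<^sup>+ \<omega>. of_bool (\<forall>j\<in>Suc -` F. y (Suc j) \<le> A j \<omega>) \<partial>M)"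
    if F: "finite F" for F y
  proof -
    let ?E = "{c. \<forall>j\<in>F. y j \<le> c j}"
    let ?b = "max \<epsilon> (if 0 \<in> F then y 0 else \<epsilon>)"
    let ?G = "Suc -` F"
    have G: "finite ?G" using F by (intro finite_vimageI) auto
    have E [measurable]: "?E \<in> sets seq_space"
    proof -
      have "{c \<in> space seq_space. \<forall>j\<in>F. y j \<le> c j} \<in> sets seq_space"
        using F by measurable
      then show ?thesis by simp
    qed
    have split: "(\<forall>j\<in>F. y j \<le> cons (s, a) j) \<longleftrightarrow> (0 \<in> F \<longrightarrow> y 0 \<le> s) \<and> (\<forall>j\<in>?G. y (Suc j) \<le> a j)" for s a
    proof -
      have "(\<forall>j\<in>F. Q j) \<longleftrightarrow> (0 \<in> F \<longrightarrow> Q 0) \<and> (\<forall>j\<in>?G. Q (Suc j))" for Q :: "nat \<Rightarrow> bool"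
        by (metis nat.exhaust vimage_eq)
      from this[of "\<lambda>j. y j \<le> cons (s, a) j"] show ?thesis by (simp add: cons_def)
    qed
    have "emeasure \<mu>1 ?E = integral\<^sup>N \<mu>1 (indicator ?E)"
      by (rule nn_integral_indicator[symmetric]) (simp add: \<mu>1_def)
    also have "\<dots> = (\<integral>\<^sup>+ z. indicator ?E (m1 z) * d1 z \<partial>(M \<Otimes>\<^sub>M count_space UNIV))"
      by (rule i1) measurable
    also have "\<dots> = (\<integral>\<^sup>+ \<omega>. \<integral>\<^sup>+ k. indicator ?E (m1 (\<omega>, k)) * d1 (\<omega>, k) \<partial>count_space UNIV \<partial>M)"
      by (rule C.nn_integral_fst[symmetric]) measurable
    also have "\<dots> = (\<integral>\<^sup>+ \<omega>. (\<Sum>k. of_bool (?b \<le> A k \<omega> \<and> (\<forall>j\<in>?G. y (Suc j) \<le> del k (\<lambda>k. A k \<omega>) j))) \<partial>M)"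
      unfolding nn_integral_count_space_nat
      by (intro nn_integral_cong arg_cong[where f = suminf] ext)
         (auto simp: d1_def m1_def indicator_def split)
    also have "\<dots> = emeasure \<nu> {?b..} * (\<integral>\<^sup>+ \<omega>. of_bool (\<forall>j\<in>?G. y (Suc j) \<le> A j \<omega>) \<partial>M)"
      by (rule Mecke_thresholds) (use \<epsilon> G in auto)
    finally show "emeasure \<mu>1 ?E = \<dots>" .
    have [measurable]: "(\<lambda>\<omega>. of_bool (\<forall>j\<in>?G. y (Suc j) \<le> A j \<omega>) :: ennreal) \<in> borel_measurable M"
    proof -
      have "Measurable.pred M (\<lambda>\<omega>. \<forall>j\<in>?G. y (Suc j) \<le> A j \<omega>)" using G by measurable
      then show ?thesis by measurable
    qed
    have "emeasure \<mu>2 ?E = integral\<^sup>N \<mu>2 (indicator ?E)"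
      by (rule nn_integral_indicator[symmetric]) (simp add: \<mu>2_def)
    also have "\<dots> = (\<integral>\<^sup>+ z. indicator ?E (m2 z) * d2 z \<partial>(\<nu> \<Otimes>\<^sub>M M))"
      by (rule i2) measurable
    also have "\<dots> = (\<integral>\<^sup>+ s. \<integral>\<^sup>+ \<omega>. indicator ?E (m2 (s, \<omega>)) * d2 (s, \<omega>) \<partial>M \<partial>\<nu>)"
      by (rule nn_integral_fst[symmetric]) measurable
    also have "\<dots> = (\<integral>\<^sup>+ s. \<integral>\<^sup>+ \<omega>. indicator {?b..} s * of_bool (\<forall>j\<in>?G. y (Suc j) \<le> A j \<omega>) \<partial>M \<partial>\<nu>)"
      by (intro nn_integral_cong) (auto simp: d2_def m2_def indicator_def split)
    also have "\<dots> = emeasure \<nu> {?b..} * (\<integral>\<^sup>+ \<omega>. of_bool (\<forall>j\<in>?G. y (Suc j) \<le> A j \<omega>) \<partial>M)"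
      by (subst nn_integral_cmult, measurable, subst nn_integral_multc)
         (auto intro!: borel_measurable_indicator)
    finally show "emeasure \<mu>2 ?E = \<dots>" .
  qed
  have "\<mu>1 = \<mu>2"
  proof (rule seq_space_eqI_ge)
    show "sets \<mu>1 = sets seq_space" "sets \<mu>2 = sets seq_space" by (simp_all add: \<mu>1_def \<mu>2_def)
    show "emeasure \<mu>1 UNIV \<noteq> \<infinity>"
      using e1[of "{}"] intensity_finite[OF \<epsilon>] by (simp add: emeasure_space_1)
    show "emeasure \<mu>1 {c. \<forall>j\<in>F. y j \<le> c j} = emeasure \<mu>2 {c. \<forall>j\<in>F. y j \<le> c j}"
      if "finite F" for F and y :: "nat \<Rightarrow> real"
      using e1[OF that, of y] e2[OF that, of y] by simp
  qed
  then have "integral\<^sup>N \<mu>1 (\<lambda>c. h (uncons c)) = integral\<^sup>N \<mu>2 (\<lambda>c. h (uncons c))" by simp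
  then show ?thesis
    by (subst (asm) i1, measurable, subst (asm) i2, measurable)
       (simp add: m1_def m2_def d1_def d2_def)
qed

text \<open>Summed over all points, a point of a Poisson process and the configuration without it are distributed
as the product of the intensity and the law of the whole configuration.  The cutoff at \<open>\<epsilon>\<close> is removed by
monotone convergence.\<close>

theorem Mecke:
  fixes h :: "real \<times> (nat \<Rightarrow> real) \<Rightarrow> ennreal"
  assumes h [measurable]: "h \<in> borel_measurable (borel \<Otimes>\<^sub>M seq_space)"
  shows "(\<integral>\<^sup>+ \<omega>. (\<Sum>k. h (A k \<omega>, del k (\<lambda>k. A k \<omega>))) \<partial>M) =
    (\<integral>\<^sup>+ s. \<integral>\<^sup>+ \<omega>. h (s, \<lambda>k. A k \<omega>) \<partial>M \<partial>\<nu>)"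
proof -
  interpret C: sigma_finite_measure "count_space (UNIV :: nat set)"
    by (rule sigma_finite_measure_count_space)
  have mA [measurable]: "(\<lambda>z. A (snd z) (fst z)) \<in> borel_measurable (M \<Otimes>\<^sub>M count_space UNIV)"
    by (rule measurable_compose_countable'[where I = UNIV and g = snd]) auto
  have md [measurable]: "(\<lambda>z. del (snd z) (\<lambda>k. A k (fst z))) \<in> measurable (M \<Otimes>\<^sub>M count_space UNIV) seq_space"
    by (rule measurable_compose_countable'[where I = UNIV and g = snd]) auto
  let ?h1 = "\<lambda>z. h (A (snd z) (fst z), del (snd z) (\<lambda>k. A k (fst z)))"
  let ?h2 = "\<lambda>z. h (fst z, \<lambda>k. A k (snd z))"
  let ?i = "\<lambda>n x. indicator {1 / real (Suc n)..} x :: ennreal"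
  have i_mono: "?i n x \<le> ?i m x" if "n \<le> m" for n m x
  proof -
    have "1 / real (Suc m) \<le> 1 / real (Suc n)" using that by (intro divide_left_mono) auto
    then show ?thesis by (auto simp: indicator_def)
  qed
  have i_SUP: "(SUP n. c * ?i n x) = c * indicator {0<..} x" for c x
  proof (cases "0 < x")
    case True
    then obtain n where "1 / real (Suc n) \<le> x"
      by (metis less_imp_le nat_approx_posE)
    then have "c * ?i n x = c" by simp
    moreover have "c * ?i m x \<le> c" for m by (simp add: indicator_def)
    ultimately show ?thesis using True by (intro antisym SUP_least SUP_upper2[of n]) auto
  next
    case False
    have "x < 1 / real (Suc n)" for n
      using False by (intro le_less_trans[of x 0]) auto
    then have "?i n x = 0" for n by (simp add: not_le)
    then show ?thesis using False by simp
  qed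
  have "(\<integral>\<^sup>+ z. ?h1 z * indicator {0<..} (A (snd z) (fst z)) \<partial>(M \<Otimes>\<^sub>M count_space UNIV)) =
      (\<integral>\<^sup>+ z. (SUP n. ?h1 z * ?i n (A (snd z) (fst z))) \<partial>(M \<Otimes>\<^sub>M count_space UNIV))"
    by (simp only: i_SUP)
  also have "\<dots> = (SUP n. \<integral>\<^sup>+ z. ?h1 z * ?i n (A (snd z) (fst z)) \<partial>(M \<Otimes>\<^sub>M count_space UNIV))"
    by (intro nn_integral_monotone_convergence_SUP incseq_SucI le_funI mult_left_mono i_mono) auto
  also have "\<dots> = (SUP n. \<integral>\<^sup>+ z. ?h2 z * ?i n (fst z) \<partial>(\<nu> \<Otimes>\<^sub>M M))"
    by (intro SUP_cong refl Mecke_cutoff) auto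
  also have "\<dots> = (\<integral>\<^sup>+ z. (SUP n. ?h2 z * ?i n (fst z)) \<partial>(\<nu> \<Otimes>\<^sub>M M))"
    by (intro nn_integral_monotone_convergence_SUP[symmetric] incseq_SucI le_funI mult_left_mono i_mono) auto
  also have "\<dots> = (\<integral>\<^sup>+ z. ?h2 z * indicator {0<..} (fst z) \<partial>(\<nu> \<Otimes>\<^sub>M M))"
    by (simp only: i_SUP)
  also have "\<dots> = (\<integral>\<^sup>+ s. \<integral>\<^sup>+ \<omega>. h (s, \<lambda>k. A k \<omega>) * indicator {0<..} s \<partial>M \<partial>\<nu>)"
    by (subst nn_integral_fst[symmetric]) auto
  also have "\<dots> = (\<integral>\<^sup>+ s. (\<integral>\<^sup>+ \<omega>. h (s, \<lambda>k. A k \<omega>) \<partial>M) * indicator {0<..} s \<partial>\<nu>)"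
    by (intro nn_integral_cong nn_integral_multc) measurable
  also have "\<dots> = (\<integral>\<^sup>+ s. \<integral>\<^sup>+ \<omega>. h (s, \<lambda>k. A k \<omega>) \<partial>M \<partial>\<nu>)"
  proof (rule nn_integral_cong_AE)
    have "AE s in \<nu>. s \<notin> {..0}" by (rule AE_not_in) (simp add: null_sets_def intensity_nonpos)
    then show "AE s in \<nu>. (\<integral>\<^sup>+ \<omega>. h (s, \<lambda>k. A k \<omega>) \<partial>M) * indicator {0<..} s = (\<integral>\<^sup>+ \<omega>. h (s, \<lambda>k. A k \<omega>) \<partial>M)"
      by eventually_elim simp
  qed
  finally have "(\<integral>\<^sup>+ z. ?h1 z * indicator {0<..} (A (snd z) (fst z)) \<partial>(M \<Otimes>\<^sub>M count_space UNIV)) = \<dots>" .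
  moreover have "(\<integral>\<^sup>+ z. ?h1 z * indicator {0<..} (A (snd z) (fst z)) \<partial>(M \<Otimes>\<^sub>M count_space UNIV)) =
     (\<integral>\<^sup>+ \<omega>. (\<Sum>k. h (A k \<omega>, del k (\<lambda>k. A k \<omega>)) * indicator {0<..} (A k \<omega>)) \<partial>M)"
    by (subst C.nn_integral_fst[symmetric]) (auto simp: nn_integral_count_space_nat)
  moreover have "\<dots> = (\<integral>\<^sup>+ \<omega>. (\<Sum>k. h (A k \<omega>, del k (\<lambda>k. A k \<omega>))) \<partial>M)"
    by (rule nn_integral_cong_AE, use A_ranked in eventually_elim) (simp add: ranked_def)
  ultimately show ?thesis by simp
qed

end

section \<open>Ranked jumps of a subordinator\<close>

definition levy_measure :: "(real \<Rightarrow> real) \<Rightarrow> real measure" where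
  "levy_measure \<rho> = density lborel (\<lambda>s. indicator {0<..} s * ennreal (\<rho> s))"

text \<open>The enumeration of the jump times turns indices of ranked jumps into jump points, so multiplicities
are counted correctly even if several jumps have the same size.\<close>

lemma ranked_jumps_cnt:
  assumes "ranked_jumps x a"
  shows "cnt B a = card (jump_points x \<inter> {0..1} \<times> B)"
proof -
  obtain \<tau> where bij: "bij_betw \<tau> UNIV {t \<in> {0..1}. (t, jump x t) \<in> jump_points x}"
    and a: "\<And>k. a k = jump x (\<tau> k)"
    using assms by (auto simp: ranked_jumps_def)
  have \<tau>: "\<tau> k \<in> {t \<in> {0..1}. (t, jump x t) \<in> jump_points x}" for k
    using bij by (auto simp: bij_betw_def)
  have "bij_betw (\<lambda>k. (\<tau> k, a k)) {k. a k \<in> B} (jump_points x \<inter> {0..1} \<times> B)"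
  proof (intro bij_betwI')
    show "((\<tau> k, a k) = (\<tau> j, a j)) = (k = j)" for k j
      using bij by (auto simp: bij_betw_def inj_def)
    show "(\<tau> k, a k) \<in> jump_points x \<inter> {0..1} \<times> B" if "k \<in> {k. a k \<in> B}" for k
      using \<tau>[of k] a[of k] that by auto
    show "\<exists>k\<in>{k. a k \<in> B}. z = (\<tau> k, a k)" if z: "z \<in> jump_points x \<inter> {0..1} \<times> B" for z
    proof -
      obtain t s where ts: "z = (t, s)" by (cases z)
      then have "jump x t = s" "t \<in> {t \<in> {0..1}. (t, jump x t) \<in> jump_points x}"
        using z by (auto simp: jump_points_def)
      moreover from this(2) obtain k where "t = \<tau> k"
        using bij by (auto simp: bij_betw_def)
      ultimately show ?thesis using z ts a[of k] by (intro bexI[of _ k]) auto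
    qed
  qed
  then show ?thesis unfolding cnt_def by (rule bij_betw_same_card)
qed

lemma ranked_jumps_ranked:
  assumes "ranked_jumps x a" "a \<longlonglongrightarrow> 0"
  shows "ranked a"
proof -
  obtain \<tau> where bij: "bij_betw \<tau> UNIV {t \<in> {0..1}. (t, jump x t) \<in> jump_points x}"
    and a: "\<And>k. a k = jump x (\<tau> k)" and dec: "decseq a"
    using assms by (auto simp: ranked_jumps_def)
  have "\<tau> k \<in> {t \<in> {0..1}. (t, jump x t) \<in> jump_points x}" for k
    using bij by (auto simp: bij_betw_def)
  then have "0 < a k" for k using a[of k] by (auto simp: jump_points_def)
  then show ?thesis using dec assms(2) by (simp add: ranked_def)
qed

text \<open>The time interval \<open>[0,1]\<close> has length one, so over it the space-time intensity projects to the Levy measure.\<close>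

lemma emeasure_levy_box:
  assumes [measurable]: "\<rho> \<in> borel_measurable borel" "B \<in> sets borel"
  shows "emeasure (density lborel (\<lambda>(t::real, s::real). indicator {0..} t * indicator {0<..} s * ennreal (\<rho> s)))
      ({0..1::real} \<times> B) = emeasure (levy_measure \<rho>) B"
proof -
  define f :: "real \<times> real \<Rightarrow> ennreal"
    where "f = (\<lambda>(t, s). indicator {0..} t * indicator {0<..} s * ennreal (\<rho> s))"
  have [measurable]: "f \<in> borel_measurable (borel \<Otimes>\<^sub>M borel)"
    unfolding f_def by measurable
  have "emeasure (density lborel f) ({0..1::real} \<times> B) =
      emeasure (density (lborel \<Otimes>\<^sub>M lborel) f) ({0..1::real} \<times> B)"
    by (simp add: lborel_prod)
  also have "\<dots> = (\<integral>\<^sup>+ z. f z * indicator ({0..1} \<times> B) z \<partial>(lborel \<Otimes>\<^sub>M lborel))"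
    by (rule emeasure_density) auto
  also have "\<dots> = (\<integral>\<^sup>+ t. \<integral>\<^sup>+ s. indicator {0..1::real} t * (indicator {0<..} s * ennreal (\<rho> s) * indicator B s)
      \<partial>lborel \<partial>lborel)"
    by (subst lborel.nn_integral_fst[symmetric])
       (auto intro!: nn_integral_cong simp: f_def indicator_def)
  also have "\<dots> = (\<integral>\<^sup>+ s. indicator {0<..} s * ennreal (\<rho> s) * indicator B s \<partial>lborel)"
  proof -
    have "(\<integral>\<^sup>+ s. indicator {0..1::real} t * (indicator {0<..} s * ennreal (\<rho> s) * indicator B s) \<partial>lborel) =
        indicator {0..1} t * (\<integral>\<^sup>+ s. indicator {0<..} s * ennreal (\<rho> s) * indicator B s \<partial>lborel)" for t
      by (rule nn_integral_cmult) auto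
    moreover have "(\<integral>\<^sup>+ t. indicator {0..1::real} t * c \<partial>lborel) = c" for c
      by (subst nn_integral_multc) auto
    ultimately show ?thesis by simp
  qed
  also have "\<dots> = emeasure (levy_measure \<rho>) B"
    unfolding levy_measure_def by (subst emeasure_density) auto
  finally show ?thesis by (simp add: f_def)
qed

theorem subordinator_ranked_poisson:
  assumes X: "subordinator M \<rho> X"
    and \<rho> [measurable]: "\<rho> \<in> borel_measurable borel"
    and fin: "\<And>b. 0 < b \<Longrightarrow> emeasure (levy_measure \<rho>) {b..} < \<infinity>"
    and A [measurable]: "\<And>k. A k \<in> borel_measurable M"
    and jumps: "AE \<omega> in M. ranked_jumps (\<lambda>t. X t \<omega>) (\<lambda>k. A k \<omega>)"
    and lim: "AE \<omega> in M. (\<lambda>k. A k \<omega>) \<longlonglongrightarrow> 0"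
  shows "ranked_poisson M (levy_measure \<rho>) A"
proof -
  from X interpret prob_space M by (simp add: subordinator_def)
  define \<mu> where "\<mu> = density lborel (\<lambda>(t::real, s::real). indicator {0..} t * indicator {0<..} s * ennreal (\<rho> s))"
  define Z where "Z \<omega> = jump_points (\<lambda>t. X t \<omega>)" for \<omega>
  have ppp: "poisson_point_process M \<mu> Z"
    using X by (simp add: subordinator_def \<mu>_def Z_def[abs_def])
  have AE_cnt: "AE \<omega> in M. \<forall>B. cnt B (\<lambda>k. A k \<omega>) = card (Z \<omega> \<inter> {0..1} \<times> B)"
    using jumps by eventually_elim (simp add: ranked_jumps_cnt Z_def)
  show ?thesis
  proof unfold_locales
    show "sets (levy_measure \<rho>) = sets borel" by (simp add: levy_measure_def)
    show "emeasure (levy_measure \<rho>) {..0} = 0"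
      unfolding levy_measure_def
      by (subst emeasure_density) (auto simp: nn_integral_0_iff_AE indicator_def)
    show "AE \<omega> in M. ranked (\<lambda>k. A k \<omega>)"
      using jumps lim by eventually_elim (rule ranked_jumps_ranked)
    fix \<J> :: "real set set" and n :: "real set \<Rightarrow> nat"
    assume \<J>: "finite \<J>" "disjoint \<J>" and B: "\<And>B. B \<in> \<J> \<Longrightarrow> B \<in> sets borel \<and> (\<exists>b>0. B \<subseteq> {b..})"
    let ?box = "\<lambda>B. {0..1::real} \<times> B"
    have \<mu>B: "emeasure \<mu> (?box B) = emeasure (levy_measure \<rho>) B" if "B \<in> sets borel" for B
      unfolding \<mu>_def by (rule emeasure_levy_box[OF \<rho> that])
    have finB: "emeasure \<mu> (?box B) < \<infinity>" if "B \<in> \<J>" for B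
    proof -
      note BJ = B[OF that]
      then obtain b where "0 < b" "B \<subseteq> {b..}" by auto
      then show ?thesis
        using \<mu>B[of B] BJ emeasure_mono[of B "{b..}" "levy_measure \<rho>"] fin[of b]
        by (auto simp: less_top[symmetric] top_unique levy_measure_def)
    qed
    have setB: "?box B \<in> sets \<mu>" if "B \<in> \<J>" for B
      using B[OF that] by (simp add: \<mu>_def borel_Times)
    define m where "m = card \<J>"
    obtain g where g: "bij_betw g {0..<m} \<J>"
      unfolding m_def using ex_bij_betw_nat_finite[OF \<J>(1)] by blast
    \<comment> \<open>Counts are independent along sequences of disjoint sets, so the family is padded with empty sets.\<close>
    define D where "D i = (if i < m then ?box (g i) else {})" for i
    have gJ: "g i \<in> \<J>" if "i < m" for i using g that by (auto simp: bij_betw_def)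
    have Dfin: "D i \<in> sets \<mu> \<and> emeasure \<mu> (D i) < \<infinity>" for i
      using finB setB gJ by (simp add: D_def)
    have "disjoint_family D"
    proof -
      have "g i \<inter> g j = {}" if "i \<noteq> j" "i < m" "j < m" for i j
      proof -
        have "g i \<noteq> g j"
          using g that unfolding bij_betw_def by (metis atLeastLessThan_iff inj_onD le0)
        then show ?thesis using disjointD[OF \<J>(2)] gJ that by blast
      qed
      then show ?thesis by (auto simp: disjoint_family_on_def D_def)
    qed
    with ppp Dfin have indep: "indep_vars (\<lambda>_. count_space UNIV) (\<lambda>i \<omega>. card (Z \<omega> \<inter> D i)) UNIV"
      unfolding poisson_point_process_def by blast
    have meas: "(\<lambda>\<omega>. card (Z \<omega> \<inter> ?box B)) \<in> measurable M (count_space UNIV)" if "B \<in> \<J>" for B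
      using ppp setB[OF that] finB[OF that] unfolding poisson_point_process_def by blast
    have law: "prob {\<omega> \<in> space M. card (Z \<omega> \<inter> ?box B) = k} =
        measure \<mu> (?box B) ^ k / fact k * exp (- measure \<mu> (?box B))" if "B \<in> \<J>" for B k
      using ppp setB[OF that] finB[OF that] unfolding poisson_point_process_def by blast
    have "prob {\<omega> \<in> space M. \<forall>B\<in>\<J>. cnt B (\<lambda>k. A k \<omega>) = n B} =
        prob {\<omega> \<in> space M. \<forall>B\<in>\<J>. card (Z \<omega> \<inter> ?box B) = n B}"
    proof (rule finite_measure_eq_AE)
      show "AE \<omega> in M. (\<omega> \<in> {\<omega> \<in> space M. \<forall>B\<in>\<J>. cnt B (\<lambda>k. A k \<omega>) = n B}) =
          (\<omega> \<in> {\<omega> \<in> space M. \<forall>B\<in>\<J>. card (Z \<omega> \<inter> ?box B) = n B})"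
        using AE_cnt by eventually_elim simp
      have [measurable]: "(\<lambda>\<omega> k. A k \<omega>) \<in> measurable M seq_space"
        by (intro seq_measurableI) simp
      have "(\<lambda>\<omega>. cnt B (\<lambda>k. A k \<omega>)) \<in> measurable M (count_space UNIV)" if "B \<in> \<J>" for B
        by (rule measurable_compose[OF _ cnt_measurable]) (use B[OF that] in auto)
      then show "{\<omega> \<in> space M. \<forall>B\<in>\<J>. cnt B (\<lambda>k. A k \<omega>) = n B} \<in> sets M"
        using \<J>(1) by measurable
      show "{\<omega> \<in> space M. \<forall>B\<in>\<J>. card (Z \<omega> \<inter> ?box B) = n B} \<in> sets M"
        using \<J>(1) meas by measurable
    qed
    also have "\<dots> = (\<Prod>B\<in>\<J>. prob {\<omega> \<in> space M. card (Z \<omega> \<inter> ?box B) = n B})"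
    proof (cases "\<J> = {}")
      case True
      then show ?thesis by (simp add: prob_space)
    next
      case False
      then have m: "{0..<m} \<noteq> {}" using \<J>(1) by (simp add: m_def card_gt_0_iff)
      have "prob (\<Inter>i\<in>{0..<m}. (\<lambda>\<omega>. card (Z \<omega> \<inter> D i)) -` {n (g i)} \<inter> space M) =
          (\<Prod>i\<in>{0..<m}. prob ((\<lambda>\<omega>. card (Z \<omega> \<inter> D i)) -` {n (g i)} \<inter> space M))"
        by (rule indep_varsD[OF indep]) (use m in auto)
      moreover have "(\<Inter>i\<in>{0..<m}. (\<lambda>\<omega>. card (Z \<omega> \<inter> D i)) -` {n (g i)} \<inter> space M) =
          {\<omega> \<in> space M. \<forall>B\<in>\<J>. card (Z \<omega> \<inter> ?box B) = n B}"
        unfolding bij_betw_imp_surj_on[OF g, symmetric] using m by (auto simp: D_def)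
      moreover have "(\<Prod>i\<in>{0..<m}. prob ((\<lambda>\<omega>. card (Z \<omega> \<inter> D i)) -` {n (g i)} \<inter> space M)) =
          (\<Prod>i\<in>{0..<m}. prob {\<omega> \<in> space M. card (Z \<omega> \<inter> ?box (g i)) = n (g i)})"
        by (intro prod.cong refl arg_cong[where f = prob]) (auto simp: D_def)
      moreover have "\<dots> = (\<Prod>B\<in>\<J>. prob {\<omega> \<in> space M. card (Z \<omega> \<inter> ?box B) = n B})"
        by (rule prod.reindex_bij_betw[OF g])
      ultimately show ?thesis by simp
    qed
    also have "\<dots> = (\<Prod>B\<in>\<J>. measure (levy_measure \<rho>) B ^ n B / fact (n B) * exp (- measure (levy_measure \<rho>) B))"
    proof (intro prod.cong refl)
      fix B' assume "B' \<in> \<J>"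
      moreover from this have "measure \<mu> (?box B') = measure (levy_measure \<rho>) B'"
        using \<mu>B[of B'] B by (simp add: measure_def)
      ultimately show "prob {\<omega> \<in> space M. card (Z \<omega> \<inter> ?box B') = n B'} =
          measure (levy_measure \<rho>) B' ^ n B' / fact (n B') * exp (- measure (levy_measure \<rho>) B')"
        using law[of B' "n B'"] by simp
    qed
    finally show "prob {\<omega> \<in> space M. \<forall>B\<in>\<J>. cnt B (\<lambda>k. A k \<omega>) = n B} = \<dots>" .
  qed (use fin in auto)
qed

section \<open>Integrals of the stable and beta densities\<close>

lemma stable_levy_density_measurable [measurable]: "stable_levy_density \<alpha> \<in> borel_measurable borel"
  unfolding stable_levy_density_def by measurable

lemma beta_density_measurable [measurable]: "beta_density a b \<in> borel_measurable borel"
  unfolding beta_density_def[abs_def] by measurable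

lemma stick_factor_measurable [measurable (raw)]:
  assumes [measurable]: "f \<in> borel_measurable M" "g \<in> borel_measurable M"
  shows "(\<lambda>x. stick_factor (f x) (g x)) \<in> borel_measurable M"
  unfolding stick_factor_def by measurable

lemma stick_factor_density_measurable [measurable]: "stick_factor_density \<alpha> r \<in> borel_measurable borel"
  unfolding stick_factor_density_def[abs_def] by measurable

lemma stable_levy_measure_finite:
  assumes \<alpha>: "0 < \<alpha>" "\<alpha> < 1" and b: "0 < b"
  shows "emeasure (levy_measure (stable_levy_density \<alpha>)) {b..} < \<infinity>"
proof -
  define C where "C = 1 / Gamma (1 - \<alpha>)"
  have C: "0 < C" using \<alpha> by (simp add: C_def Gamma_real_pos)
  have lim: "((\<lambda>s. - C * s powr - \<alpha>) \<longlongrightarrow> 0) at_top"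
  proof -
    have "((\<lambda>s::real. s powr - \<alpha>) \<longlongrightarrow> 0) at_top"
      using \<alpha> by (intro tendsto_neg_powr filterlim_ident) auto
    from tendsto_mult_left[OF this, of "- C"] show ?thesis by simp
  qed
  have "emeasure (levy_measure (stable_levy_density \<alpha>)) {b..} =
      (\<integral>\<^sup>+ s. ennreal (stable_levy_density \<alpha> s) * indicator {b..} s \<partial>lborel)"
    unfolding levy_measure_def using b
    by (subst emeasure_density) (auto intro!: nn_integral_cong simp: indicator_def)
  also have "\<dots> = ennreal (0 - (- C * b powr - \<alpha>))"
  proof (rule nn_integral_FTC_atLeast)
    show "((\<lambda>s. - C * s powr - \<alpha>) has_real_derivative stable_levy_density \<alpha> x) (at x)" if "b \<le> x" for x
    proof -
      have "((\<lambda>s. - C * s powr - \<alpha>) has_real_derivative (- C * (- \<alpha> * x powr (- \<alpha> - 1)))) (at x)"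
        using that b by (auto intro!: derivative_eq_intros)
      then show ?thesis by (simp add: stable_levy_density_def C_def)
    qed
    show "0 \<le> stable_levy_density \<alpha> x" if "b \<le> x" for x
      using \<alpha> Gamma_real_pos[of "1 - \<alpha>"] by (simp add: stable_levy_density_def)
  qed (use lim in auto)
  finally show ?thesis by simp
qed

lemma nn_integral_Gamma_scaled:
  fixes a c :: real
  assumes a: "0 < a" and c: "0 < c"
  shows "(\<integral>\<^sup>+ v. indicator {0<..} v * ennreal (v powr (a - 1) * exp (- c * v)) \<partial>lborel) =
    ennreal (Gamma a * c powr - a)"
proof -
  let ?f = "\<lambda>v. indicator {0<..} v * ennreal (v powr (a - 1) * exp (- c * v))"
  have "(\<integral>\<^sup>+ v. ?f v \<partial>lborel) = ennreal \<bar>1 / c\<bar> * (\<integral>\<^sup>+ v. ?f (0 + (1 / c) * v) \<partial>lborel)"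
    by (rule nn_integral_real_affine) (use c in auto)
  also have "(\<integral>\<^sup>+ v. ?f (0 + (1 / c) * v) \<partial>lborel) =
      (\<integral>\<^sup>+ v. ennreal (c powr (1 - a)) * ennreal (indicator {0..} v * v powr (a - 1) / exp v) \<partial>lborel)"
    (is "nn_integral _ ?L = nn_integral _ ?R")
  proof (rule nn_integral_cong_AE)
    have "AE v in lborel. v \<noteq> (0::real)" by (rule AE_lborel_singleton)
    then show "AE v in lborel. ?L v = ?R v"
    proof eventually_elim
      fix v :: real assume "v \<noteq> 0"
      show "?L v = ?R v"
      proof (cases "0 < v")
        case True
        have "(v / c) powr (a - 1) * exp (- v) = c powr (1 - a) * (v powr (a - 1) / exp v)"
          using True c by (simp add: powr_divide exp_minus powr_diff field_simps)
        then show ?thesis using True c by (simp add: ennreal_mult[symmetric])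
      next
        case False
        then show ?thesis using \<open>v \<noteq> 0\<close> c by (simp add: zero_less_divide_iff)
      qed
    qed
  qed
  also have "\<dots> = ennreal (c powr (1 - a)) * ennreal (Gamma a)"
    by (subst nn_integral_cmult) (simp_all add: Gamma_conv_nn_integral_real[OF a])
  also have "ennreal \<bar>1 / c\<bar> * (ennreal (c powr (1 - a)) * ennreal (Gamma a)) = ennreal (Gamma a * c powr - a)"
    using c a Gamma_real_pos[OF a]
    by (simp add: ennreal_mult[symmetric] powr_diff powr_minus field_simps)
  finally show ?thesis .
qed

lemma nn_integral_real_scale:
  fixes f :: "real \<Rightarrow> ennreal"
  assumes f: "f \<in> borel_measurable borel" and c: "0 < c"
  shows "(\<integral>\<^sup>+ x. f x \<partial>lborel) = (\<integral>\<^sup>+ x. ennreal c * f (c * x) \<partial>lborel)"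
proof -
  note [measurable] = f
  have "(\<integral>\<^sup>+ x. f x \<partial>lborel) = ennreal \<bar>c\<bar> * (\<integral>\<^sup>+ x. f (0 + c * x) \<partial>lborel)"
    by (rule nn_integral_real_affine) (use f c in auto)
  also have "\<dots> = (\<integral>\<^sup>+ x. ennreal c * f (c * x) \<partial>lborel)"
    using c by (simp add: nn_integral_cmult)
  finally show ?thesis .
qed

text \<open>A gamma integral in \<open>u - y\<close>.  It writes the weight \<open>S\<^sup>1\<^sup>-\<^sup>\<alpha> exp(- y S)\<close>, which a size-biased
pick leaves behind, as a mixture of the tilts \<open>S exp(- u S)\<close>.\<close>

lemma powr_exp_mixture:
  fixes S y \<alpha> :: real
  assumes \<alpha>: "0 < \<alpha>" and S: "0 < S"
  shows "ennreal (S powr (1 - \<alpha>) * exp (- y * S)) =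
    (\<integral>\<^sup>+ u. indicator {y<..} u * ennreal (S * exp (- u * S) * (u - y) powr (\<alpha> - 1) / Gamma \<alpha>) \<partial>lborel)"
proof -
  have G: "0 < Gamma \<alpha>" using \<alpha> by (rule Gamma_real_pos)
  let ?f = "\<lambda>u. indicator {y<..} u * ennreal (S * exp (- u * S) * (u - y) powr (\<alpha> - 1) / Gamma \<alpha>)"
  have "(\<integral>\<^sup>+ u. ?f u \<partial>lborel) = ennreal \<bar>1\<bar> * (\<integral>\<^sup>+ v. ?f (y + 1 * v) \<partial>lborel)"
    by (rule nn_integral_real_affine) auto
  also have "\<dots> = (\<integral>\<^sup>+ v. ennreal (S * exp (- y * S) / Gamma \<alpha>) *
      (indicator {0<..} v * ennreal (v powr (\<alpha> - 1) * exp (- S * v))) \<partial>lborel)"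
  proof -
    have "exp (- (y + v) * S) = exp (- y * S) * exp (- S * v)" for v
      by (simp add: exp_add[symmetric] algebra_simps)
    then have "?f (y + 1 * v) = ennreal (S * exp (- y * S) / Gamma \<alpha>) *
        (indicator {0<..} v * ennreal (v powr (\<alpha> - 1) * exp (- S * v)))" for v
      using S G by (simp add: indicator_def ennreal_mult[symmetric] mult_ac)
    then show ?thesis by simp
  qed
  also have "\<dots> = ennreal (S * exp (- y * S) / Gamma \<alpha>) * ennreal (Gamma \<alpha> * S powr - \<alpha>)"
    by (subst nn_integral_cmult) (simp_all add: nn_integral_Gamma_scaled[OF \<alpha> S, simplified])
  also have "\<dots> = ennreal (S powr (1 - \<alpha>) * exp (- y * S))"
    using S G by (simp add: ennreal_mult[symmetric] powr_diff powr_minus field_simps)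
  finally show ?thesis by simp
qed

text \<open>The computation behind the recursion, for a fixed sum \<open>S\<close> of the jumps that are not picked.  The
substitutions are \<open>s = S x\<close>, then \<open>powr_exp_mixture\<close> with \<open>y = \<lambda> (1 + x)\<close>, and finally, for fixed \<open>u\<close>,
\<open>x = b (u - \<lambda>) / \<lambda>\<close>, under which \<open>u - y = (u - \<lambda>) (1 - b)\<close> and all powers of \<open>u - \<lambda>\<close> cancel.\<close>

lemma tilted_pick_mixture:
  fixes S lam \<alpha> :: real and h :: "real \<Rightarrow> ennreal"
  assumes \<alpha>: "0 < \<alpha>" "\<alpha> < 1" and S: "0 < S" and lam: "0 < lam"
    and h [measurable]: "h \<in> borel_measurable borel"
  shows "(\<integral>\<^sup>+ s. ennreal (s * exp (- lam * (s + S))) * h (s / (s + S)) \<partial>levy_measure (stable_levy_density \<alpha>)) =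
    (\<integral>\<^sup>+ u. indicator {lam<..} u * ennreal (S * exp (- u * S) * (\<alpha> * lam powr (\<alpha> - 1))) *
      (\<integral>\<^sup>+ b. ennreal (beta_density (1 - \<alpha>) \<alpha> b) * h (1 - stick_factor b (lam / u)) \<partial>lborel) \<partial>lborel)"
proof -
  let ?l = "\<lambda>s. ennreal (s * exp (- lam * (s + S))) * h (s / (s + S))"
  let ?a = "\<lambda>x. indicator {0<..} x * ennreal (\<alpha> * x powr - \<alpha> / Gamma (1 - \<alpha>)) * h (x / (1 + x))"
  let ?H = "\<lambda>u x. ?a x *
    (indicator {lam * (1 + x)<..} u * ennreal (S * exp (- u * S) * (u - lam * (1 + x)) powr (\<alpha> - 1) / Gamma \<alpha>))"
  let ?c = "\<lambda>u. ennreal (S * exp (- u * S) * (\<alpha> * lam powr (\<alpha> - 1)))"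
  let ?q = "\<lambda>u. \<integral>\<^sup>+ b. ennreal (beta_density (1 - \<alpha>) \<alpha> b) * h (1 - stick_factor b (lam / u)) \<partial>lborel"
  have G: "0 < Gamma \<alpha>" "0 < Gamma (1 - \<alpha>)" using \<alpha> by (simp_all add: Gamma_real_pos)
  let ?F = "\<lambda>s. indicator {0<..} s * ennreal (\<alpha> * s powr (- \<alpha>) / Gamma (1 - \<alpha>) * exp (- lam * (s + S))) * h (s / (s + S))"
  have "(\<integral>\<^sup>+ s. ?l s \<partial>levy_measure (stable_levy_density \<alpha>)) =
      (\<integral>\<^sup>+ s. ?F s \<partial>lborel)"
  proof -
    have "(\<integral>\<^sup>+ s. ?l s \<partial>levy_measure (stable_levy_density \<alpha>)) =
      (\<integral>\<^sup>+ s. indicator {0<..} s * ennreal (stable_levy_density \<alpha> s) * ?l s \<partial>lborel)"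
      unfolding levy_measure_def by (rule nn_integral_density) measurable
    also have "\<dots> = (\<integral>\<^sup>+ s. ?F s \<partial>lborel)"
    proof (intro nn_integral_cong)
      fix s :: real
      show "indicator {0<..} s * ennreal (stable_levy_density \<alpha> s) * ?l s = ?F s"
      proof (cases "0 < s")
        case True
        have "s powr (- \<alpha> - 1) * s = s powr - \<alpha>" using True by (simp add: powr_diff)
        then have "stable_levy_density \<alpha> s * (s * exp (- lam * (s + S))) = \<alpha> * s powr (- \<alpha>) / Gamma (1 - \<alpha>) * exp (- lam * (s + S))"
          by (simp add: stable_levy_density_def field_simps)
        moreover have "0 \<le> stable_levy_density \<alpha> s" using \<alpha> G by (simp add: stable_levy_density_def)
        ultimately show ?thesis using True by (simp add: mult.assoc[symmetric] ennreal_mult[symmetric])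
      qed simp
    qed
    finally show ?thesis .
  qed
  also have "\<dots> = (\<integral>\<^sup>+ x. ennreal S * ?F (S * x) \<partial>lborel)"
    by (rule nn_integral_real_scale) (use S in auto)
  also have "\<dots> = (\<integral>\<^sup>+ x. ?a x *
      ennreal (S powr (1 - \<alpha>) * exp (- (lam * (1 + x)) * S)) \<partial>lborel)"
  proof (intro nn_integral_cong)
    fix x :: real
    show "ennreal S * ?F (S * x) = ?a x *
      ennreal (S powr (1 - \<alpha>) * exp (- (lam * (1 + x)) * S))"
    proof (cases "0 < x")
      case True
      have 1: "S * x / (S * x + S) = x / (1 + x)"
      proof -
        have "S * x + S = S * (1 + x)" by (simp add: algebra_simps)
        then show ?thesis using S by simp
      qed
      have 2: "- lam * (S * x + S) = - (lam * (1 + x)) * S" by (simp add: algebra_simps)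
      have 3: "S * (\<alpha> * (S * x) powr (- \<alpha>) / Gamma (1 - \<alpha>) * E) =
          (\<alpha> * x powr - \<alpha> / Gamma (1 - \<alpha>)) * (S powr (1 - \<alpha>) * E)" for E
        using True S by (simp add: powr_mult powr_diff powr_minus field_simps)
      have "ennreal S * ?F (S * x) =
          ennreal (S * (\<alpha> * (S * x) powr (- \<alpha>) / Gamma (1 - \<alpha>) * exp (- (lam * (1 + x)) * S))) * h (x / (1 + x))"
      proof -
        have e: "ennreal S * (ennreal p * H) = ennreal (S * p) * H" if "0 \<le> p" for p H
          using S that by (simp add: ennreal_mult mult.assoc)
        have ind: "indicator {0<..} (S * x) = (1::ennreal)" using True S by simp
        show ?thesis
          unfolding 1 2 ind mult_1
          by (rule e) (use \<alpha> G in auto)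
      qed
      also have "\<dots> = ennreal (\<alpha> * x powr - \<alpha> / Gamma (1 - \<alpha>)) * ennreal (S powr (1 - \<alpha>) * exp (- (lam * (1 + x)) * S)) * h (x / (1 + x))"
        unfolding 3 using \<alpha> G by (subst ennreal_mult) auto
      finally show ?thesis using True by (simp add: mult_ac)
    qed (use S in \<open>simp add: zero_less_mult_iff\<close>)
  qed
  also have "\<dots> = (\<integral>\<^sup>+ x. \<integral>\<^sup>+ u. ?H u x \<partial>lborel \<partial>lborel)"
    unfolding powr_exp_mixture[OF \<alpha>(1) S]
    by (intro nn_integral_cong nn_integral_cmult[symmetric]) measurable
  also have "\<dots> = (\<integral>\<^sup>+ u. \<integral>\<^sup>+ x. ?H u x \<partial>lborel \<partial>lborel)"
  proof (rule lborel_pair.Fubini')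
    have "(\<lambda>z. (indicator {0<..} (snd z) * ennreal (\<alpha> * snd z powr - \<alpha> / Gamma (1 - \<alpha>)) * h (snd z / (1 + snd z))) *
      ((if lam * (1 + snd z) < fst z then 1 else 0) * ennreal (S * exp (- fst z * S) * (fst z - lam * (1 + snd z)) powr (\<alpha> - 1) / Gamma \<alpha>)))
      \<in> borel_measurable (lborel \<Otimes>\<^sub>M lborel)" by measurable
    then show "(\<lambda>(u, x). ?H u x)
      \<in> borel_measurable (lborel \<Otimes>\<^sub>M lborel)"
      by (simp add: case_prod_beta' indicator_def of_bool_def)
  qed
  also have "\<dots> = (\<integral>\<^sup>+ u. indicator {lam<..} u * ?c u *
      ?q u \<partial>lborel)"
  proof (intro nn_integral_cong)
    fix u :: real
    have Hm: "?H u \<in> borel_measurable borel"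
    proof -
      have "(\<lambda>x. ?a x *
       ((if lam * (1 + x) < u then 1 else 0) * ennreal (S * exp (- u * S) * (u - lam * (1 + x)) powr (\<alpha> - 1) / Gamma \<alpha>)))
        \<in> borel_measurable borel" by measurable
      then show ?thesis by (simp add: indicator_def of_bool_def)
    qed
    show "integral\<^sup>N lborel (?H u) = indicator {lam<..} u * ?c u *
      ?q u"
    proof (cases "lam < u")
      case False
      have H0: "?H u x = 0" for x
      proof (cases "0 < x")
        case True
        then have "lam \<le> lam * (1 + x)" using lam by simp
        then have "\<not> lam * (1 + x) < u" using False by linarith
        then show ?thesis by simp
      qed simp
      have "integral\<^sup>N lborel (?H u) = integral\<^sup>N lborel (\<lambda>_ :: real. 0)"
        by (intro nn_integral_cong) (rule H0)
      then show ?thesis using False by simp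
    next
      case True
      define c where "c = (u - lam) / lam"
      have c: "0 < c" using True lam by (simp add: c_def)
      have lc: "lam * c = u - lam" using lam by (simp add: c_def)
      have "integral\<^sup>N lborel (?H u) = (\<integral>\<^sup>+ b. ennreal c * ?H u (c * b) \<partial>lborel)"
        by (rule nn_integral_real_scale[OF Hm c])
      also have "\<dots> = (\<integral>\<^sup>+ b. ?c u *
          (ennreal (beta_density (1 - \<alpha>) \<alpha> b) * h (1 - stick_factor b (lam / u))) \<partial>lborel)"
      proof (intro nn_integral_cong)
        fix b :: real
        have ub: "u - lam * (1 + c * b) = (u - lam) * (1 - b)"
        proof -
          have "u - lam * (1 + c * b) = u - lam - (lam * c) * b" by (simp add: algebra_simps)
          then show ?thesis unfolding lc by (simp add: algebra_simps)
        qed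
        show "ennreal c * ?H u (c * b) = ?c u *
          (ennreal (beta_density (1 - \<alpha>) \<alpha> b) * h (1 - stick_factor b (lam / u)))"
        proof (cases "0 < b \<and> b < 1")
          case False
          then have b0: "beta_density (1 - \<alpha>) \<alpha> b = 0" by (auto simp: beta_density_def)
          have H0: "?H u (c * b) = 0"
          proof (cases "0 < b")
            case True
            then have "1 \<le> b" using False by simp
            then have "(u - lam) * (1 - b) \<le> 0" using \<open>lam < u\<close> by (simp add: mult_le_0_iff)
            then have "\<not> lam * (1 + c * b) < u" using ub by linarith
            then show ?thesis by simp
          qed (use c in \<open>simp add: zero_less_mult_iff\<close>)
          show ?thesis unfolding H0 b0 by simp
        next
          case b: True
          have "0 < (u - lam) * (1 - b)" using b True by simp
          then have lt: "lam * (1 + c * b) < u" using ub by linarith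
          have sf: "1 - stick_factor b (lam / u) = c * b / (1 + c * b)"
          proof -
            have "(1 - lam / u) / (lam / u) = c" using lam True by (simp add: c_def field_simps)
            moreover have "0 < 1 + c * b" using c b by (intro add_pos_pos) auto
            ultimately show ?thesis by (simp add: stick_factor_def field_simps)
          qed
          have Beta: "Beta (1 - \<alpha>) \<alpha> = Gamma (1 - \<alpha>) * Gamma \<alpha>"
            by (simp add: Beta_def)
          \<comment> \<open>The factor \<open>c\<close> is the Jacobian; here the powers of \<open>u - lam\<close> cancel.\<close>
          have pw: "c * c powr - \<alpha> * (u - lam) powr (\<alpha> - 1) = lam powr (\<alpha> - 1)"
            using True lam by (simp add: c_def powr_divide powr_diff powr_minus field_simps)
          have "c * ((\<alpha> * (c * b) powr - \<alpha> / Gamma (1 - \<alpha>)) *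
                (S * exp (- u * S) * ((u - lam) * (1 - b)) powr (\<alpha> - 1) / Gamma \<alpha>)) =
             (c * c powr - \<alpha> * (u - lam) powr (\<alpha> - 1)) * (S * exp (- u * S) * \<alpha> *
             (b powr - \<alpha> * (1 - b) powr (\<alpha> - 1) / (Gamma (1 - \<alpha>) * Gamma \<alpha>)))"
          proof -
            have p1: "((u - lam) * (1 - b)) powr (\<alpha> - 1) = (u - lam) powr (\<alpha> - 1) * (1 - b) powr (\<alpha> - 1)"
              by (rule powr_mult)
            have p2: "(c * b) powr - \<alpha> = c powr - \<alpha> * b powr - \<alpha>"
              by (rule powr_mult)
            show ?thesis unfolding p1 p2 by (simp add: mult_ac)
          qed
          then have real_eq: "c * ((\<alpha> * (c * b) powr - \<alpha> / Gamma (1 - \<alpha>)) *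
                (S * exp (- u * S) * (u - lam * (1 + c * b)) powr (\<alpha> - 1) / Gamma \<alpha>)) =
              (S * exp (- u * S) * (\<alpha> * lam powr (\<alpha> - 1))) * beta_density (1 - \<alpha>) \<alpha> b"
            unfolding pw ub using b by (simp add: beta_density_def Beta)
          have "ennreal c * ?H u (c * b) = ennreal (c * ((\<alpha> * (c * b) powr - \<alpha> / Gamma (1 - \<alpha>)) *
                (S * exp (- u * S) * (u - lam * (1 + c * b)) powr (\<alpha> - 1) / Gamma \<alpha>))) * h (c * b / (1 + c * b))"
          proof -
            have e3: "ennreal c * (ennreal p * H * ennreal q) = ennreal (c * (p * q)) * H"
              if "0 \<le> p" "0 \<le> q" for p q H
              using c that by (simp add: ennreal_mult mult_ac)
            have ind: "indicator {0<..} (c * b) = (1::ennreal)" "indicator {lam * (1 + c * b)<..} u = (1::ennreal)"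
              using lt c b by simp_all
            show ?thesis
              unfolding ind mult_1
              by (rule e3) (use \<alpha> G S in auto)
          qed
          also have "\<dots> = ?c u *
            (ennreal (beta_density (1 - \<alpha>) \<alpha> b) * h (1 - stick_factor b (lam / u)))"
            unfolding real_eq sf using \<alpha> S G
            by (subst ennreal_mult) (auto simp: mult.assoc beta_density_def Beta)
          finally show ?thesis .
        qed
      qed
      also have "\<dots> = ?c u *
          ?q u"
        by (rule nn_integral_cmult) measurable
      finally show ?thesis using True by simp
    qed
  qed
  finally show ?thesis .
qed

lemma nn_integral_exp_tail:
  "(\<integral>\<^sup>+ x. ennreal (exp (- x)) * indicator {t..} x \<partial>lborel) = ennreal (exp (- t))" for t :: real
proof -
  have "(\<integral>\<^sup>+ x. ennreal (exp (- x)) * indicator {t..} x \<partial>lborel) = ennreal (0 - (- exp (- t)))"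
  proof (rule nn_integral_FTC_atLeast)
    have "((\<lambda>x::real. exp (- x)) \<longlongrightarrow> 0) at_top"
      by (intro filterlim_compose[OF exp_at_bot] filterlim_uminus_at_bot_at_top)
    from tendsto_minus[OF this] show "((\<lambda>x::real. - exp (- x)) \<longlongrightarrow> 0) at_top" by simp
  qed (auto intro!: derivative_eq_intros)
  then show ?thesis by simp
qed

text \<open>The tilt \<open>U\<close> with \<open>U\<^sup>\<alpha> = \<lambda>\<^sup>\<alpha> + x\<close>; for \<open>x = e\<^sub>1 + \<dots> + e\<^sub>k\<close> it is the tilt of the partition
after \<open>k\<close> picks.\<close>

definition arrival_tilt :: "real \<Rightarrow> real \<Rightarrow> real \<Rightarrow> real" where
  "arrival_tilt \<alpha> lam x = (lam powr \<alpha> + x) powr (1 / \<alpha>)"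

lemma arrival_tilt_pos: "0 < lam \<Longrightarrow> 0 \<le> x \<Longrightarrow> 0 < arrival_tilt \<alpha> lam x"
  using add_pos_nonneg[of "lam powr \<alpha>" x] by (simp add: arrival_tilt_def)

lemma arrival_tilt_ge:
  assumes "0 < \<alpha>" "0 < u" "0 \<le> x"
  shows "u \<le> arrival_tilt \<alpha> u x"
proof -
  have "u = (u powr \<alpha>) powr (1 / \<alpha>)" using assms by (simp add: powr_powr)
  also have "\<dots> \<le> arrival_tilt \<alpha> u x"
    unfolding arrival_tilt_def using assms by (intro powr_mono2) auto
  finally show ?thesis .
qed

lemma arrival_tilt_gt_iff:
  assumes "0 < \<alpha>" "0 < u" "0 \<le> x" "0 < a"
  shows "a < arrival_tilt \<alpha> u x \<longleftrightarrow> a powr \<alpha> - u powr \<alpha> < x"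
proof -
  let ?t = "arrival_tilt \<alpha> u x"
  have t: "0 < ?t" using assms by (simp add: arrival_tilt_pos)
  have pos: "0 < u powr \<alpha> + x" using assms by (intro add_pos_nonneg) auto
  have "a < ?t \<longleftrightarrow> a powr \<alpha> < ?t powr \<alpha>"
    using assms t powr_less_mono2[of \<alpha> a ?t] powr_mono2[of \<alpha> ?t a] by (auto simp: not_less[symmetric])
  also have "?t powr \<alpha> = u powr \<alpha> + x" using pos assms(1) by (simp add: arrival_tilt_def powr_powr)
  finally show ?thesis by auto
qed

lemma arrival_tilt_measurable [measurable (raw)]:
  assumes [measurable]: "f \<in> borel_measurable M" "g \<in> borel_measurable M"
  shows "(\<lambda>z. arrival_tilt \<alpha> (f z) (g z)) \<in> borel_measurable M"
  unfolding arrival_tilt_def by measurable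

text \<open>The change of variables \<open>u\<^sup>\<alpha> = \<lambda>\<^sup>\<alpha> + x\<close> for the exponential law, obtained by comparing tails.\<close>

lemma exponential_stable_substitution:
  fixes \<alpha> lam :: real and g :: "real \<Rightarrow> ennreal"
  assumes \<alpha>: "0 < \<alpha>" and lam: "0 < lam" and g [measurable]: "g \<in> borel_measurable borel"
  shows "(\<integral>\<^sup>+ x. ennreal (exponential_density 1 x) * g (arrival_tilt \<alpha> lam x) \<partial>lborel) =
    (\<integral>\<^sup>+ u. indicator {lam<..} u * ennreal (\<alpha> * u powr (\<alpha> - 1) * exp (lam powr \<alpha> - u powr \<alpha>)) * g u \<partial>lborel)"
proof -
  define U where "U = arrival_tilt \<alpha> lam"
  define d where "d u = indicator {lam<..} u * ennreal (\<alpha> * u powr (\<alpha> - 1) * exp (lam powr \<alpha> - u powr \<alpha>))" for u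
  have [measurable]: "U \<in> borel_measurable borel" "d \<in> borel_measurable borel"
    unfolding U_def d_def by measurable
  let ?M1 = "distr (density lborel (\<lambda>x. ennreal (exponential_density 1 x))) borel U"
  let ?M2 = "density lborel d"
  have U_gt: "a < U x \<longleftrightarrow> a powr \<alpha> - lam powr \<alpha> < x" if "0 \<le> x" "0 < a" for a x
    unfolding U_def by (rule arrival_tilt_gt_iff[OF \<alpha> lam that])
  have e1: "emeasure ?M1 {a<..} = ennreal (exp (lam powr \<alpha> - (max a lam) powr \<alpha>))" for a
  proof -
    have "emeasure ?M1 {a<..} = (\<integral>\<^sup>+ x. ennreal (exponential_density 1 x) * indicator {a<..} (U x) \<partial>lborel)"
    proof -
      have "emeasure ?M1 {a<..} = integral\<^sup>N ?M1 (indicator {a<..})" by simp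
      also have "\<dots> = (\<integral>\<^sup>+ x. ennreal (exponential_density 1 x) * indicator {a<..} (U x) \<partial>lborel)"
        by (subst nn_integral_distr, measurable, subst nn_integral_density) auto
      finally show ?thesis .
    qed
    also have "\<dots> = (\<integral>\<^sup>+ x. ennreal (exp (- x)) * indicator {max a lam powr \<alpha> - lam powr \<alpha>..} x \<partial>lborel)"
    proof (rule nn_integral_cong_AE)
      have "AE x in lborel. x \<noteq> (0::real)" "AE x in lborel. x \<noteq> max a lam powr \<alpha> - lam powr \<alpha>"
        by (rule AE_lborel_singleton)+
      then show "AE x in lborel. ennreal (exponential_density 1 x) * indicator {a<..} (U x) =
          ennreal (exp (- x)) * indicator {max a lam powr \<alpha> - lam powr \<alpha>..} x"
      proof eventually_elim
        case (elim x)
        have le: "0 \<le> max a lam powr \<alpha> - lam powr \<alpha>"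
          using powr_mono2[of \<alpha> lam "max a lam"] \<alpha> lam by simp
        show ?case
        proof (cases "0 < x")
          case True
          have "lam < U x" using U_gt[of x lam] True lam by simp
          then have "a < U x \<longleftrightarrow> max a lam < U x" by auto
          also have "\<dots> \<longleftrightarrow> max a lam powr \<alpha> - lam powr \<alpha> < x"
            using U_gt[of x "max a lam"] True lam by simp
          finally show ?thesis using True elim by (auto simp: exponential_density_def indicator_def)
        qed (use elim le in \<open>auto simp: exponential_density_def indicator_def\<close>)
      qed
    qed
    also have "\<dots> = ennreal (exp (lam powr \<alpha> - (max a lam) powr \<alpha>))"
      by (subst nn_integral_exp_tail) simp
    finally show ?thesis .
  qed
  have e2: "emeasure ?M2 {a<..} = ennreal (exp (lam powr \<alpha> - (max a lam) powr \<alpha>))" for a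
  proof -
    have "emeasure ?M2 {a<..} = (\<integral>\<^sup>+ u. d u * indicator {a<..} u \<partial>lborel)"
      by (rule emeasure_density) auto
    also have "\<dots> = (\<integral>\<^sup>+ u. ennreal (\<alpha> * u powr (\<alpha> - 1) * exp (lam powr \<alpha> - u powr \<alpha>)) * indicator {max a lam..} u \<partial>lborel)"
    proof (rule nn_integral_cong_AE)
      have "AE u in lborel. u \<noteq> max a lam" by (rule AE_lborel_singleton)
      then show "AE u in lborel. d u * indicator {a<..} u =
          ennreal (\<alpha> * u powr (\<alpha> - 1) * exp (lam powr \<alpha> - u powr \<alpha>)) * indicator {max a lam..} u"
        by eventually_elim (auto simp: d_def indicator_def)
    qed
    also have "\<dots> = ennreal (0 - (- exp (lam powr \<alpha> - (max a lam) powr \<alpha>)))"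
    proof (rule nn_integral_FTC_atLeast)
      show "((\<lambda>u. - exp (lam powr \<alpha> - u powr \<alpha>)) has_real_derivative \<alpha> * u powr (\<alpha> - 1) * exp (lam powr \<alpha> - u powr \<alpha>)) (at u)"
        if "max a lam \<le> u" for u
        using that lam by (auto intro!: derivative_eq_intros)
      have "filterlim (\<lambda>u. u powr \<alpha>) at_top (at_top :: real filter)"
      proof -
        have "filterlim (\<lambda>u. exp (\<alpha> * ln u)) at_top (at_top :: real filter)"
          by (intro filterlim_compose[OF exp_at_top]
              filterlim_tendsto_pos_mult_at_top[OF tendsto_const \<alpha> ln_at_top])
        moreover have "eventually (\<lambda>u::real. exp (\<alpha> * ln u) = u powr \<alpha>) at_top"
          using eventually_gt_at_top[of 0] by eventually_elim (simp add: powr_def)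
        ultimately show ?thesis by (rule filterlim_cong[THEN iffD1, OF refl refl, rotated])
      qed
      then have "filterlim (\<lambda>u. lam powr \<alpha> - u powr \<alpha>) at_bot (at_top :: real filter)"
        unfolding filterlim_uminus_at_bot
        using filterlim_tendsto_add_at_top[OF tendsto_const[of "- (lam powr \<alpha>)"]] by simp
      from filterlim_compose[OF exp_at_bot this]
      have "((\<lambda>u. exp (lam powr \<alpha> - u powr \<alpha>)) \<longlongrightarrow> 0) (at_top :: real filter)" .
      from tendsto_minus[OF this] show "((\<lambda>u. - exp (lam powr \<alpha> - u powr \<alpha>)) \<longlongrightarrow> 0) at_top" by simp
    qed (use \<alpha> in auto)
    finally show ?thesis by simp
  qed
  have "?M1 = ?M2"
    by (rule measure_eqI_lessThan) (auto simp: e1 e2)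
  then have "integral\<^sup>N ?M1 g = integral\<^sup>N ?M2 g" by simp
  moreover have "integral\<^sup>N ?M1 g = (\<integral>\<^sup>+ x. ennreal (exponential_density 1 x) * g (U x) \<partial>lborel)"
    by (subst nn_integral_distr, measurable, subst nn_integral_density) auto
  moreover have "integral\<^sup>N ?M2 g = (\<integral>\<^sup>+ u. d u * g u \<partial>lborel)"
    by (subst nn_integral_density) auto
  ultimately show ?thesis by (simp add: U_def d_def)
qed

text \<open>The factor \<open>w\<close> decreases in \<open>b\<close>, so the increasing substitution is made in \<open>v = 1 - w\<close>, where
\<open>b = (r / (1 - r)) (v / (1 - v))\<close> maps \<open>[0, 1 - r]\<close> onto \<open>[0, 1]\<close>.\<close>

lemma beta_stick_factor_substitution:
  fixes \<alpha> r :: real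
  assumes \<alpha>: "0 < \<alpha>" "\<alpha> < 1" and r: "0 < r" "r < 1" and B [measurable]: "B \<in> sets borel"
  shows "(\<integral>\<^sup>+ b. ennreal (beta_density (1 - \<alpha>) \<alpha> b) * indicator B (stick_factor b r) \<partial>lborel) =
    (\<integral>\<^sup>+ w. ennreal (stick_factor_density \<alpha> r w) * indicator B w \<partial>lborel)"
proof -
  have G: "0 < Gamma \<alpha>" "0 < Gamma (1 - \<alpha>)" using \<alpha> by (simp_all add: Gamma_real_pos)
  have Beta: "Beta (1 - \<alpha>) \<alpha> = Gamma (1 - \<alpha>) * Gamma \<alpha>" by (simp add: Beta_def)
  define g where "g v = (r / (1 - r)) * (v / (1 - v))" for v
  define g' where "g' v = (r / (1 - r)) * (1 / (1 - v)\<^sup>2)" for v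
  define f where "f b = beta_density (1 - \<alpha>) \<alpha> b * indicator B (stick_factor b r)" for b
  have [measurable]: "f \<in> borel_measurable borel" unfolding f_def by measurable
  have g0: "g 0 = 0" and g1: "g (1 - r) = 1" using r by (simp_all add: g_def)
  have "(\<integral>\<^sup>+ b. ennreal (beta_density (1 - \<alpha>) \<alpha> b) * indicator B (stick_factor b r) \<partial>lborel) =
      (\<integral>\<^sup>+ b. ennreal (f b * indicator {g 0..g (1 - r)} b) \<partial>lborel)"
    by (intro nn_integral_cong) (auto simp: f_def g0 g1 indicator_def beta_density_def)
  also have "\<dots> = (\<integral>\<^sup>+ v. ennreal (f (g v) * g' v * indicator {0..1 - r} v) \<partial>lborel)"
  proof (rule nn_integral_substitution)
    show "set_borel_measurable borel {g 0..g (1 - r)} f"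
      unfolding set_borel_measurable_def by measurable
    show "(g has_real_derivative g' x) (at x)" if "x \<in> {0..1 - r}" for x
    proof -
      have "1 - x \<noteq> 0" using that r by auto
      then have "((\<lambda>v. v / (1 - v)) has_real_derivative 1 / (1 - x)\<^sup>2) (at x)"
        by (auto intro!: derivative_eq_intros simp: power2_eq_square)
      then show ?thesis unfolding g_def g'_def by (rule DERIV_cmult)
    qed
    show "continuous_on {0..1 - r} g'"
      unfolding g'_def using r by (intro continuous_intros) auto
    show "0 \<le> g' x" for x using r by (simp add: g'_def)
  qed (use r in auto)
  also have "\<dots> = (\<integral>\<^sup>+ v. ennreal (stick_factor_density \<alpha> r (1 - v)) * indicator B (1 - v) \<partial>lborel)"
  proof (intro nn_integral_cong)
    fix v :: real
    have "f (g v) * g' v * indicator {0..1 - r} v = stick_factor_density \<alpha> r (1 - v) * indicator B (1 - v)"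
    proof (cases "0 < v \<and> v < 1 - r")
      case False
      then have "v \<in> {0..1 - r} \<Longrightarrow> v = 0 \<or> v = 1 - r" by auto
      then have "f (g v) * indicator {0..1 - r} v = 0"
        by (cases "v \<in> {0..1 - r}") (auto simp: f_def g0 g1 beta_density_def)
      moreover have "stick_factor_density \<alpha> r (1 - v) = 0"
        using False by (auto simp: stick_factor_density_def)
      ultimately show ?thesis by (metis mult.commute mult.left_commute mult_zero_left)
    next
      case v: True
      define w where "w = 1 - v"
      have w: "r < w" "w < 1" "0 < w" using v r by (auto simp: w_def)
      have gv: "g v = r * (1 - w) / (w * (1 - r))" by (simp add: g_def w_def)
      have gv1: "1 - g v = (w - r) / (w * (1 - r))"
        unfolding gv using w r by (simp add: field_simps)
      have gpos: "0 < g v" "g v < 1"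
      proof -
        show "0 < g v" unfolding gv using w r by simp
        have "0 < 1 - g v" unfolding gv1 using w r by simp
        then show "g v < 1" by simp
      qed
      have sf: "stick_factor (g v) r = w"
      proof -
        have "g v * ((1 - r) / r) = (1 - w) / w" unfolding gv using w r by simp
        then have "g v * ((1 - r) / r) + 1 = 1 / w" using w by (simp add: field_simps)
        then show ?thesis unfolding stick_factor_def by simp
      qed
      have bd: "beta_density (1 - \<alpha>) \<alpha> (g v) = (g v) powr - \<alpha> * (1 - g v) powr (\<alpha> - 1) / (Gamma (1 - \<alpha>) * Gamma \<alpha>)"
        using gpos by (simp add: beta_density_def Beta)
      have p1: "(g v) powr - \<alpha> = r powr - \<alpha> * (1 - w) powr - \<alpha> * w powr \<alpha> * (1 - r) powr \<alpha>"
        unfolding gv powr_divide powr_mult using w r by (simp add: powr_minus divide_simps)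
      have p2: "(1 - g v) powr (\<alpha> - 1) = (w - r) powr (\<alpha> - 1) * (w powr (1 - \<alpha>) * (1 - r) powr (1 - \<alpha>))"
        unfolding gv1 powr_divide powr_mult using w r by (simp add: powr_diff divide_simps)
      have p3: "w powr \<alpha> * w powr (1 - \<alpha>) = w" "(1 - r) powr \<alpha> * (1 - r) powr (1 - \<alpha>) = 1 - r"
        "r powr (1 - \<alpha>) = r * r powr - \<alpha>"
        using w r by (simp_all add: powr_add[symmetric] powr_diff powr_minus field_simps)
      have "beta_density (1 - \<alpha>) \<alpha> (g v) * g' v =
        (w powr \<alpha> * w powr (1 - \<alpha>)) * ((1 - r) powr \<alpha> * (1 - r) powr (1 - \<alpha>)) *
        ((r powr - \<alpha> * r) * (1 - w) powr - \<alpha> * (w - r) powr (\<alpha> - 1)) / (w\<^sup>2 * (1 - r)) / (Gamma (1 - \<alpha>) * Gamma \<alpha>)"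
        unfolding bd p1 p2 g'_def by (simp add: w_def mult_ac)
      also have "\<dots> = stick_factor_density \<alpha> r w"
      proof -
        have key: "w * (1 - r) * q / (w\<^sup>2 * (1 - r)) = q / w" for q
          using w r by (simp add: power2_eq_square)
        show ?thesis
          unfolding p3(1,2) key using w by (simp add: stick_factor_density_def p3(3) powr_minus_divide mult_ac)
      qed
      finally have main: "beta_density (1 - \<alpha>) \<alpha> (g v) * g' v = stick_factor_density \<alpha> r w" .
      have "f (g v) * g' v * indicator {0..1 - r} v = (beta_density (1 - \<alpha>) \<alpha> (g v) * g' v) * indicator B w"
        using v by (simp add: f_def sf)
      then show ?thesis unfolding main by (simp add: w_def)
    qed
    then show "ennreal (f (g v) * g' v * indicator {0..1 - r} v) = ennreal (stick_factor_density \<alpha> r (1 - v)) * indicator B (1 - v)"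
      by (simp add: indicator_def)
  qed
  also have "\<dots> = (\<integral>\<^sup>+ w. ennreal (stick_factor_density \<alpha> r w) * indicator B w \<partial>lborel)"
    by (subst nn_integral_real_affine[where c = "-1" and t = 1 and f = "\<lambda>w. ennreal (stick_factor_density \<alpha> r w) * indicator B w"]) auto
  finally show ?thesis .
qed

section \<open>Size-biased deletion from tilted stable partitions\<close>

lemma sigma_finite_levy_measure:
  assumes [measurable]: "\<rho> \<in> borel_measurable borel"
  shows "sigma_finite_measure (levy_measure \<rho>)"
  unfolding levy_measure_def
  by (subst sigma_finite_measure.sigma_finite_iff_density_finite[OF lborel.sigma_finite_measure_axioms]) (auto simp: indicator_def)

lemma sums_del:
  fixes a :: "nat \<Rightarrow> real"
  assumes "\<And>j. 0 \<le> a j" "a sums s"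
  shows "del k a sums (s - a k)"
proof -
  have "(a has_sum s) UNIV"
    using assms(2,1) by (rule sums_nonneg_imp_has_sum)
  moreover have "(a has_sum a k) {k}"
    using has_sum_finite[of "{k}" a] by simp
  ultimately have "(a has_sum (s - a k)) (UNIV - {k})"
    by (rule has_sum_Diff) simp
  then have "(a has_sum (s - a k)) (range (skip k))"
    by (simp add: range_skip Compl_eq_Diff_UNIV)
  then have "(del k a has_sum (s - a k)) UNIV"
    by (subst (asm) has_sum_reindex[OF inj_skip]) (simp add: del_def[abs_def] o_def)
  then show ?thesis by (rule has_sum_imp_sums)
qed

definition tilt_const :: "real \<Rightarrow> real \<Rightarrow> real" where
  "tilt_const \<alpha> lam = lam powr (1 - \<alpha>) / \<alpha> * exp (lam powr \<alpha>)"

definition renormalized :: "nat \<Rightarrow> (nat \<Rightarrow> real) \<Rightarrow> nat \<Rightarrow> real" where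
  "renormalized k p = (\<lambda>j. del k p j / (1 - p k))"

lemma renormalized_measurable [measurable]: "renormalized k \<in> measurable seq_space seq_space"
  unfolding renormalized_def del_def
  by (intro seq_measurableI borel_measurable_divide borel_measurable_diff borel_measurable_const seq_measurable_coord)

locale stable_jumps = ranked_poisson M "levy_measure (stable_levy_density \<alpha>)" A
  for M :: "'a measure" and \<alpha> :: real and A :: "nat \<Rightarrow> 'a \<Rightarrow> real" +
  fixes S :: "'a \<Rightarrow> real"
  assumes \<alpha>: "0 < \<alpha>" "\<alpha> < 1"
    and stable: "positive_stable M \<alpha> S"
    and A_sums: "AE \<omega> in M. (\<lambda>k. A k \<omega>) sums S \<omega>"
begin

lemma S_measurable [measurable]: "S \<in> borel_measurable M"
  using stable by (simp add: positive_stable_def)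

lemma S_pos: "AE \<omega> in M. 0 < S \<omega>"
  using stable by (simp add: positive_stable_def)

definition masses :: "'a \<Rightarrow> nat \<Rightarrow> real" where
  "masses \<omega> = (\<lambda>k. A k \<omega> / S \<omega>)"

lemma masses_measurable [measurable]: "masses \<in> measurable M seq_space"
  unfolding masses_def by (intro seq_measurableI) measurable

definition tilted_law :: "real \<Rightarrow> (nat \<Rightarrow> real) measure" where
  "tilted_law lam = distr (density M (\<lambda>\<omega>. ennreal (tilt_const \<alpha> lam * S \<omega> * exp (- lam * S \<omega>)))) seq_space masses"

lemma sets_tilted_law [simp, measurable_cong]: "sets (tilted_law lam) = sets seq_space"
  by (simp add: tilted_law_def)

lemma nn_integral_tilted_law:
  assumes [measurable]: "F \<in> borel_measurable seq_space"
  shows "(\<integral>\<^sup>+ p. F p \<partial>tilted_law lam) =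
    (\<integral>\<^sup>+ \<omega>. ennreal (tilt_const \<alpha> lam * S \<omega> * exp (- lam * S \<omega>)) * F (masses \<omega>) \<partial>M)"
  unfolding tilted_law_def
  by (subst nn_integral_distr, measurable, subst nn_integral_density) auto

lemma tilt_const_pos: "0 < lam \<Longrightarrow> 0 < tilt_const \<alpha> lam"
  using \<alpha> by (simp add: tilt_const_def)

lemma nn_integral_exp_S:
  assumes "0 \<le> \<theta>"
  shows "(\<integral>\<^sup>+ \<omega>. ennreal (exp (- \<theta> * S \<omega>)) \<partial>M) = ennreal (exp (- (\<theta> powr \<alpha>)))"
proof -
  have bd: "AE \<omega> in M. norm (exp (- \<theta> * S \<omega>)) \<le> 1"
    using S_pos by eventually_elim (use assms in \<open>simp add: mult_nonneg_nonneg\<close>)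
  have "integrable M (\<lambda>\<omega>. exp (- \<theta> * S \<omega>))"
    by (rule integrable_const_bound[OF bd]) measurable
  then have "(\<integral>\<^sup>+ \<omega>. ennreal (exp (- \<theta> * S \<omega>)) \<partial>M) = ennreal (\<integral>\<omega>. exp (- \<theta> * S \<omega>) \<partial>M)"
    by (rule nn_integral_eq_integral) simp
  then show ?thesis using stable assms by (simp add: positive_stable_def)
qed

text \<open>Minus the derivative of the Laplace transform.  Differentiation under the integral is replaced by the
convexity of \<open>\<theta> \<mapsto> exp(- \<theta> S)\<close>, which puts the integral between the two one-sided difference quotients.\<close>

lemma nn_integral_S_exp_S:
  assumes u: "0 < u"
  shows "(\<integral>\<^sup>+ \<omega>. ennreal (S \<omega> * exp (- u * S \<omega>)) \<partial>M) = ennreal (\<alpha> * u powr (\<alpha> - 1) * exp (- (u powr \<alpha>)))"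
proof -
  define \<phi> where "\<phi> \<theta> = exp (- (\<theta> powr \<alpha>))" for \<theta> :: real
  define L where "L = (\<integral>\<^sup>+ \<omega>. ennreal (S \<omega> * exp (- u * S \<omega>)) \<partial>M)"
  define D where "D = \<alpha> * u powr (\<alpha> - 1) * exp (- (u powr \<alpha>))"
  have deriv: "(\<phi> has_real_derivative - D) (at u)"
    unfolding \<phi>_def D_def using u by (auto intro!: derivative_eq_intros)
  have quot: "((\<lambda>h. (\<phi> (u + h) - \<phi> u) / h) \<longlongrightarrow> - D) (at 0)"
    using deriv by (simp add: DERIV_def)
  have split: "ennreal h * L + ennreal b \<le> ennreal a \<Longrightarrow> L \<le> ennreal ((a - b) / h)"
    if "0 < h" "0 \<le> b" "0 \<le> a" for h a b
  proof -
    assume le: "ennreal h * L + ennreal b \<le> ennreal a"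
    then have "ennreal h * L < \<infinity>"
      by (metis ennreal_add_eq_top ennreal_less_top infinity_ennreal_def less_top linorder_not_less top.not_eq_extremum)
    then have "L < \<infinity>" using \<open>0 < h\<close> by (auto simp: ennreal_mult_less_top)
    then obtain l where l: "0 \<le> l" "L = ennreal l" by (cases L) auto
    with le that have "h * l + b \<le> a" by (simp add: ennreal_mult[symmetric] ennreal_plus[symmetric] del: ennreal_plus)
    then have "l \<le> (a - b) / h" using \<open>0 < h\<close> by (simp add: field_simps)
    then show ?thesis using l by (simp add: ennreal_leI)
  qed
  have up: "L \<le> ennreal ((\<phi> (u + - h) - \<phi> u) / h)" if h: "0 < h" "h < u" for h
  proof (rule split)
    have "ennreal h * L + ennreal (\<phi> u) =
        (\<integral>\<^sup>+ \<omega>. ennreal h * ennreal (S \<omega> * exp (- u * S \<omega>)) + ennreal (exp (- u * S \<omega>)) \<partial>M)"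
      unfolding L_def \<phi>_def using u
      by (subst nn_integral_add) (auto simp: nn_integral_cmult nn_integral_exp_S[of u, simplified])
    also have "\<dots> \<le> (\<integral>\<^sup>+ \<omega>. ennreal (exp (- (u + - h) * S \<omega>)) \<partial>M)"
    proof (rule nn_integral_mono_AE, use S_pos in eventually_elim)
      fix \<omega> assume S: "0 < S \<omega>"
      have "1 + h * S \<omega> \<le> exp (h * S \<omega>)" by (rule exp_ge_add_one_self)
      then have "exp (- u * S \<omega>) * (1 + h * S \<omega>) \<le> exp (- u * S \<omega>) * exp (h * S \<omega>)"
        by (intro mult_left_mono) auto
      also have "\<dots> = exp (- (u + - h) * S \<omega>)" by (simp add: exp_add[symmetric] algebra_simps)
      finally show "ennreal h * ennreal (S \<omega> * exp (- u * S \<omega>)) + ennreal (exp (- u * S \<omega>)) \<le> ennreal (exp (- (u + - h) * S \<omega>))"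
        using S h by (simp add: ennreal_mult[symmetric] ennreal_plus[symmetric] algebra_simps del: ennreal_plus)
    qed
    also have "\<dots> = ennreal (\<phi> (u + - h))"
      unfolding \<phi>_def by (rule nn_integral_exp_S) (use h in simp)
    finally show "ennreal h * L + ennreal (\<phi> u) \<le> ennreal (\<phi> (u + - h))" .
  qed (use h in \<open>auto simp: \<phi>_def\<close>)
  have low: "ennreal ((\<phi> u - \<phi> (u + h)) / h) \<le> L" if h: "0 < h" for h
  proof -
    have "ennreal (\<phi> u) = (\<integral>\<^sup>+ \<omega>. ennreal (exp (- u * S \<omega>)) \<partial>M)"
      unfolding \<phi>_def using u by (intro nn_integral_exp_S[symmetric]) simp
    also have "\<dots> \<le> (\<integral>\<^sup>+ \<omega>. ennreal h * ennreal (S \<omega> * exp (- u * S \<omega>)) + ennreal (exp (- (u + h) * S \<omega>)) \<partial>M)"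
    proof (rule nn_integral_mono_AE, use S_pos in eventually_elim)
      fix \<omega> assume S: "0 < S \<omega>"
      have "1 - h * S \<omega> \<le> exp (- (h * S \<omega>))" using exp_ge_add_one_self[of "- (h * S \<omega>)"] by simp
      then have "exp (- u * S \<omega>) * 1 \<le> exp (- u * S \<omega>) * (h * S \<omega> + exp (- (h * S \<omega>)))"
        by (intro mult_left_mono) auto
      also have "\<dots> = h * (S \<omega> * exp (- u * S \<omega>)) + exp (- (u + h) * S \<omega>)"
        by (simp add: exp_add[symmetric] algebra_simps)
      finally show "ennreal (exp (- u * S \<omega>)) \<le> ennreal h * ennreal (S \<omega> * exp (- u * S \<omega>)) + ennreal (exp (- (u + h) * S \<omega>))"
        using S h by (simp add: ennreal_mult[symmetric] ennreal_plus[symmetric] del: ennreal_plus)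
    qed
    also have "\<dots> = ennreal h * L + ennreal (\<phi> (u + h))"
      unfolding L_def \<phi>_def using u h
      by (subst nn_integral_add) (auto simp: nn_integral_cmult nn_integral_exp_S[of "u + h", simplified])
    finally have le: "ennreal (\<phi> u) \<le> ennreal h * L + ennreal (\<phi> (u + h))" .
    show ?thesis
    proof (cases L)
      case (real l)
      with le h have "\<phi> u \<le> h * l + \<phi> (u + h)"
        by (simp add: \<phi>_def ennreal_mult[symmetric] ennreal_plus[symmetric] del: ennreal_plus)
      then have "(\<phi> u - \<phi> (u + h)) / h \<le> l" using h by (simp add: field_simps)
      then show ?thesis using real by (simp add: ennreal_leI)
    qed simp
  qed
  have "L \<le> ennreal D"
  proof (rule tendsto_lowerbound)
    have "((\<lambda>h. (\<phi> (u + h) - \<phi> u) / h) \<longlongrightarrow> - D) (at_left 0)"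
      using quot by (rule filterlim_mono) (auto intro: at_le)
    then have "((\<lambda>h. (\<phi> (u + - h) - \<phi> u) / (- h)) \<longlongrightarrow> - D) (at_right 0)"
      by (simp add: filterlim_at_left_to_right)
    from tendsto_minus[OF this] show "((\<lambda>h. ennreal ((\<phi> (u + - h) - \<phi> u) / h)) \<longlongrightarrow> ennreal D) (at_right 0)"
      by (intro tendsto_ennrealI) simp
    show "\<forall>\<^sub>F h in at_right 0. L \<le> ennreal ((\<phi> (u + - h) - \<phi> u) / h)"
      unfolding eventually_at_right_field using up u by auto
  qed simp
  moreover have "ennreal D \<le> L"
  proof (rule tendsto_upperbound)
    have "((\<lambda>h. (\<phi> (u + h) - \<phi> u) / h) \<longlongrightarrow> - D) (at_right 0)"
      using quot by (rule filterlim_mono) (auto intro: at_le)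
    from tendsto_minus[OF this] show "((\<lambda>h. ennreal ((\<phi> u - \<phi> (u + h)) / h)) \<longlongrightarrow> ennreal D) (at_right 0)"
      by (intro tendsto_ennrealI) (simp add: minus_divide_left)
    show "\<forall>\<^sub>F h in at_right 0. ennreal ((\<phi> u - \<phi> (u + h)) / h) \<le> L"
      unfolding eventually_at_right_field using low by (intro exI[of _ 1]) auto
  qed simp
  ultimately show ?thesis unfolding L_def D_def by (rule antisym)
qed

lemma tilted_law_total:
  assumes lam: "0 < lam"
  shows "(\<integral>\<^sup>+ p. 1 \<partial>tilted_law lam) = 1"
proof -
  have "(\<integral>\<^sup>+ p. 1 \<partial>tilted_law lam) = (\<integral>\<^sup>+ \<omega>. ennreal (tilt_const \<alpha> lam) * ennreal (S \<omega> * exp (- lam * S \<omega>)) \<partial>M)"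
    using tilt_const_pos[OF lam]
    by (subst nn_integral_tilted_law) (auto simp: ennreal_mult'[symmetric] mult.assoc)
  also have "\<dots> = ennreal (tilt_const \<alpha> lam * (\<alpha> * lam powr (\<alpha> - 1) * exp (- (lam powr \<alpha>))))"
    using tilt_const_pos[OF lam] \<alpha> nn_integral_S_exp_S[OF lam]
    by (subst nn_integral_cmult) (auto simp: ennreal_mult)
  also have "tilt_const \<alpha> lam * (\<alpha> * lam powr (\<alpha> - 1) * exp (- (lam powr \<alpha>))) = 1"
    using lam \<alpha> by (simp add: tilt_const_def exp_minus powr_diff field_simps)
  finally show ?thesis by simp
qed

text \<open>The Mecke formula for the tilted jumps: the probability \<open>A\<^sub>k / S\<close> of the pick cancels the factor \<open>S\<close> of the
tilt, and the total is the picked jump plus the sum of the others.\<close>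

lemma size_biased_pick_eq:
  fixes h :: "real \<times> (nat \<Rightarrow> real) \<Rightarrow> ennreal"
  assumes lam: "0 < lam" and h [measurable]: "h \<in> borel_measurable (borel \<Otimes>\<^sub>M seq_space)"
  shows "(\<integral>\<^sup>+ p. (\<Sum>k. ennreal (p k) * h (1 - p k, renormalized k p)) \<partial>tilted_law lam) =
    (\<integral>\<^sup>+ \<omega>. ennreal (tilt_const \<alpha> lam) * (\<integral>\<^sup>+ s. ennreal (s * exp (- lam * (s + S \<omega>))) *
      h (1 - s / (s + S \<omega>), masses \<omega>) \<partial>levy_measure (stable_levy_density \<alpha>)) \<partial>M)"
proof -
  let ?\<nu> = "levy_measure (stable_levy_density \<alpha>)"
  interpret \<nu>: sigma_finite_measure ?\<nu> by (rule sigma_finite_levy_measure) measurable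
  interpret P: pair_sigma_finite ?\<nu> M ..
  let ?A = "\<lambda>\<omega> k. A k \<omega>"
  define H where "H z = ennreal (tilt_const \<alpha> lam) * (ennreal (fst z * exp (- lam * (fst z + suminf (snd z)))) *
      h (1 - fst z / (fst z + suminf (snd z)), \<lambda>j. snd z j / suminf (snd z)))"
    for z :: "real \<times> (nat \<Rightarrow> real)"
  have sum_meas [measurable]: "(suminf :: (nat \<Rightarrow> real) \<Rightarrow> real) \<in> borel_measurable seq_space"
    by (rule borel_measurable_suminf) (rule seq_measurable_coord)
  have [measurable]: "(\<lambda>z. \<lambda>j. snd z j / suminf (snd z)) \<in> measurable (borel \<Otimes>\<^sub>M seq_space) seq_space"
    by (intro seq_measurableI borel_measurable_divide measurable_compose[OF measurable_snd seq_measurable_coord]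
        measurable_compose[OF measurable_snd sum_meas])
  have [measurable]: "H \<in> borel_measurable (borel \<Otimes>\<^sub>M seq_space)"
    unfolding H_def by measurable
  have [measurable]: "(\<lambda>p. \<Sum>k. ennreal (p k) * h (1 - p k, renormalized k p)) \<in> borel_measurable seq_space"
  proof -
    have [measurable]: "(\<lambda>p. p k) \<in> borel_measurable seq_space" for k by (rule seq_measurable_coord)
    show ?thesis by measurable
  qed
  have term_eq: "ennreal (tilt_const \<alpha> lam * S \<omega> * exp (- lam * S \<omega>)) *
      (ennreal (masses \<omega> k) * h (1 - masses \<omega> k, renormalized k (masses \<omega>))) =
      H (A k \<omega>, del k (?A \<omega>))"
    if sums: "(\<lambda>k. A k \<omega>) sums S \<omega>" and S: "0 < S \<omega>" and rk: "ranked (?A \<omega>)" for \<omega> k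
  proof -
    have Ak: "0 < A k \<omega>" using rk by (simp add: ranked_def)
    have T: "suminf (del k (?A \<omega>)) = S \<omega> - A k \<omega>"
      by (rule sums_unique[symmetric], rule sums_del) (use sums rk in \<open>auto simp: ranked_def intro: less_imp_le\<close>)
    have r: "renormalized k (masses \<omega>) = (\<lambda>j. del k (?A \<omega>) j / (S \<omega> - A k \<omega>))"
    proof
      fix j
      have "1 - A k \<omega> / S \<omega> = (S \<omega> - A k \<omega>) / S \<omega>" using S by (simp add: field_simps)
      then show "renormalized k (masses \<omega>) j = del k (?A \<omega>) j / (S \<omega> - A k \<omega>)"
        using S by (simp add: renormalized_def masses_def del_def)
    qed
    have "ennreal (tilt_const \<alpha> lam * S \<omega> * exp (- lam * S \<omega>)) * ennreal (masses \<omega> k) =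
        ennreal (tilt_const \<alpha> lam) * ennreal (A k \<omega> * exp (- lam * S \<omega>))"
      using tilt_const_pos[OF lam] S Ak by (simp add: ennreal_mult[symmetric] masses_def)
    then show ?thesis
      unfolding H_def fst_conv snd_conv T r using S by (simp add: masses_def mult.assoc[symmetric])
  qed
  have "(\<integral>\<^sup>+ p. (\<Sum>k. ennreal (p k) * h (1 - p k, renormalized k p)) \<partial>tilted_law lam) =
      (\<integral>\<^sup>+ \<omega>. (\<Sum>k. H (A k \<omega>, del k (?A \<omega>))) \<partial>M)"
    by (subst nn_integral_tilted_law, measurable, rule nn_integral_cong_AE, use A_sums S_pos A_ranked in eventually_elim)
       (simp only: ennreal_suminf_cmult[symmetric] term_eq)
  also have "\<dots> = (\<integral>\<^sup>+ s. \<integral>\<^sup>+ \<omega>. H (s, ?A \<omega>) \<partial>M \<partial>?\<nu>)"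
    by (rule Mecke) measurable
  also have "\<dots> = (\<integral>\<^sup>+ \<omega>. \<integral>\<^sup>+ s. H (s, ?A \<omega>) \<partial>?\<nu> \<partial>M)"
    by (rule P.Fubini'[symmetric]) measurable
  also have "\<dots> = (\<integral>\<^sup>+ \<omega>. ennreal (tilt_const \<alpha> lam) * (\<integral>\<^sup>+ s. ennreal (s * exp (- lam * (s + S \<omega>))) *
      h (1 - s / (s + S \<omega>), masses \<omega>) \<partial>?\<nu>) \<partial>M)"
  proof (rule nn_integral_cong_AE, use A_sums in eventually_elim)
    fix \<omega> assume "(\<lambda>k. A k \<omega>) sums S \<omega>"
    then have *: "suminf (?A \<omega>) = S \<omega>" by (rule sums_unique[symmetric])
    have [measurable]: "(\<lambda>s. h (1 - s / (s + S \<omega>), masses \<omega>)) \<in> borel_measurable borel"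
      by measurable
    show "(\<integral>\<^sup>+ s. H (s, ?A \<omega>) \<partial>?\<nu>) = ennreal (tilt_const \<alpha> lam) *
        (\<integral>\<^sup>+ s. ennreal (s * exp (- lam * (s + S \<omega>))) * h (1 - s / (s + S \<omega>), masses \<omega>) \<partial>?\<nu>)"
      unfolding H_def fst_conv snd_conv * by (subst nn_integral_cmult) (auto simp: masses_def)
  qed
  finally show ?thesis .
qed

text \<open>One size-biased pick: the remainder is again a tilted partition, with a larger tilt, and depends on
the surviving fraction only through the new tilt.\<close>

theorem size_biased_pick_recursion:
  fixes h :: "real \<times> (nat \<Rightarrow> real) \<Rightarrow> ennreal"
  assumes lam: "0 < lam" and h [measurable]: "h \<in> borel_measurable (borel \<Otimes>\<^sub>M seq_space)"
  shows "(\<integral>\<^sup>+ p. (\<Sum>k. ennreal (p k) * h (1 - p k, renormalized k p)) \<partial>tilted_law lam) =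
    (\<integral>\<^sup>+ x. ennreal (exponential_density 1 x) * (\<integral>\<^sup>+ b. ennreal (beta_density (1 - \<alpha>) \<alpha> b) *
      (\<integral>\<^sup>+ p. h (stick_factor b (lam / arrival_tilt \<alpha> lam x), p) \<partial>tilted_law (arrival_tilt \<alpha> lam x)) \<partial>lborel) \<partial>lborel)"
proof -
  interpret P: pair_sigma_finite lborel M ..
  define d where "d u = indicator {lam<..} u * ennreal (\<alpha> * u powr (\<alpha> - 1) * exp (lam powr \<alpha> - u powr \<alpha>))" for u
  define v where "v u \<omega> = ennreal (u powr (1 - \<alpha>) / \<alpha> * exp (u powr \<alpha>) * S \<omega> * exp (- u * S \<omega>))" for u \<omega>
  define B where "B b = ennreal (beta_density (1 - \<alpha>) \<alpha> b)" for b
  let ?w = "\<lambda>u \<omega> b. B b * (v u \<omega> * h (stick_factor b (lam / u), masses \<omega>))"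
  let ?k = "\<lambda>u \<omega>. indicator {lam<..} u * ennreal (S \<omega> * exp (- u * S \<omega>) * (\<alpha> * lam powr (\<alpha> - 1)))"
  let ?l = "\<lambda>\<omega>. \<integral>\<^sup>+ s. ennreal (s * exp (- lam * (s + S \<omega>))) *
      h (1 - s / (s + S \<omega>), masses \<omega>) \<partial>levy_measure (stable_levy_density \<alpha>)"
  define g where "g u = (\<integral>\<^sup>+ b. B b * (\<integral>\<^sup>+ \<omega>. v u \<omega> * h (stick_factor b (lam / u), masses \<omega>) \<partial>M) \<partial>lborel)" for u
  have [measurable]: "d \<in> borel_measurable borel" "B \<in> borel_measurable borel"
    "(\<lambda>z. v (fst z) (snd z)) \<in> borel_measurable (borel \<Otimes>\<^sub>M M)"
    unfolding d_def B_def v_def by measurable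
  have g_meas [measurable]: "g \<in> borel_measurable borel"
    unfolding g_def v_def by measurable
  \<comment> \<open>The tilt by \<open>lam\<close>, times the weight of \<open>u\<close>, is the density of the new tilt times the tilt by
    \<open>u\<close>.\<close>
  have weight: "ennreal (tilt_const \<alpha> lam) * ?k u \<omega> =
      d u * v u \<omega>" if S: "0 < S \<omega>" for u \<omega>
  proof (cases "lam < u")
    case True
    then have u: "0 < u" using lam by simp
    have "tilt_const \<alpha> lam * (\<alpha> * lam powr (\<alpha> - 1)) = exp (lam powr \<alpha>)"
      using lam \<alpha> by (simp add: tilt_const_def powr_diff field_simps)
    moreover have "\<alpha> * u powr (\<alpha> - 1) * exp (lam powr \<alpha> - u powr \<alpha>) * (u powr (1 - \<alpha>) / \<alpha> * exp (u powr \<alpha>)) = exp (lam powr \<alpha>)"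
      using u \<alpha> by (simp add: powr_diff exp_diff field_simps)
    ultimately have "tilt_const \<alpha> lam * (\<alpha> * lam powr (\<alpha> - 1)) * (S \<omega> * exp (- u * S \<omega>)) =
        \<alpha> * u powr (\<alpha> - 1) * exp (lam powr \<alpha> - u powr \<alpha>) * (u powr (1 - \<alpha>) / \<alpha> * exp (u powr \<alpha>)) * (S \<omega> * exp (- u * S \<omega>))"
      by simp
    then have "tilt_const \<alpha> lam * (S \<omega> * exp (- u * S \<omega>) * (\<alpha> * lam powr (\<alpha> - 1))) =
        (\<alpha> * u powr (\<alpha> - 1) * exp (lam powr \<alpha> - u powr \<alpha>)) * (u powr (1 - \<alpha>) / \<alpha> * exp (u powr \<alpha>) * S \<omega> * exp (- u * S \<omega>))"
      by (simp only: mult_ac)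
    then show ?thesis
      using True \<alpha> S tilt_const_pos[OF lam] unfolding d_def v_def
      by (simp add: ennreal_mult[symmetric] del: mult_minus_left)
  next
    case False
    then show ?thesis by (simp add: d_def)
  qed
  have "(\<integral>\<^sup>+ p. (\<Sum>k. ennreal (p k) * h (1 - p k, renormalized k p)) \<partial>tilted_law lam) =
      (\<integral>\<^sup>+ \<omega>. \<integral>\<^sup>+ u. d u * (\<integral>\<^sup>+ b. ?w u \<omega> b \<partial>lborel) \<partial>lborel \<partial>M)"
    unfolding size_biased_pick_eq[OF lam h]
  proof (rule nn_integral_cong_AE, use S_pos in eventually_elim)
    fix \<omega> assume S: "0 < S \<omega>"
    let ?q = "\<lambda>u. \<integral>\<^sup>+ b. B b * h (stick_factor b (lam / u), masses \<omega>) \<partial>lborel"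
    have "ennreal (tilt_const \<alpha> lam) * ?l \<omega> =
      ennreal (tilt_const \<alpha> lam) * (\<integral>\<^sup>+ u. ?k u \<omega> * ?q u \<partial>lborel)"
      using tilted_pick_mixture[OF \<alpha> S lam, of "\<lambda>x. h (1 - x, masses \<omega>)"] by (simp add: B_def)
    also have "\<dots> = (\<integral>\<^sup>+ u. ennreal (tilt_const \<alpha> lam) * (?k u \<omega> * ?q u) \<partial>lborel)"
      by (rule nn_integral_cmult[symmetric]) measurable
    also have "\<dots> = (\<integral>\<^sup>+ u. d u * (\<integral>\<^sup>+ b. ?w u \<omega> b \<partial>lborel) \<partial>lborel)"
    proof (intro nn_integral_cong)
      fix u
      have "(\<integral>\<^sup>+ b. ?w u \<omega> b \<partial>lborel) =
          (\<integral>\<^sup>+ b. v u \<omega> * (B b * h (stick_factor b (lam / u), masses \<omega>)) \<partial>lborel)"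
        by (simp add: mult.left_commute)
      also have "\<dots> = v u \<omega> * ?q u" by (rule nn_integral_cmult) measurable
      finally show "ennreal (tilt_const \<alpha> lam) * (?k u \<omega> * ?q u) =
          d u * (\<integral>\<^sup>+ b. ?w u \<omega> b \<partial>lborel)"
        using weight[OF S, of u] by (simp only: mult.assoc[symmetric])
    qed
    finally show "ennreal (tilt_const \<alpha> lam) * ?l \<omega> = \<dots>" .
  qed
  also have "\<dots> = (\<integral>\<^sup>+ u. \<integral>\<^sup>+ \<omega>. d u * (\<integral>\<^sup>+ b. ?w u \<omega> b \<partial>lborel) \<partial>M \<partial>lborel)"
    by (rule P.Fubini') (simp add: case_prod_beta' v_def)
  also have "\<dots> = (\<integral>\<^sup>+ u. d u * g u \<partial>lborel)"
  proof (intro nn_integral_cong)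
    fix u
    have [measurable]: "(\<lambda>\<omega>. v u \<omega>) \<in> borel_measurable M" unfolding v_def by measurable
    have "(\<integral>\<^sup>+ \<omega>. d u * (\<integral>\<^sup>+ b. ?w u \<omega> b \<partial>lborel) \<partial>M) =
        d u * (\<integral>\<^sup>+ \<omega>. (\<integral>\<^sup>+ b. ?w u \<omega> b \<partial>lborel) \<partial>M)"
      by (rule nn_integral_cmult) measurable
    also have "(\<integral>\<^sup>+ \<omega>. (\<integral>\<^sup>+ b. ?w u \<omega> b \<partial>lborel) \<partial>M) =
        (\<integral>\<^sup>+ b. (\<integral>\<^sup>+ \<omega>. ?w u \<omega> b \<partial>M) \<partial>lborel)"
      by (rule P.Fubini') measurable
    also have "\<dots> = g u"
      unfolding g_def by (intro nn_integral_cong nn_integral_cmult) measurable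
    finally show "(\<integral>\<^sup>+ \<omega>. d u * (\<integral>\<^sup>+ b. ?w u \<omega> b \<partial>lborel) \<partial>M) = d u * g u" .
  qed
  also have "\<dots> = (\<integral>\<^sup>+ x. ennreal (exponential_density 1 x) * g (arrival_tilt \<alpha> lam x) \<partial>lborel)"
    unfolding d_def
    by (rule exponential_stable_substitution[OF \<alpha>(1) lam g_meas, symmetric])
  also have "\<dots> = (\<integral>\<^sup>+ x. ennreal (exponential_density 1 x) * (\<integral>\<^sup>+ b. ennreal (beta_density (1 - \<alpha>) \<alpha> b) *
      (\<integral>\<^sup>+ p. h (stick_factor b (lam / arrival_tilt \<alpha> lam x), p) \<partial>tilted_law (arrival_tilt \<alpha> lam x)) \<partial>lborel) \<partial>lborel)"
    unfolding g_def by (subst nn_integral_tilted_law) (simp_all add: B_def v_def tilt_const_def)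
  finally show ?thesis .
qed

end

section \<open>Iterated deletion and the stick-breaking factors\<close>

text \<open>The probability that the surviving fractions in the first \<open>n\<close> size-biased picks from \<open>p\<close> lie in
\<open>B 0, \<dots>, B (n - 1)\<close>, by recursion on the first pick.\<close>

primrec picks_in :: "nat \<Rightarrow> (nat \<Rightarrow> real set) \<Rightarrow> (nat \<Rightarrow> real) \<Rightarrow> ennreal" where
  "picks_in 0 B p = 1"
| "picks_in (Suc n) B p =
    (\<Sum>k. ennreal (p k) * (indicator (B 0) (1 - p k) * picks_in n (\<lambda>i. B (Suc i)) (renormalized k p)))"

text \<open>The law of a stick-breaking factor for a given value \<open>r\<close> of the ratio.\<close>

definition stick_kernel :: "real \<Rightarrow> real \<Rightarrow> real set \<Rightarrow> ennreal" where
  "stick_kernel \<alpha> r B = (\<integral>\<^sup>+ b. ennreal (beta_density (1 - \<alpha>) \<alpha> b) * indicator B (stick_factor b r) \<partial>lborel)"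

text \<open>The probability that the first \<open>n\<close> factors lie in \<open>B 0, \<dots>, B (n - 1)\<close>, by recursion on the first
exponential waiting time: after it the factors start afresh from the new tilt.\<close>

primrec factors_in :: "real \<Rightarrow> nat \<Rightarrow> (nat \<Rightarrow> real set) \<Rightarrow> real \<Rightarrow> ennreal" where
  "factors_in \<alpha> 0 B lam = 1"
| "factors_in \<alpha> (Suc n) B lam =
    (\<integral>\<^sup>+ x. ennreal (exponential_density 1 x) * (stick_kernel \<alpha> (lam / arrival_tilt \<alpha> lam x) (B 0) *
      factors_in \<alpha> n (\<lambda>i. B (Suc i)) (arrival_tilt \<alpha> lam x)) \<partial>lborel)"

lemma picks_in_measurable [measurable]:
  "(\<And>i. B i \<in> sets borel) \<Longrightarrow> picks_in n B \<in> borel_measurable seq_space"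
proof (induction n arbitrary: B)
  case 0
  then show ?case by simp
next
  case (Suc n)
  have [measurable]: "picks_in n (\<lambda>i. B (Suc i)) \<in> borel_measurable seq_space" "B 0 \<in> sets borel"
    using Suc by auto
  have [measurable]: "(\<lambda>p. p k) \<in> borel_measurable seq_space" for k by (rule seq_measurable_coord)
  show ?case unfolding picks_in.simps by measurable
qed

lemma stick_kernel_measurable [measurable]:
  assumes [measurable]: "B \<in> sets borel"
  shows "(\<lambda>r. stick_kernel \<alpha> r B) \<in> borel_measurable borel"
  unfolding stick_kernel_def by measurable

lemma factors_in_measurable [measurable]:
  "(\<And>i. B i \<in> sets borel) \<Longrightarrow> factors_in \<alpha> n B \<in> borel_measurable borel"
proof (induction n arbitrary: B)
  case 0
  then show ?case by simp
next
  case (Suc n)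
  have [measurable]: "factors_in \<alpha> n (\<lambda>i. B (Suc i)) \<in> borel_measurable borel" "B 0 \<in> sets borel"
    using Suc by auto
  show ?case unfolding factors_in.simps by measurable
qed

lemma (in stable_jumps) picks_in_tilted_law:
  assumes "0 < lam" "\<And>i. B i \<in> sets borel"
  shows "(\<integral>\<^sup>+ p. picks_in n B p \<partial>tilted_law lam) = factors_in \<alpha> n B lam"
  using assms
proof (induction n arbitrary: B lam)
  case 0
  then show ?case using tilted_law_total by simp
next
  case (Suc n)
  let ?B = "\<lambda>i. B (Suc i)"
  have [measurable]: "picks_in n ?B \<in> borel_measurable seq_space" "B 0 \<in> sets borel"
    using Suc.prems(2) by auto
  let ?h = "\<lambda>z. indicator (B 0) (fst z) * picks_in n ?B (snd z)"
  have "(\<integral>\<^sup>+ p. picks_in (Suc n) B p \<partial>tilted_law lam) =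
      (\<integral>\<^sup>+ p. (\<Sum>k. ennreal (p k) * ?h (1 - p k, renormalized k p)) \<partial>tilted_law lam)"
    by simp
  also have "\<dots> = (\<integral>\<^sup>+ x. ennreal (exponential_density 1 x) * (\<integral>\<^sup>+ b. ennreal (beta_density (1 - \<alpha>) \<alpha> b) *
      (\<integral>\<^sup>+ p. ?h (stick_factor b (lam / arrival_tilt \<alpha> lam x), p) \<partial>tilted_law (arrival_tilt \<alpha> lam x)) \<partial>lborel) \<partial>lborel)"
    by (rule size_biased_pick_recursion[OF Suc.prems(1)]) measurable
  also have "\<dots> = factors_in \<alpha> (Suc n) B lam"
    unfolding factors_in.simps
  proof (intro nn_integral_cong)
    fix x :: real
    show "ennreal (exponential_density 1 x) * (\<integral>\<^sup>+ b. ennreal (beta_density (1 - \<alpha>) \<alpha> b) *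
        (\<integral>\<^sup>+ p. ?h (stick_factor b (lam / arrival_tilt \<alpha> lam x), p) \<partial>tilted_law (arrival_tilt \<alpha> lam x)) \<partial>lborel) =
      ennreal (exponential_density 1 x) * (stick_kernel \<alpha> (lam / arrival_tilt \<alpha> lam x) (B 0) *
        factors_in \<alpha> n ?B (arrival_tilt \<alpha> lam x))"
    proof (cases "0 \<le> x")
      case True
      let ?u = "arrival_tilt \<alpha> lam x"
      have u: "0 < ?u" using True Suc.prems(1) by (simp add: arrival_tilt_pos)
      have "(\<integral>\<^sup>+ p. ?h (stick_factor b (lam / ?u), p) \<partial>tilted_law ?u) =
          indicator (B 0) (stick_factor b (lam / ?u)) * factors_in \<alpha> n ?B ?u" for b
        using Suc.IH[OF u, of ?B] Suc.prems(2) by (simp add: nn_integral_cmult)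
      then have "(\<integral>\<^sup>+ b. ennreal (beta_density (1 - \<alpha>) \<alpha> b) *
          (\<integral>\<^sup>+ p. ?h (stick_factor b (lam / ?u), p) \<partial>tilted_law ?u) \<partial>lborel) =
          (\<integral>\<^sup>+ b. ennreal (beta_density (1 - \<alpha>) \<alpha> b) * indicator (B 0) (stick_factor b (lam / ?u)) *
            factors_in \<alpha> n ?B ?u \<partial>lborel)"
        by (simp add: mult.assoc)
      also have "\<dots> = stick_kernel \<alpha> (lam / ?u) (B 0) * factors_in \<alpha> n ?B ?u"
        unfolding stick_kernel_def by (rule nn_integral_multc) measurable
      finally show ?thesis by simp
    qed (simp add: exponential_density_def)
  qed
  finally show ?case .
qed

text \<open>The ratios as a function of the sequence of waiting times, to work under their product law.\<close>

definition ratio_seq :: "real \<Rightarrow> real \<Rightarrow> (nat \<Rightarrow> real) \<Rightarrow> nat \<Rightarrow> real" where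
  "ratio_seq \<alpha> lam x k =
    (((\<Sum>i<k. x i) + lam powr \<alpha>) / ((\<Sum>i<Suc k. x i) + lam powr \<alpha>)) powr (1 / \<alpha>)"

abbreviation exp_measure :: "real measure" where
  "exp_measure \<equiv> density lborel (\<lambda>x. ennreal (exponential_density 1 x))"

lemma prob_space_exp_measure: "prob_space exp_measure"
  by (rule prob_space_exponential_density) simp

lemma ratio_seq_measurable [measurable]: "(\<lambda>x. ratio_seq \<alpha> lam x k) \<in> borel_measurable seq_space"
proof -
  have [measurable]: "(\<lambda>x. x i) \<in> borel_measurable seq_space" for i by (rule seq_measurable_coord)
  show ?thesis unfolding ratio_seq_def by measurable
qed

text \<open>The waiting times after the first one produce the ratios of the same scheme started from the new tilt.\<close>

lemma ratio_seq_cons: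
  assumes "0 < \<alpha>" "0 < lam" "0 \<le> x"
  shows "ratio_seq \<alpha> lam (case_nat x y) 0 = lam / arrival_tilt \<alpha> lam x"
    and "ratio_seq \<alpha> lam (case_nat x y) (Suc k) = ratio_seq \<alpha> (arrival_tilt \<alpha> lam x) y k"
proof -
  have pos: "0 < lam powr \<alpha> + x" using assms by (simp add: add_pos_nonneg)
  show "ratio_seq \<alpha> lam (case_nat x y) 0 = lam / arrival_tilt \<alpha> lam x"
    using assms pos by (simp add: ratio_seq_def arrival_tilt_def powr_divide powr_powr add.commute)
  have "arrival_tilt \<alpha> lam x powr \<alpha> = lam powr \<alpha> + x"
    using assms pos by (simp add: arrival_tilt_def powr_powr)
  then show "ratio_seq \<alpha> lam (case_nat x y) (Suc k) = ratio_seq \<alpha> (arrival_tilt \<alpha> lam x) y k"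
    by (simp add: ratio_seq_def sum.lessThan_Suc_shift del: sum.lessThan_Suc)
       (simp add: add_ac)
qed

lemma factors_in_exponential:
  assumes \<alpha>: "0 < \<alpha>" and "0 < lam" "\<And>i. B i \<in> sets borel"
  shows "(\<integral>\<^sup>+ x. (\<Prod>k<n. stick_kernel \<alpha> (ratio_seq \<alpha> lam x k) (B k)) \<partial>PiM UNIV (\<lambda>_. exp_measure)) =
    factors_in \<alpha> n B lam"
  using assms(2,3)
proof -
  interpret E: prob_space exp_measure by (rule prob_space_exp_measure)
  interpret E: sequence_space exp_measure ..
  have sets: "sets (PiM UNIV (\<lambda>_::nat. exp_measure)) = sets seq_space"
    by (rule sets_PiM_cong) auto
  note [measurable_cong] = sets
  have cons [measurable]: "(\<lambda>z. case_nat (fst z) (snd z)) \<in> measurable (exp_measure \<Otimes>\<^sub>M PiM UNIV (\<lambda>_::nat. exp_measure)) seq_space"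
  proof (rule seq_measurableI)
    show "(\<lambda>z. case_nat (fst z) (snd z) i) \<in> borel_measurable (exp_measure \<Otimes>\<^sub>M PiM UNIV (\<lambda>_::nat. exp_measure))" for i
    proof (cases i)
      case (Suc j)
      have "(\<lambda>z. (snd z) j) \<in> borel_measurable (exp_measure \<Otimes>\<^sub>M PiM UNIV (\<lambda>_::nat. exp_measure))"
        by (rule measurable_compose[OF measurable_snd]) (subst measurable_cong_sets[OF sets refl], rule seq_measurable_coord)
      then show ?thesis using Suc by simp
    qed (simp, measurable)
  qed
  show ?thesis
    using assms(2,3)
  proof (induction n arbitrary: B lam)
    case 0
    show ?case by (simp add: E.P.emeasure_space_1)
  next
    case (Suc n)
    let ?E = "PiM UNIV (\<lambda>_::nat. exp_measure)"
    let ?B = "\<lambda>i. B (Suc i)"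
    have [measurable]: "B i \<in> sets borel" for i by (rule Suc.prems(2))
    let ?F = "\<lambda>x. \<Prod>k<Suc n. stick_kernel \<alpha> (ratio_seq \<alpha> lam x k) (B k)"
    have F [measurable]: "?F \<in> borel_measurable seq_space" by measurable
    have "(\<integral>\<^sup>+ x. ?F x \<partial>?E) = (\<integral>\<^sup>+ x. ?F x \<partial>distr (exp_measure \<Otimes>\<^sub>M ?E) ?E (\<lambda>(s, \<omega>). case_nat s \<omega>))"
      by (simp only: E.PiM_iter)
    also have "\<dots> = (\<integral>\<^sup>+ z. ?F (case_nat (fst z) (snd z)) \<partial>(exp_measure \<Otimes>\<^sub>M ?E))"
      using cons by (subst nn_integral_distr)
        (auto simp: case_prod_beta' measurable_cong_sets[OF refl sets] measurable_cong_sets[OF sets refl] F simp del: prod.lessThan_Suc)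
    also have "\<dots> = (\<integral>\<^sup>+ s. \<integral>\<^sup>+ \<omega>. ?F (case_nat s \<omega>) \<partial>?E \<partial>exp_measure)"
      by (subst E.P.nn_integral_fst[symmetric]) (auto simp del: prod.lessThan_Suc intro: measurable_compose[OF cons F])
    also have "\<dots> = (\<integral>\<^sup>+ s. stick_kernel \<alpha> (lam / arrival_tilt \<alpha> lam s) (B 0) *
        factors_in \<alpha> n ?B (arrival_tilt \<alpha> lam s) \<partial>exp_measure)"
    proof (rule nn_integral_cong_AE)
      have "AE s in exp_measure. 0 \<le> s"
        by (subst AE_density) (auto simp: exponential_density_def)
      then show "AE s in exp_measure. (\<integral>\<^sup>+ \<omega>. ?F (case_nat s \<omega>) \<partial>?E) =
          stick_kernel \<alpha> (lam / arrival_tilt \<alpha> lam s) (B 0) * factors_in \<alpha> n ?B (arrival_tilt \<alpha> lam s)"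
      proof eventually_elim
        fix s :: real assume s: "0 \<le> s"
        let ?u = "arrival_tilt \<alpha> lam s"
        have u: "0 < ?u" using s Suc.prems(1) by (simp add: arrival_tilt_pos)
        note c = ratio_seq_cons[OF \<alpha> Suc.prems(1) s]
        have "(\<integral>\<^sup>+ \<omega>. ?F (case_nat s \<omega>) \<partial>?E) =
            (\<integral>\<^sup>+ \<omega>. stick_kernel \<alpha> (lam / ?u) (B 0) * (\<Prod>k<n. stick_kernel \<alpha> (ratio_seq \<alpha> ?u \<omega> k) (?B k)) \<partial>?E)"
          by (simp add: prod.lessThan_Suc_shift c del: prod.lessThan_Suc)
        also have "\<dots> = stick_kernel \<alpha> (lam / ?u) (B 0) * (\<integral>\<^sup>+ \<omega>. (\<Prod>k<n. stick_kernel \<alpha> (ratio_seq \<alpha> ?u \<omega> k) (?B k)) \<partial>?E)"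
          by (rule nn_integral_cmult) measurable
        also have "(\<integral>\<^sup>+ \<omega>. (\<Prod>k<n. stick_kernel \<alpha> (ratio_seq \<alpha> ?u \<omega> k) (?B k)) \<partial>?E) = factors_in \<alpha> n ?B ?u"
          by (rule Suc.IH[OF u]) simp
        finally show "(\<integral>\<^sup>+ \<omega>. ?F (case_nat s \<omega>) \<partial>?E) =
          stick_kernel \<alpha> (lam / ?u) (B 0) * factors_in \<alpha> n ?B ?u" .
      qed
    qed
    also have "\<dots> = factors_in \<alpha> (Suc n) B lam"
    proof -
      have "(\<lambda>s. stick_kernel \<alpha> (lam / arrival_tilt \<alpha> lam s) (B 0) *
          factors_in \<alpha> n ?B (arrival_tilt \<alpha> lam s)) \<in> borel_measurable lborel"
        by measurable
      then show ?thesis by (subst nn_integral_density) auto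
    qed
    finally show ?case .
  qed
qed

locale stick_breaking = prob_space N for N :: "'n measure" +
  fixes \<alpha> lam :: real and e \<beta> R W :: "nat \<Rightarrow> 'n \<Rightarrow> real"
  assumes \<alpha>: "0 < \<alpha>" "\<alpha> < 1" and lam: "0 < lam"
    and e: "\<And>i. distributed N lborel (e i) (\<lambda>x. ennreal (exponential_density 1 x))"
      "indep_vars (\<lambda>_. borel) e UNIV"
    and R: "R = R_ratio \<alpha> lam e"
    and \<beta>: "\<And>k. distributed N lborel (\<beta> k) (\<lambda>x. ennreal (beta_density (1 - \<alpha>) \<alpha> x))"
      "indep_vars (\<lambda>_. borel) \<beta> UNIV"
      "indep_var seq_space (\<lambda>\<omega> k. \<beta> k \<omega>) seq_space (\<lambda>\<omega> k. R k \<omega>)"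
    and W: "W = (\<lambda>k \<omega>. stick_factor (\<beta> k \<omega>) (R k \<omega>))"
begin

lemma e_measurable [measurable]: "e i \<in> borel_measurable N"
  using distributed_measurable[OF e(1)[of i]] by simp

lemma \<beta>_measurable [measurable]: "\<beta> i \<in> borel_measurable N"
  using distributed_measurable[OF \<beta>(1)[of i]] by simp

lemma R_eq_ratio_seq: "R k \<omega> = ratio_seq \<alpha> lam (\<lambda>i. e i \<omega>) k"
  by (simp add: R R_ratio_def ratio_seq_def arrival_def)

lemma e_seq_measurable [measurable]: "(\<lambda>\<omega> i. e i \<omega>) \<in> measurable N seq_space"
  by (intro seq_measurableI) simp

lemma R_measurable [measurable]: "R i \<in> borel_measurable N"
  unfolding R_eq_ratio_seq[abs_def] by (rule measurable_compose[OF e_seq_measurable]) measurable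

lemma R_seq_measurable [measurable]: "(\<lambda>\<omega> i. R i \<omega>) \<in> measurable N seq_space"
  by (intro seq_measurableI) simp

lemma W_measurable [measurable]: "W i \<in> borel_measurable N"
  unfolding W by measurable

lemma \<beta>_law: "distr N borel (\<beta> k) = density lborel (\<lambda>x. ennreal (beta_density (1 - \<alpha>) \<alpha> x))"
  using distributed_distr_eq_density[OF \<beta>(1)[of k]] by (simp cong: distr_cong)

lemma e_law: "distr N borel (e k) = exp_measure"
  using distributed_distr_eq_density[OF e(1)[of k]] by (simp cong: distr_cong)

lemma e_seq_law: "distr N seq_space (\<lambda>\<omega> i. e i \<omega>) = PiM UNIV (\<lambda>_. exp_measure)"
  using e(2) by (subst (asm) indep_vars_iff_distr_eq_PiM) (auto simp: e_law restrict_UNIV)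

lemma stick_kernel_eq:
  assumes [measurable]: "B \<in> sets borel"
  shows "stick_kernel \<alpha> r B = emeasure N {\<omega> \<in> space N. stick_factor (\<beta> k \<omega>) r \<in> B}"
proof -
  have "stick_kernel \<alpha> r B = (\<integral>\<^sup>+ b. indicator B (stick_factor b r) \<partial>distr N borel (\<beta> k))"
    unfolding stick_kernel_def \<beta>_law by (subst nn_integral_density) auto
  also have "\<dots> = (\<integral>\<^sup>+ \<omega>. indicator B (stick_factor (\<beta> k \<omega>) r) \<partial>N)"
    by (subst nn_integral_distr) auto
  also have "\<dots> = (\<integral>\<^sup>+ \<omega>. indicator {\<omega> \<in> space N. stick_factor (\<beta> k \<omega>) r \<in> B} \<omega> \<partial>N)"
    by (intro nn_integral_cong) (auto simp: indicator_def)
  also have "\<dots> = emeasure N {\<omega> \<in> space N. stick_factor (\<beta> k \<omega>) r \<in> B}"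
    by (rule nn_integral_indicator) measurable
  finally show ?thesis .
qed

lemma stick_kernel_le_1: "B \<in> sets borel \<Longrightarrow> stick_kernel \<alpha> r B \<le> 1"
  by (subst stick_kernel_eq[of _ _ 0]) (auto simp: emeasure_eq_measure)

lemma factors_given_ratios:
  assumes J: "finite J" and B [measurable]: "\<And>i. B i \<in> sets borel"
  shows "emeasure N {\<omega> \<in> space N. \<forall>i\<in>J. stick_factor (\<beta> i \<omega>) (r i) \<in> B i} =
    (\<Prod>i\<in>J. stick_kernel \<alpha> (r i) (B i))"
proof (cases "J = {}")
  case False
  have S: "(\<lambda>b. stick_factor b (r i)) -` B i \<inter> space borel \<in> sets borel" for i
    by (rule measurable_sets[OF _ B]) measurable
  have "prob (\<Inter>i\<in>J. \<beta> i -` ((\<lambda>b. stick_factor b (r i)) -` B i \<inter> space borel) \<inter> space N) =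
      (\<Prod>i\<in>J. prob (\<beta> i -` ((\<lambda>b. stick_factor b (r i)) -` B i \<inter> space borel) \<inter> space N))"
    by (rule indep_varsD[OF \<beta>(2) False J]) (use S in auto)
  moreover have "(\<Inter>i\<in>J. \<beta> i -` ((\<lambda>b. stick_factor b (r i)) -` B i \<inter> space borel) \<inter> space N) =
      {\<omega> \<in> space N. \<forall>i\<in>J. stick_factor (\<beta> i \<omega>) (r i) \<in> B i}"
    using False by auto
  moreover have "ennreal (prob (\<beta> i -` ((\<lambda>b. stick_factor b (r i)) -` B i \<inter> space borel) \<inter> space N)) =
      stick_kernel \<alpha> (r i) (B i)" for i
    unfolding emeasure_eq_measure[symmetric] stick_kernel_eq[OF B, of _ _ i]
    by (intro arg_cong[where f = "emeasure N"]) auto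
  ultimately show ?thesis
    by (simp add: emeasure_eq_measure prod_ennreal[symmetric])
qed (simp add: emeasure_space_1)

text \<open>The ratios are integrated last: they are independent of the \<open>\<beta>\<^sub>i\<close>, and for fixed ratios the factors are
independent.  All conditional statements are read off from this formula.\<close>

theorem factors_joint:
  assumes J: "finite J" and B [measurable]: "\<And>i. B i \<in> sets borel" and D [measurable]: "D \<in> sets seq_space"
  shows "emeasure N {\<omega> \<in> space N. (\<lambda>i. R i \<omega>) \<in> D \<and> (\<forall>i\<in>J. W i \<omega> \<in> B i)} =
    (\<integral>\<^sup>+ \<omega>. indicator D (\<lambda>i. R i \<omega>) * (\<Prod>i\<in>J. stick_kernel \<alpha> (R i \<omega>) (B i)) \<partial>N)"
proof -
  let ?b = "\<lambda>\<omega> k. \<beta> k \<omega>" and ?R = "\<lambda>\<omega> k. R k \<omega>"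
  define E where "E = {z \<in> space (seq_space \<Otimes>\<^sub>M seq_space). snd z \<in> D \<and> (\<forall>i\<in>J. stick_factor (fst z i) (snd z i) \<in> B i)}"
  have c1 [measurable]: "(\<lambda>z. fst z i) \<in> borel_measurable (seq_space \<Otimes>\<^sub>M seq_space)" for i
    by (rule measurable_compose[OF measurable_fst seq_measurable_coord])
  have c2 [measurable]: "(\<lambda>z. snd z i) \<in> borel_measurable (seq_space \<Otimes>\<^sub>M seq_space)" for i
    by (rule measurable_compose[OF measurable_snd seq_measurable_coord])
  have E [measurable]: "E \<in> sets (seq_space \<Otimes>\<^sub>M seq_space)"
  proof -
    have "Measurable.pred (seq_space \<Otimes>\<^sub>M seq_space) (\<lambda>z. snd z \<in> D)" by measurable
    moreover have "Measurable.pred (seq_space \<Otimes>\<^sub>M seq_space) (\<lambda>z. \<forall>i\<in>J. stick_factor (fst z i) (snd z i) \<in> B i)"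
      by (intro pred_intros_finite(3) J) measurable
    ultimately show ?thesis unfolding E_def by measurable
  qed
  have bm [measurable]: "?b \<in> measurable N seq_space" by (intro seq_measurableI) simp
  interpret b: prob_space "distr N seq_space ?b" by (rule prob_space_distr) measurable
  interpret r: prob_space "distr N seq_space ?R" by (rule prob_space_distr) measurable
  interpret P: pair_sigma_finite "distr N seq_space ?b" "distr N seq_space ?R" ..
  have joint: "distr N seq_space ?b \<Otimes>\<^sub>M distr N seq_space ?R = distr N (seq_space \<Otimes>\<^sub>M seq_space) (\<lambda>\<omega>. (?b \<omega>, ?R \<omega>))"
    using \<beta>(3) by (simp add: indep_var_distribution_eq)
  have "emeasure N {\<omega> \<in> space N. ?R \<omega> \<in> D \<and> (\<forall>i\<in>J. W i \<omega> \<in> B i)} =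
      emeasure (distr N (seq_space \<Otimes>\<^sub>M seq_space) (\<lambda>\<omega>. (?b \<omega>, ?R \<omega>))) E"
  proof -
    have "(\<lambda>\<omega>. (?b \<omega>, ?R \<omega>)) -` E \<inter> space N = {\<omega> \<in> space N. ?R \<omega> \<in> D \<and> (\<forall>i\<in>J. W i \<omega> \<in> B i)}"
      by (auto simp: E_def W space_pair_measure)
    moreover have "emeasure (distr N (seq_space \<Otimes>\<^sub>M seq_space) (\<lambda>\<omega>. (?b \<omega>, ?R \<omega>))) E =
        emeasure N ((\<lambda>\<omega>. (?b \<omega>, ?R \<omega>)) -` E \<inter> space N)"
      by (rule emeasure_distr) measurable
    ultimately show ?thesis by simp
  qed
  also have "\<dots> = (\<integral>\<^sup>+ r. emeasure (distr N seq_space ?b) ((\<lambda>b. (b, r)) -` E) \<partial>distr N seq_space ?R)"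
    unfolding joint[symmetric] by (rule P.emeasure_pair_measure_alt2) measurable
  also have "\<dots> = (\<integral>\<^sup>+ \<omega>. emeasure (distr N seq_space ?b) ((\<lambda>b. (b, ?R \<omega>)) -` E) \<partial>N)"
  proof -
    have "(\<lambda>r. emeasure (distr N seq_space ?b) ((\<lambda>b. (b, r)) -` E)) \<in> borel_measurable seq_space"
      using P.measurable_emeasure_Pair2[of E] E by simp
    then show ?thesis by (intro nn_integral_distr R_seq_measurable) simp
  qed
  also have "\<dots> = (\<integral>\<^sup>+ \<omega>. indicator D (?R \<omega>) * (\<Prod>i\<in>J. stick_kernel \<alpha> (R i \<omega>) (B i)) \<partial>N)"
  proof (intro nn_integral_cong)
    fix \<omega>
    have S: "(\<lambda>b. (b, ?R \<omega>)) -` E \<in> sets seq_space"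
      using sets_Pair2[of E seq_space seq_space "?R \<omega>"] E by simp
    have "emeasure (distr N seq_space ?b) ((\<lambda>b. (b, ?R \<omega>)) -` E) =
        emeasure N (?b -` ((\<lambda>b. (b, ?R \<omega>)) -` E) \<inter> space N)"
      by (rule emeasure_distr[OF bm S])
    also have "?b -` ((\<lambda>b. (b, ?R \<omega>)) -` E) \<inter> space N =
        (if ?R \<omega> \<in> D then {\<omega>' \<in> space N. \<forall>i\<in>J. stick_factor (\<beta> i \<omega>') (R i \<omega>) \<in> B i} else {})"
      by (auto simp: E_def space_pair_measure)
    also have "emeasure N \<dots> = indicator D (?R \<omega>) * (\<Prod>i\<in>J. stick_kernel \<alpha> (R i \<omega>) (B i))"
      using factors_given_ratios[OF J B, of "\<lambda>i. R i \<omega>"] by simp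
    finally show "emeasure (distr N seq_space ?b) ((\<lambda>b. (b, ?R \<omega>)) -` E) = \<dots>" .
  qed
  finally show ?thesis .
qed

lemma factors_law:
  assumes B: "\<And>i. B i \<in> sets borel"
  shows "emeasure N {\<omega> \<in> space N. \<forall>i<n. W i \<omega> \<in> B i} = factors_in \<alpha> n B lam"
proof -
  note [measurable] = B
  have "emeasure N {\<omega> \<in> space N. \<forall>i<n. W i \<omega> \<in> B i} =
      (\<integral>\<^sup>+ \<omega>. (\<Prod>i<n. stick_kernel \<alpha> (R i \<omega>) (B i)) \<partial>N)"
    using factors_joint[OF _ B, of "{..<n}" UNIV] sets.top[of seq_space] by (simp add: Ball_def)
  also have "\<dots> = (\<integral>\<^sup>+ \<omega>. (\<Prod>i<n. stick_kernel \<alpha> (ratio_seq \<alpha> lam (\<lambda>i. e i \<omega>) i) (B i)) \<partial>N)"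
    by (simp add: R_eq_ratio_seq)
  also have "\<dots> = (\<integral>\<^sup>+ x. (\<Prod>i<n. stick_kernel \<alpha> (ratio_seq \<alpha> lam x i) (B i)) \<partial>distr N seq_space (\<lambda>\<omega> i. e i \<omega>))"
    by (rule nn_integral_distr[symmetric]) measurable
  also have "\<dots> = factors_in \<alpha> n B lam"
    unfolding e_seq_law by (rule factors_in_exponential[OF \<alpha>(1) lam B])
  finally show ?thesis .
qed

end

section \<open>Conditional laws and dependence of the factors\<close>

text \<open>A way to refute that an integral with positive integrand vanishes.\<close>

lemma AE_lborel_ex_in_interval:
  fixes a b :: real
  assumes ae: "AE x in lborel. P x" and ab: "a < b"
  shows "\<exists>x\<in>{a<..<b}. P x"
proof (rule ccontr)
  assume "\<not> (\<exists>x\<in>{a<..<b}. P x)"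
  then have "AE x in lborel. x \<notin> {a<..<b}"
    using ae by (auto elim: eventually_mono)
  then have "emeasure lborel {a<..<b} = 0"
    by (subst (asm) AE_iff_null_sets[symmetric]) auto
  then show False using ab by simp
qed

text \<open>A factor is never smaller than its ratio.\<close>

lemma stick_kernel_eq_0:
  assumes r: "0 < r" "r \<le> 1" and c: "c \<le> r"
  shows "stick_kernel \<alpha> r {..<c} = 0"
proof -
  have zero: "ennreal (beta_density (1 - \<alpha>) \<alpha> b) * indicator {..<c} (stick_factor b r) = 0" for b
  proof (cases "0 < b \<and> b < 1")
    case True
    have "b * (1 - r) + r \<le> 1 * (1 - r) + r" using True r by (intro add_right_mono mult_right_mono) auto
    also have "b * (1 - r) + r = r * (b * ((1 - r) / r) + 1)" using r by (simp add: distrib_left)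
    finally have "r * (b * ((1 - r) / r) + 1) \<le> 1" by simp
    moreover have "0 < b * ((1 - r) / r) + 1" using True r by (intro add_nonneg_pos mult_nonneg_nonneg) auto
    ultimately have "r \<le> stick_factor b r" by (simp add: stick_factor_def pos_le_divide_eq)
    then show ?thesis using c by simp
  qed (auto simp: beta_density_def)
  show ?thesis unfolding stick_kernel_def zero by simp
qed

lemma stick_kernel_neq_0:
  assumes \<alpha>: "0 < \<alpha>" "\<alpha> < 1" and r: "0 < r" "r < c" "c \<le> 1"
  shows "stick_kernel \<alpha> r {..<c} \<noteq> 0"
proof
  assume 0: "stick_kernel \<alpha> r {..<c} = 0"
  have "stick_kernel \<alpha> r {..<c} = (\<integral>\<^sup>+ w. ennreal (stick_factor_density \<alpha> r w) * indicator {..<c} w \<partial>lborel)"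
    unfolding stick_kernel_def by (rule beta_stick_factor_substitution) (use \<alpha> r in auto)
  with 0 have "AE w in lborel. ennreal (stick_factor_density \<alpha> r w) * indicator {..<c} w = 0"
    by (simp add: nn_integral_0_iff_AE)
  from AE_lborel_ex_in_interval[OF this r(2)] obtain w
    where w: "r < w" "w < c" "ennreal (stick_factor_density \<alpha> r w) * indicator {..<c} w = 0" by auto
  have "0 < stick_factor_density \<alpha> r w"
    using w(1,2) r \<alpha> Gamma_real_pos[of \<alpha>] Gamma_real_pos[of "1 - \<alpha>"] by (simp add: stick_factor_density_def)
  with w show False by (simp add: ennreal_eq_0_iff)
qed

lemma nn_integral_exponential_tail:
  assumes "0 \<le> K"
  shows "(\<integral>\<^sup>+ x. ennreal (exponential_density 1 x) * indicator {K..} x \<partial>lborel) = ennreal (exp (- K))"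
proof -
  have "(\<integral>\<^sup>+ x. ennreal (exponential_density 1 x) * indicator {K..} x \<partial>lborel) =
      (\<integral>\<^sup>+ x. ennreal (exp (- x)) * indicator {K..} x \<partial>lborel)"
    using assms by (intro nn_integral_cong) (auto simp: exponential_density_def indicator_def)
  also have "\<dots> = ennreal (exp (- K))" by (rule nn_integral_exp_tail)
  finally show ?thesis .
qed

lemma factors_in_1_neq_0:
  assumes \<alpha>: "0 < \<alpha>" "\<alpha> < 1" and u: "0 < u" and c: "0 < c" "c \<le> 1" and B: "B 0 = {..<c}"
  shows "factors_in \<alpha> 1 B u \<noteq> 0"
proof
  assume 0: "factors_in \<alpha> 1 B u = 0"
  let ?f = "\<lambda>x. ennreal (exponential_density 1 x) * stick_kernel \<alpha> (u / arrival_tilt \<alpha> u x) {..<c}"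
  have [measurable]: "?f \<in> borel_measurable borel" by measurable
  have "factors_in \<alpha> 1 B u = (\<integral>\<^sup>+ x. ?f x \<partial>lborel)" by (simp add: B)
  with 0 have "AE x in lborel. ?f x = 0" by (simp add: nn_integral_0_iff_AE)
  define X where "X = max 0 ((u / c) powr \<alpha> - u powr \<alpha>)"
  obtain x where x: "X < x" "?f x = 0"
    using AE_lborel_ex_in_interval[OF \<open>AE x in lborel. ?f x = 0\<close>, of X "X + 1"] by auto
  have x0: "0 < x" using x by (simp add: X_def)
  have "u / c < arrival_tilt \<alpha> u x"
    using x x0 u c \<alpha> by (subst arrival_tilt_gt_iff) (auto simp: X_def)
  then have "u / arrival_tilt \<alpha> u x < c"
    using c u arrival_tilt_pos[of u x \<alpha>] x0 by (simp add: field_simps)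
  then have "stick_kernel \<alpha> (u / arrival_tilt \<alpha> u x) {..<c} \<noteq> 0"
    using u x0 arrival_tilt_pos[of u x \<alpha>] by (intro stick_kernel_neq_0 \<alpha> c(2)) auto
  moreover have "0 < exponential_density 1 x" using x0 by (simp add: exponential_density_def)
  ultimately show False using x(2) by (simp add: ennreal_eq_0_iff)
qed

context stick_breaking
begin

lemma stick_factor_distributed:
  assumes "0 < r" "r < 1"
  shows "distributed N lborel (\<lambda>\<omega>. stick_factor (\<beta> k \<omega>) r) (\<lambda>w. ennreal (stick_factor_density \<alpha> r w))"
  unfolding distributed_def
proof (intro conjI)
  show "distr N lborel (\<lambda>\<omega>. stick_factor (\<beta> k \<omega>) r) = density lborel (\<lambda>w. ennreal (stick_factor_density \<alpha> r w))"
  proof (rule measure_eqI)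
    fix B assume "B \<in> sets (distr N lborel (\<lambda>\<omega>. stick_factor (\<beta> k \<omega>) r))"
    then have B [measurable]: "B \<in> sets borel" by simp
    have "emeasure (distr N lborel (\<lambda>\<omega>. stick_factor (\<beta> k \<omega>) r)) B =
        emeasure N ((\<lambda>\<omega>. stick_factor (\<beta> k \<omega>) r) -` B \<inter> space N)"
      by (rule emeasure_distr) (use B in auto)
    also have "\<dots> = stick_kernel \<alpha> r B"
      unfolding stick_kernel_eq[OF B, of r k] by (intro arg_cong[where f = "emeasure N"]) auto
    also have "\<dots> = (\<integral>\<^sup>+ w. ennreal (stick_factor_density \<alpha> r w) * indicator B w \<partial>lborel)"
      unfolding stick_kernel_def by (rule beta_stick_factor_substitution[OF \<alpha> assms B])
    also have "\<dots> = emeasure (density lborel (\<lambda>w. ennreal (stick_factor_density \<alpha> r w))) B"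
      by (rule emeasure_density[symmetric]) (use B in auto)
    finally show "emeasure (distr N lborel (\<lambda>\<omega>. stick_factor (\<beta> k \<omega>) r)) B = \<dots>" .
  qed simp
qed measurable

lemma factor_regular_conditional_law:
  "regular_conditional_law N borel (W k) (PiM {..k} (\<lambda>_. borel)) (\<lambda>\<omega>. \<lambda>j\<in>{..k}. R j \<omega>)
    (\<lambda>r. distr N borel (\<lambda>\<omega>. stick_factor (\<beta> k \<omega>) (r k)))"
  unfolding regular_conditional_law_def
proof (intro conjI ballI)
  let ?L = "PiM {..k} (\<lambda>_. borel) :: (nat \<Rightarrow> real) measure"
  let ?T = "\<lambda>\<omega>. \<lambda>j\<in>{..k}. R j \<omega>"
  let ?K = "\<lambda>r :: nat \<Rightarrow> real. distr N borel (\<lambda>\<omega>. stick_factor (\<beta> k \<omega>) (r k))"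
  show "W k \<in> borel_measurable N" by simp
  show T [measurable]: "?T \<in> measurable N ?L" by measurable
  have K: "emeasure (?K r) B = stick_kernel \<alpha> (r k) B" if [measurable]: "B \<in> sets borel" for r B
    unfolding stick_kernel_eq[OF that, of _ k]
    by (subst emeasure_distr) (auto intro!: arg_cong[where f = "emeasure N"])
  show "?K \<in> measurable ?L (prob_algebra borel)"
  proof (rule measurable_prob_algebraI)
    show prob: "prob_space (?K r)" for r by (rule prob_space_distr) measurable
    show "?K \<in> measurable ?L (subprob_algebra borel)"
    proof (rule measurable_subprob_algebra)
      show "subprob_space (?K r)" for r using prob by (rule prob_space_imp_subprob_space)
      show "(\<lambda>r. emeasure (?K r) B) \<in> borel_measurable ?L" if "B \<in> sets borel" for B
        unfolding K[OF that] by (rule measurable_compose[OF _ stick_kernel_measurable[OF that]]) measurable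
    qed simp
  qed
  fix B :: "real set" and C assume B [measurable]: "B \<in> sets borel" and C [measurable]: "C \<in> sets ?L"
  define D where "D = (\<lambda>r. restrict r {..k}) -` C \<inter> space seq_space"
  have "D \<in> sets seq_space"
    unfolding D_def by (rule measurable_sets[OF measurable_restrict_subset C]) auto
  have D: "(\<lambda>i. R i \<omega>) \<in> D \<longleftrightarrow> ?T \<omega> \<in> C" for \<omega>
    by (simp add: D_def)
  have "{\<omega> \<in> space N. W k \<omega> \<in> B \<and> ?T \<omega> \<in> C} = {\<omega> \<in> space N. (\<lambda>i. R i \<omega>) \<in> D \<and> (\<forall>i\<in>{k}. W i \<omega> \<in> B)}"
    unfolding D by auto
  then have "emeasure N {\<omega> \<in> space N. W k \<omega> \<in> B \<and> ?T \<omega> \<in> C} =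
      (\<integral>\<^sup>+ \<omega>. indicator D (\<lambda>i. R i \<omega>) * (\<Prod>i\<in>{k}. stick_kernel \<alpha> (R i \<omega>) B) \<partial>N)"
    using factors_joint[of "{k}" "\<lambda>_. B" D] \<open>D \<in> sets seq_space\<close> B by simp
  also have "\<dots> = (\<integral>\<^sup>+ \<omega>. emeasure (?K (?T \<omega>)) B * indicator C (?T \<omega>) \<partial>N)"
  proof (intro nn_integral_cong)
    fix \<omega>
    have "emeasure (?K (?T \<omega>)) B = stick_kernel \<alpha> (R k \<omega>) B"
      using K[OF B, of "?T \<omega>"] by simp
    then show "indicator D (\<lambda>i. R i \<omega>) * (\<Prod>i\<in>{k}. stick_kernel \<alpha> (R i \<omega>) B) =
        emeasure (?K (?T \<omega>)) B * indicator C (?T \<omega>)"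
      by (simp only: D indicator_def) (simp add: mult.commute)
  qed
  also have "\<dots> = (\<integral>\<^sup>+ t. emeasure (?K t) B * indicator C t \<partial>distr N ?L ?T)"
  proof (rule nn_integral_distr[symmetric, OF T])
    have "(\<lambda>t. stick_kernel \<alpha> (t k) B) \<in> borel_measurable ?L"
      by (rule measurable_compose[OF _ stick_kernel_measurable[OF B]]) measurable
    then show "(\<lambda>t. emeasure (?K t) B * indicator C t) \<in> borel_measurable (distr N ?L ?T)"
      unfolding K[OF B] by simp
  qed
  finally show "emeasure N {\<omega> \<in> space N. W k \<omega> \<in> B \<and> ?T \<omega> \<in> C} = \<dots>" .
qed

text \<open>Tested against the event that the ratios lie in \<open>D\<close>, the defining integrals of the conditional
expectation are those of \<open>factors_joint\<close>.\<close>

lemma factors_cond_exp: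
  assumes J: "finite J" and B: "\<And>i. B i \<in> sets borel"
  shows "AE \<omega> in N. real_cond_exp N (generated_by N seq_space (\<lambda>\<omega> k. R k \<omega>))
      (indicator {\<omega> \<in> space N. \<forall>i\<in>J. W i \<omega> \<in> B i}) \<omega> = (\<Prod>i\<in>J. enn2real (stick_kernel \<alpha> (R i \<omega>) (B i)))"
proof -
  let ?R = "\<lambda>\<omega> k. R k \<omega>"
  let ?F = "generated_by N seq_space ?R"
  let ?E = "{\<omega> \<in> space N. \<forall>i\<in>J. W i \<omega> \<in> B i}"
  let ?g = "\<lambda>\<omega>. \<Prod>i\<in>J. enn2real (stick_kernel \<alpha> (R i \<omega>) (B i))"
  note [measurable] = B
  have RF: "?R \<in> measurable ?F seq_space"
    by (rule measurable_vimage_algebra1) auto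
  have sub: "subalgebra N ?F"
    using measurable_sets[OF R_seq_measurable] by (auto simp: subalgebra_def sets_vimage_algebra2)
  interpret F: finite_measure_subalgebra N ?F
    by (unfold_locales) (rule sub)
  have E [measurable]: "?E \<in> sets N" using J by measurable
  have g [measurable]: "?g \<in> borel_measurable ?F"
  proof (intro borel_measurable_prod)
    fix i
    have "(\<lambda>r. enn2real (stick_kernel \<alpha> (r i) (B i))) \<in> borel_measurable seq_space"
      by (intro borel_measurable_enn2real measurable_compose[OF seq_measurable_coord stick_kernel_measurable] B)
    from measurable_compose[OF RF this] show "(\<lambda>\<omega>. enn2real (stick_kernel \<alpha> (R i \<omega>) (B i))) \<in> borel_measurable ?F" .
  qed
  then have gN [measurable]: "?g \<in> borel_measurable N" by (rule measurable_from_subalg[OF sub])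
  have sk1: "stick_kernel \<alpha> r (B i) \<noteq> \<top>" "enn2real (stick_kernel \<alpha> r (B i)) \<le> 1" for r i
    using stick_kernel_le_1[OF B, of r i] by (auto simp: top_unique enn2real_leI)
  have g01: "0 \<le> ?g \<omega>" "?g \<omega> \<le> 1" for \<omega>
    using sk1 by (auto intro!: prod_nonneg prod_le_1)
  have gint: "integrable N ?g"
    by (rule integrable_const_bound[of _ 1]) (use g01 in auto)
  show ?thesis
  proof (rule F.real_cond_exp_charact)
    fix A assume "A \<in> sets ?F"
    then obtain D where D [measurable]: "D \<in> sets seq_space" and A: "A = ?R -` D \<inter> space N"
      by (auto simp: sets_vimage_algebra2)
    have [measurable]: "A \<in> sets N" unfolding A by measurable
    have "ennreal (\<integral>x\<in>A. indicator ?E x \<partial>N) = ennreal (measure N (A \<inter> ?E))"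
      unfolding set_lebesgue_integral_def
      by (simp add: indicator_inter_arith[symmetric] mult.commute)
    also have "\<dots> = emeasure N {\<omega> \<in> space N. ?R \<omega> \<in> D \<and> (\<forall>i\<in>J. W i \<omega> \<in> B i)}"
      unfolding emeasure_eq_measure by (intro arg_cong[where f = "\<lambda>A. ennreal (measure N A)"]) (auto simp: A)
    also have "\<dots> = (\<integral>\<^sup>+ \<omega>. indicator D (?R \<omega>) * (\<Prod>i\<in>J. stick_kernel \<alpha> (R i \<omega>) (B i)) \<partial>N)"
      by (rule factors_joint[OF J B D])
    also have "\<dots> = (\<integral>\<^sup>+ \<omega>. ennreal (indicator A \<omega> * ?g \<omega>) \<partial>N)"
    proof (intro nn_integral_cong)
      fix \<omega> assume "\<omega> \<in> space N"
      have "(\<Prod>i\<in>J. stick_kernel \<alpha> (R i \<omega>) (B i)) = ennreal (?g \<omega>)"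
        using sk1(1) by (subst prod_ennreal[symmetric]) (auto simp: less_top)
      then show "indicator D (?R \<omega>) * (\<Prod>i\<in>J. stick_kernel \<alpha> (R i \<omega>) (B i)) = ennreal (indicator A \<omega> * ?g \<omega>)"
        using \<open>\<omega> \<in> space N\<close> by (simp add: A indicator_def)
    qed
    also have "\<dots> = ennreal (\<integral>\<omega>\<in>A. ?g \<omega> \<partial>N)"
      unfolding set_lebesgue_integral_def real_scaleR_def
      by (rule nn_integral_eq_integral)
         (use g01 integrable_mult_indicator[OF \<open>A \<in> sets N\<close> gint] in auto)
    finally show "(\<integral>x\<in>A. indicator ?E x \<partial>N) = (\<integral>\<omega>\<in>A. ?g \<omega> \<partial>N)"
      using g01 by (subst (asm) ennreal_inj) (auto simp: set_lebesgue_integral_def intro!: integral_nonneg_AE)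
  qed (use gint g in \<open>auto simp: less_top[symmetric]\<close>)
qed

lemma factors_cond_indep:
  "cond_indep_vars N (generated_by N seq_space (\<lambda>\<omega> k. R k \<omega>)) (\<lambda>_. borel) W UNIV"
  unfolding cond_indep_vars_def
proof (intro conjI ballI allI impI)
  show "W i \<in> borel_measurable N" for i by simp
  fix J :: "nat set" and B :: "nat \<Rightarrow> real set"
  assume J: "finite J \<and> J \<subseteq> UNIV" and "\<forall>i\<in>J. B i \<in> sets borel"
  define C where "C i = (if i \<in> J then B i else {})" for i
  have C: "C i \<in> sets borel" for i using \<open>\<forall>i\<in>J. B i \<in> sets borel\<close> by (simp add: C_def)
  have CB: "C i = B i" if "i \<in> J" for i using that by (simp add: C_def)
  let ?ce = "real_cond_exp N (generated_by N seq_space (\<lambda>\<omega> k. R k \<omega>))"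
  have "AE \<omega> in N. ?ce (indicator {\<omega> \<in> space N. \<forall>i\<in>J. W i \<omega> \<in> C i}) \<omega> = (\<Prod>i\<in>J. enn2real (stick_kernel \<alpha> (R i \<omega>) (C i)))"
    by (rule factors_cond_exp) (use J C in auto)
  moreover have "AE \<omega> in N. \<forall>i\<in>J. ?ce (indicator {\<omega> \<in> space N. W i \<omega> \<in> C i}) \<omega> = enn2real (stick_kernel \<alpha> (R i \<omega>) (C i))"
  proof (rule AE_finite_allI)
    show "AE \<omega> in N. ?ce (indicator {\<omega> \<in> space N. W i \<omega> \<in> C i}) \<omega> = enn2real (stick_kernel \<alpha> (R i \<omega>) (C i))" for i
      using factors_cond_exp[of "{i}" C] C by simp
  qed (use J in simp)
  ultimately show "AE \<omega> in N. ?ce (indicator {\<omega> \<in> space N. \<forall>i\<in>J. W i \<omega> \<in> B i}) \<omega> =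
      (\<Prod>i\<in>J. ?ce (indicator {\<omega> \<in> space N. W i \<omega> \<in> B i}) \<omega>)"
  proof eventually_elim
    case (elim \<omega>)
    then show ?case by (simp add: CB cong: prod.cong)
  qed
qed

text \<open>From a tilt \<open>u\<close> the next factor can be below 1/2 only if the tilt more than doubles, that is, if the
waiting time exceeds \<open>(2\<^sup>\<alpha> - 1) u\<^sup>\<alpha>\<close>.\<close>

lemma second_factor_tail:
  assumes u: "0 < u"
  shows "factors_in \<alpha> 1 (\<lambda>_. {..<1/2}) u \<le> ennreal (exp (- ((2 powr \<alpha> - 1) * u powr \<alpha>)))"
proof -
  let ?H = "{..<1/2::real}" and ?K = "(2 powr \<alpha> - 1) * u powr \<alpha>"
  have "factors_in \<alpha> 1 (\<lambda>_. ?H) u =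
      (\<integral>\<^sup>+ y. ennreal (exponential_density 1 y) * stick_kernel \<alpha> (u / arrival_tilt \<alpha> u y) ?H \<partial>lborel)"
    by simp
  also have "\<dots> \<le> (\<integral>\<^sup>+ y. ennreal (exponential_density 1 y) * indicator {?K..} y \<partial>lborel)"
  proof (intro nn_integral_mono)
    fix y :: real
    let ?t = "arrival_tilt \<alpha> u y"
    show "ennreal (exponential_density 1 y) * stick_kernel \<alpha> (u / ?t) ?H \<le>
        ennreal (exponential_density 1 y) * indicator {?K..} y"
    proof (cases "0 \<le> y")
      case True
      have t: "0 < ?t" "u \<le> ?t" using True u \<alpha> by (auto intro: arrival_tilt_pos arrival_tilt_ge)
      show ?thesis
      proof (cases "2 * u < ?t")
        case True
        then have "(2 * u) powr \<alpha> - u powr \<alpha> < y"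
          using arrival_tilt_gt_iff[of \<alpha> u y "2 * u"] u \<alpha> \<open>0 \<le> y\<close> by simp
        moreover have "(2 * u) powr \<alpha> - u powr \<alpha> = ?K"
          by (simp add: powr_mult algebra_simps)
        ultimately have "?K \<le> y" by simp
        then show ?thesis
          using stick_kernel_le_1[of ?H] mult_left_mono[of _ 1 "ennreal (exponential_density 1 y)"] by simp
      next
        case False
        then have "stick_kernel \<alpha> (u / ?t) ?H = 0"
          using t u by (intro stick_kernel_eq_0) (auto simp: field_simps)
        then show ?thesis by simp
      qed
    qed (simp add: exponential_density_def)
  qed
  also have "\<dots> = ennreal (exp (- ?K))"
    by (rule nn_integral_exponential_tail) (use \<alpha> in \<open>simp add: ge_one_powr_ge_zero\<close>)
  finally show ?thesis .
qed

text \<open>If the first factor is below \<open>\<epsilon> = \<lambda> / u\<^sub>0\<close>, then the first tilt exceeds \<open>u\<^sub>0\<close>, so that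
\<open>second_factor_tail\<close> applies.  Under independence the probability
\<open>\<delta> > 0\<close> that the second factor is below 1/2 would thus be at most \<open>exp(- (2\<^sup>\<alpha> - 1) u\<^sub>0\<^sup>\<alpha>)\<close> for every large \<open>u\<^sub>0\<close>.\<close>

lemma factors_not_indep: "\<not> indep_vars (\<lambda>_. borel) W UNIV"
proof
  assume indep: "indep_vars (\<lambda>_. borel) W UNIV"
  define H where "H = {..<1/2::real}"
  define \<delta> where "\<delta> = prob {\<omega> \<in> space N. W 1 \<omega> \<in> H}"
  have [measurable]: "H \<in> sets borel" by (simp add: H_def)
  have "\<delta> \<noteq> 0"
  proof
    assume "\<delta> = 0"
    let ?B = "\<lambda>i::nat. if i = 0 then UNIV else H"
    \<comment> \<open>Without restriction on the first factor, the recursion makes \<open>\<delta>\<close> an integral of positive values.\<close>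
    have "emeasure N {\<omega> \<in> space N. \<forall>i<2. W i \<omega> \<in> ?B i} = factors_in \<alpha> (Suc 1) ?B lam"
      using factors_law[of ?B 2] by (simp add: numeral_2_eq_2)
    moreover have "{\<omega> \<in> space N. \<forall>i<2. W i \<omega> \<in> ?B i} = {\<omega> \<in> space N. W 1 \<omega> \<in> H}"
      by (auto simp: less_2_cases_iff)
    ultimately have "factors_in \<alpha> (Suc 1) ?B lam = 0"
      using \<open>\<delta> = 0\<close> by (simp add: \<delta>_def emeasure_eq_measure)
    moreover have "factors_in \<alpha> (Suc 1) ?B lam = (\<integral>\<^sup>+ x. ennreal (exponential_density 1 x) *
        (stick_kernel \<alpha> (lam / arrival_tilt \<alpha> lam x) UNIV * factors_in \<alpha> 1 (\<lambda>_. H) (arrival_tilt \<alpha> lam x)) \<partial>lborel)"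
      by simp
    moreover have "stick_kernel \<alpha> r UNIV = 1" for r
      by (subst stick_kernel_eq[of _ _ 0]) (auto simp: emeasure_space_1)
    ultimately have "(\<integral>\<^sup>+ x. ennreal (exponential_density 1 x) * factors_in \<alpha> 1 (\<lambda>_. H) (arrival_tilt \<alpha> lam x) \<partial>lborel) = 0"
      by simp
    then have "AE x in lborel. ennreal (exponential_density 1 x) * factors_in \<alpha> 1 (\<lambda>_. H) (arrival_tilt \<alpha> lam x) = 0"
      by (subst (asm) nn_integral_0_iff_AE) auto
    from AE_lborel_ex_in_interval[OF this, of 0 1] obtain x where x: "0 < x"
      "ennreal (exponential_density 1 x) * factors_in \<alpha> 1 (\<lambda>_. H) (arrival_tilt \<alpha> lam x) = 0" by auto
    moreover have "factors_in \<alpha> 1 (\<lambda>_. H) (arrival_tilt \<alpha> lam x) \<noteq> 0"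
      by (rule factors_in_1_neq_0[OF \<alpha>, where c = "1/2"]) (use lam x in \<open>auto simp: H_def arrival_tilt_pos\<close>)
    moreover have "0 < exponential_density 1 x" using x by (simp add: exponential_density_def)
    ultimately show False by (simp add: ennreal_eq_0_iff)
  qed
  then have \<delta>: "0 < \<delta>" by (simp add: \<delta>_def zero_less_measure_iff)
  have bound: "\<delta> \<le> exp (- ((2 powr \<alpha> - 1) * u0 powr \<alpha>))" if u0: "lam \<le> u0" for u0
  proof -
    define \<epsilon> where "\<epsilon> = lam / u0"
    have \<epsilon>: "0 < \<epsilon>" "\<epsilon> \<le> 1" using u0 lam by (auto simp: \<epsilon>_def)
    define K where "K = (2 powr \<alpha> - 1) * u0 powr \<alpha>"
    define L where "L = {..<\<epsilon>}"
    have [measurable]: "L \<in> sets borel" by (simp add: L_def)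
    let ?B = "\<lambda>i::nat. if i = 0 then L else H"
    let ?U = "arrival_tilt \<alpha> lam"
    have tail: "factors_in \<alpha> 1 (\<lambda>_. H) u \<le> ennreal (exp (- K))" if u: "u0 < u" for u
    proof -
      have "K \<le> (2 powr \<alpha> - 1) * u powr \<alpha>"
        unfolding K_def using u u0 lam \<alpha> by (intro mult_left_mono powr_mono2) (auto simp: ge_one_powr_ge_zero)
      then have "ennreal (exp (- ((2 powr \<alpha> - 1) * u powr \<alpha>))) \<le> ennreal (exp (- K))"
        by (intro ennreal_leI) simp
      moreover have "0 < u" using u u0 lam by simp
      ultimately show ?thesis
        unfolding H_def using second_factor_tail order_trans by blast
    qed
    have "emeasure N {\<omega> \<in> space N. W 0 \<omega> \<in> L \<and> W 1 \<omega> \<in> H} = factors_in \<alpha> (Suc 1) ?B lam"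
    proof -
      have "{\<omega> \<in> space N. W 0 \<omega> \<in> L \<and> W 1 \<omega> \<in> H} = {\<omega> \<in> space N. \<forall>i<2. W i \<omega> \<in> ?B i}"
        by (auto simp: less_2_cases_iff)
      then show ?thesis using factors_law[of ?B 2] by (simp add: numeral_2_eq_2)
    qed
    also have "\<dots> = (\<integral>\<^sup>+ x. ennreal (exponential_density 1 x) *
        (stick_kernel \<alpha> (lam / ?U x) L * factors_in \<alpha> 1 (\<lambda>_. H) (?U x)) \<partial>lborel)"
      by simp
    also have "\<dots> \<le> (\<integral>\<^sup>+ x. (ennreal (exponential_density 1 x) * stick_kernel \<alpha> (lam / ?U x) L) * ennreal (exp (- K)) \<partial>lborel)"
    proof (intro nn_integral_mono)
      fix x :: real
      show "ennreal (exponential_density 1 x) * (stick_kernel \<alpha> (lam / ?U x) L * factors_in \<alpha> 1 (\<lambda>_. H) (?U x)) \<le>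
          (ennreal (exponential_density 1 x) * stick_kernel \<alpha> (lam / ?U x) L) * ennreal (exp (- K))"
      proof (cases "0 \<le> x")
        case True
        have t: "0 < ?U x" "lam \<le> ?U x" using True lam \<alpha> by (auto intro: arrival_tilt_pos arrival_tilt_ge)
        show ?thesis
        proof (cases "u0 < ?U x")
          case True
          from tail[OF this] show ?thesis by (simp only: mult.assoc) (intro mult_left_mono, auto)
        next
          case False
          then have "stick_kernel \<alpha> (lam / ?U x) L = 0"
            unfolding L_def \<epsilon>_def using t lam u0 by (intro stick_kernel_eq_0) (auto intro: divide_left_mono)
          then show ?thesis by simp
        qed
      qed (simp add: exponential_density_def)
    qed
    also have "\<dots> = (\<integral>\<^sup>+ x. ennreal (exponential_density 1 x) * stick_kernel \<alpha> (lam / ?U x) L \<partial>lborel) * ennreal (exp (- K))"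
      by (rule nn_integral_multc) measurable
    also have "(\<integral>\<^sup>+ x. ennreal (exponential_density 1 x) * stick_kernel \<alpha> (lam / ?U x) L \<partial>lborel) = factors_in \<alpha> 1 (\<lambda>_. L) lam"
      by simp
    also have "\<dots> = emeasure N {\<omega> \<in> space N. W 0 \<omega> \<in> L}"
      using factors_law[of "\<lambda>_. L" 1] by simp
    finally have le: "prob {\<omega> \<in> space N. W 0 \<omega> \<in> L \<and> W 1 \<omega> \<in> H} \<le> prob {\<omega> \<in> space N. W 0 \<omega> \<in> L} * exp (- K)"
      by (simp add: emeasure_eq_measure ennreal_mult'[symmetric])
    have pos: "prob {\<omega> \<in> space N. W 0 \<omega> \<in> L} \<noteq> 0"
    proof
      assume "prob {\<omega> \<in> space N. W 0 \<omega> \<in> L} = 0"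
      then have "factors_in \<alpha> 1 (\<lambda>_. L) lam = 0"
        using factors_law[of "\<lambda>_. L" 1] by (simp add: emeasure_eq_measure)
      moreover have "factors_in \<alpha> 1 (\<lambda>_. L) lam \<noteq> 0"
        by (rule factors_in_1_neq_0[OF \<alpha> lam \<epsilon>]) (simp add: L_def)
      ultimately show False by simp
    qed
    have "prob (\<Inter>i\<in>{0,1}. W i -` ?B i \<inter> space N) = (\<Prod>i\<in>{0,1}. prob (W i -` ?B i \<inter> space N))"
      by (rule indep_varsD[OF indep]) auto
    moreover have "(\<Inter>i\<in>{0,1}. W i -` ?B i \<inter> space N) = {\<omega> \<in> space N. W 0 \<omega> \<in> L \<and> W 1 \<omega> \<in> H}" by auto
    moreover have "W 0 -` L \<inter> space N = {\<omega> \<in> space N. W 0 \<omega> \<in> L}" "W 1 -` H \<inter> space N = {\<omega> \<in> space N. W 1 \<omega> \<in> H}"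
      by auto
    ultimately have "prob {\<omega> \<in> space N. W 0 \<omega> \<in> L \<and> W 1 \<omega> \<in> H} = prob {\<omega> \<in> space N. W 0 \<omega> \<in> L} * \<delta>"
      by (simp add: \<delta>_def)
    with le have "prob {\<omega> \<in> space N. W 0 \<omega> \<in> L} * \<delta> \<le> prob {\<omega> \<in> space N. W 0 \<omega> \<in> L} * exp (- K)" by simp
    then show ?thesis
      using pos measure_nonneg[of N "{\<omega> \<in> space N. W 0 \<omega> \<in> L}"] unfolding K_def
      by (simp add: mult_le_cancel_left_pos less_le)
  qed
  define q where "q = 2 powr \<alpha> - 1"
  have q: "0 < q" using powr_less_mono2[of \<alpha> 1 2] \<alpha> by (simp add: q_def)
  \<comment> \<open>At \<open>u0 = t powr (1 / \<alpha>)\<close> the bound is \<open>exp (- q * t)\<close>, at most \<open>\<delta> * exp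
    (-1)\<close>.\<close>
  define t where "t = max (lam powr \<alpha>) ((1 - ln \<delta>) / q)"
  have t: "0 < t" using lam by (simp add: t_def less_max_iff_disj)
  have "lam = (lam powr \<alpha>) powr (1 / \<alpha>)" using lam \<alpha> by (simp add: powr_powr)
  also have "\<dots> \<le> t powr (1 / \<alpha>)" using \<alpha> by (intro powr_mono2) (auto simp: t_def)
  finally have "\<delta> \<le> exp (- (q * (t powr (1 / \<alpha>)) powr \<alpha>))" unfolding q_def by (rule bound)
  then have "\<delta> \<le> exp (- (q * t))" using t \<alpha> by (simp add: powr_powr)
  then have "ln \<delta> \<le> ln (exp (- (q * t)))" using \<delta> by (subst ln_le_cancel_iff) auto
  then have "ln \<delta> \<le> - (q * t)" by simp
  moreover have "(1 - ln \<delta>) / q \<le> t" by (simp add: t_def)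
  then have "1 - ln \<delta> \<le> q * t" using q by (simp add: pos_divide_le_eq mult.commute)
  ultimately show False by linarith
qed

end

section \<open>The law of a size-biased sample\<close>

text \<open>Extends an identity of weights, conditional on \<open>T\<close>, from events of \<open>T\<close> to functions of \<open>T\<close>.\<close>

lemma nn_integral_through_eqI:
  fixes u v :: "'a \<Rightarrow> ennreal"
  assumes T [measurable]: "T \<in> measurable M L" and [measurable]: "u \<in> borel_measurable M" "v \<in> borel_measurable M"
    and eq: "\<And>C. C \<in> sets L \<Longrightarrow> (\<integral>\<^sup>+ \<omega>. indicator C (T \<omega>) * u \<omega> \<partial>M) = (\<integral>\<^sup>+ \<omega>. indicator C (T \<omega>) * v \<omega> \<partial>M)"
    and g [measurable]: "g \<in> borel_measurable L"
  shows "(\<integral>\<^sup>+ \<omega>. g (T \<omega>) * u \<omega> \<partial>M) = (\<integral>\<^sup>+ \<omega>. g (T \<omega>) * v \<omega> \<partial>M)"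
proof -
  have int: "integral\<^sup>N (distr (density M w) L T) h = (\<integral>\<^sup>+ \<omega>. h (T \<omega>) * w \<omega> \<partial>M)"
    if [measurable]: "w \<in> borel_measurable M" "h \<in> borel_measurable L" for w h
    by (subst nn_integral_distr, measurable, subst nn_integral_density) (auto simp: mult.commute)
  have "distr (density M u) L T = distr (density M v) L T"
  proof (rule measure_eqI)
    fix C assume "C \<in> sets (distr (density M u) L T)"
    then have C [measurable]: "C \<in> sets L" by simp
    have "emeasure (distr (density M w) L T) C = (\<integral>\<^sup>+ \<omega>. indicator C (T \<omega>) * w \<omega> \<partial>M)"
      if [measurable]: "w \<in> borel_measurable M" for w
      using int[of w "indicator C"] by simp
    then show "emeasure (distr (density M u) L T) C = emeasure (distr (density M v) L T) C"
      using eq[OF C] by simp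
  qed simp
  then show ?thesis using int[of u g] int[of v g] by simp
qed

text \<open>The density of \<open>S\<close> turns the integral over \<open>t\<close> into an expectation over \<open>S\<close>, and the conditional law given
\<open>S\<close> is integrated out.\<close>

lemma (in stable_jumps) P1_law_eq_tilted_law:
  assumes lam: "0 < lam" and f: "\<And>t. 0 \<le> f t" "distributed M lborel S (\<lambda>t. ennreal (f t))"
    and K: "regular_conditional_law M seq_space (\<lambda>\<omega> k. A k \<omega> / S \<omega>) borel S K"
  shows "P1_law \<alpha> lam f K = tilted_law lam"
proof -
  let ?c = "tilt_const \<alpha> lam"
  define D where "D = density lborel (\<lambda>t. indicator {0<..} t * ennreal (t * exp (- lam * t) * f t))"
  have P1: "P1_law \<alpha> lam f K = scale_measure (ennreal ?c) (bind D K)"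
    by (simp only: P1_law_def tilt_const_def D_def)
  define g where "g t = indicator {0<..} t * ennreal (t * exp (- lam * t))" for t :: real
  have [measurable]: "g \<in> borel_measurable borel" unfolding g_def by measurable
  have fm [measurable]: "(\<lambda>t. ennreal (f t)) \<in> borel_measurable borel"
    using distributed_borel_measurable[OF f(2)] by simp
  have dens: "(\<lambda>t. indicator {0<..} t * ennreal (t * exp (- lam * t) * f t)) = (\<lambda>t. ennreal (f t) * g t)"
  proof
    fix t
    show "indicator {0<..} t * ennreal (t * exp (- lam * t) * f t) = ennreal (f t) * g t"
    proof (cases "0 < t")
      case True
      then have "ennreal (t * exp (- lam * t) * f t) = ennreal (t * exp (- lam * t)) * ennreal (f t)"
        using f(1) by (intro ennreal_mult) auto
      then show ?thesis by (simp add: g_def mult_ac)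
    qed (simp add: g_def)
  qed
  have Km: "K \<in> measurable borel (prob_algebra seq_space)"
    using K by (simp add: regular_conditional_law_def)
  then have Ksub [measurable]: "K \<in> measurable borel (subprob_algebra seq_space)"
    by (rule measurable_prob_algebraD)
  then have KD: "K \<in> measurable D (subprob_algebra seq_space)" by (simp add: D_def)
  have setsK: "sets (K t) = sets seq_space" for t
    using measurable_space[OF Ksub, of t] by (simp add: space_subprob_algebra)
  have bind_sets: "sets (bind D K) = sets seq_space"
    by (rule sets_bind) (auto simp: setsK D_def)
  have Slaw: "distr M lborel S = density lborel (\<lambda>t. ennreal (f t))"
    by (rule distributed_distr_eq_density[OF f(2)])
  show ?thesis
  proof (rule measure_eqI)
    show "sets (P1_law \<alpha> lam f K) = sets (tilted_law lam)"
      by (simp add: P1 bind_sets)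
    fix B assume "B \<in> sets (P1_law \<alpha> lam f K)"
    then have B [measurable]: "B \<in> sets seq_space" by (simp add: P1 bind_sets)
    have KB [measurable]: "(\<lambda>t. emeasure (K t) B) \<in> borel_measurable borel"
      by (rule measurable_emeasure_kernel[OF Ksub B])
    have "emeasure (P1_law \<alpha> lam f K) B = ennreal ?c * emeasure (bind D K) B"
      by (simp add: P1)
    also have "emeasure (bind D K) B = (\<integral>\<^sup>+ t. emeasure (K t) B \<partial>D)"
      by (rule emeasure_bind[OF _ KD B]) (simp add: D_def)
    also have "\<dots> = (\<integral>\<^sup>+ t. ennreal (f t) * (g t * emeasure (K t) B) \<partial>lborel)"
      unfolding D_def dens by (subst nn_integral_density) (auto simp: mult.assoc)
    also have "\<dots> = (\<integral>\<^sup>+ t. g t * emeasure (K t) B \<partial>distr M lborel S)"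
      unfolding Slaw by (rule nn_integral_density[symmetric]) auto
    also have "\<dots> = (\<integral>\<^sup>+ \<omega>. g (S \<omega>) * emeasure (K (S \<omega>)) B \<partial>M)"
      by (rule nn_integral_distr) auto
    also have "\<dots> = (\<integral>\<^sup>+ \<omega>. g (S \<omega>) * indicator B (masses \<omega>) \<partial>M)"
    proof (rule nn_integral_through_eqI[where L = borel and T = S and g = g])
      fix C :: "real set" assume C [measurable]: "C \<in> sets borel"
      have "(\<integral>\<^sup>+ \<omega>. indicator C (S \<omega>) * emeasure (K (S \<omega>)) B \<partial>M) =
          (\<integral>\<^sup>+ t. emeasure (K t) B * indicator C t \<partial>distr M borel S)"
        by (subst nn_integral_distr) (auto simp: mult.commute)
      also have "\<dots> = emeasure M {\<omega> \<in> space M. (\<lambda>k. A k \<omega> / S \<omega>) \<in> B \<and> S \<omega> \<in> C}"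
        using K B C by (simp add: regular_conditional_law_def)
      also have "\<dots> = (\<integral>\<^sup>+ \<omega>. indicator {\<omega> \<in> space M. masses \<omega> \<in> B \<and> S \<omega> \<in> C} \<omega> \<partial>M)"
        by (simp add: masses_def[symmetric])
      also have "\<dots> = (\<integral>\<^sup>+ \<omega>. indicator C (S \<omega>) * indicator B (masses \<omega>) \<partial>M)"
        by (intro nn_integral_cong) (auto simp: indicator_def)
      finally show "(\<integral>\<^sup>+ \<omega>. indicator C (S \<omega>) * emeasure (K (S \<omega>)) B \<partial>M) = \<dots>" .
    qed measurable
    also have "ennreal ?c * \<dots> = (\<integral>\<^sup>+ \<omega>. ennreal ?c * (g (S \<omega>) * indicator B (masses \<omega>)) \<partial>M)"
      by (rule nn_integral_cmult[symmetric]) measurable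
    also have "\<dots> = (\<integral>\<^sup>+ \<omega>. ennreal (?c * S \<omega> * exp (- lam * S \<omega>)) * indicator B (masses \<omega>) \<partial>M)"
      by (rule nn_integral_cong_AE, use S_pos in eventually_elim)
         (use tilt_const_pos[OF lam] in \<open>simp add: g_def ennreal_mult mult.assoc\<close>)
    also have "\<dots> = (\<integral>\<^sup>+ p. indicator B p \<partial>tilted_law lam)"
      by (rule nn_integral_tilted_law[symmetric]) measurable
    finally show "emeasure (P1_law \<alpha> lam f K) B = emeasure (tilted_law lam) B" by simp
  qed
qed

definition mass_partition :: "(nat \<Rightarrow> real) \<Rightarrow> bool" where
  "mass_partition p \<longleftrightarrow> (\<forall>j. 0 < p j) \<and> p sums 1"

lemma (in stable_jumps) AE_tilted_law_mass_partition: "AE p in tilted_law lam. mass_partition p"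
proof -
  have [measurable]: "(\<lambda>p. p k) \<in> borel_measurable seq_space" for k by (rule seq_measurable_coord)
  have m [measurable]: "Measurable.pred seq_space mass_partition"
    unfolding mass_partition_def sums_def by measurable
  have "AE \<omega> in M. mass_partition (masses \<omega>)"
    using A_ranked S_pos A_sums
  proof eventually_elim
    case (elim \<omega>)
    then show ?case
      using sums_divide[of "\<lambda>k. A k \<omega>" "S \<omega>" "S \<omega>"] by (auto simp: mass_partition_def masses_def ranked_def)
  qed
  then have "AE \<omega> in density M (\<lambda>\<omega>. ennreal (tilt_const \<alpha> lam * S \<omega> * exp (- lam * S \<omega>))). mass_partition (masses \<omega>)"
    by (subst AE_density) auto
  then show ?thesis
    unfolding tilted_law_def using m by (subst AE_distr_iff) (auto simp: pred_def)
qed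

lemma mass_partition_finite_sum_less:
  assumes p: "mass_partition p" and J: "finite J"
  shows "(\<Sum>j\<in>J. p j) < 1"
proof -
  obtain k where k: "k \<notin> J" using J ex_new_if_finite[of J] by auto
  have "sum p (insert k J) \<le> suminf p"
    using p J by (intro sum_le_suminf) (auto simp: mass_partition_def sums_iff intro: less_imp_le)
  moreover have "suminf p = 1" using p by (simp add: mass_partition_def sums_iff)
  moreover have "0 < p k" using p by (simp add: mass_partition_def)
  ultimately show ?thesis using J k by simp
qed

lemma mass_partition_renormalized:
  assumes p: "mass_partition p"
  shows "mass_partition (renormalized k p)"
proof -
  have k: "p k < 1" using mass_partition_finite_sum_less[OF p, of "{k}"] by simp
  have "del k p sums (1 - p k)"
    using p by (intro sums_del) (auto simp: mass_partition_def intro: less_imp_le)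
  from sums_divide[OF this, of "1 - p k"] show ?thesis
    using p k by (auto simp: mass_partition_def renormalized_def del_def)
qed

text \<open>The fraction of the remaining mass that is left after the pick of step \<open>k\<close>, if the indices are picked
in the order of the list.\<close>

definition survival :: "(nat \<Rightarrow> real) \<Rightarrow> nat list \<Rightarrow> nat \<Rightarrow> real" where
  "survival p is k = 1 - p (is ! k) / (1 - (\<Sum>j\<in>set (take k is). p j))"

text \<open>The conditional probability, given the partition, that the first picks are the indices in the list.\<close>

definition pick_weight :: "(nat \<Rightarrow> real) \<Rightarrow> nat list \<Rightarrow> real" where
  "pick_weight p is = (if distinct is then \<Prod>k<length is. 1 - survival p is k else 0)"

lemma pick_weight_snoc:
  "pick_weight p (is @ [i]) =
    pick_weight p is * (if i \<in> set is then 0 else p i / (1 - (\<Sum>j\<in>set is. p j)))"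
proof -
  have "(\<Prod>k<length is. 1 - survival p (is @ [i]) k) = (\<Prod>k<length is. 1 - survival p is k)"
    by (intro prod.cong) (auto simp: survival_def nth_append)
  then show ?thesis by (auto simp: pick_weight_def survival_def nth_append)
qed

lemma pick_weight_nonneg: "mass_partition p \<Longrightarrow> 0 \<le> pick_weight p is"
  unfolding pick_weight_def survival_def
  using mass_partition_finite_sum_less[of p]
  by (auto intro!: prod_nonneg divide_nonneg_nonneg simp: mass_partition_def less_imp_le)

text \<open>After the first pick \<open>i\<close>, the remaining indices are relabelled by \<open>skip i\<close> and the remaining masses are
renormalized; the later surviving fractions are those of the renormalized partition.\<close>

lemma survival_Cons:
  assumes p: "mass_partition p"
  shows "survival p (i # map (skip i) js) 0 = 1 - p i"
    and "k < length js \<Longrightarrow> survival p (i # map (skip i) js) (Suc k) = survival (renormalized i p) js k"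
proof -
  show "survival p (i # map (skip i) js) 0 = 1 - p i" by (simp add: survival_def)
  assume k: "k < length js"
  have pi: "0 < 1 - p i" using mass_partition_finite_sum_less[OF p, of "{i}"] by simp
  have ren: "p (skip i j) = (1 - p i) * renormalized i p j" for j
    using pi by (simp add: renormalized_def del_def)
  have "i \<notin> skip i ` X" for X using range_skip[of i] by auto
  then have "(\<Sum>j\<in>set (take (Suc k) (i # map (skip i) js)). p j) = p i + (\<Sum>j\<in>skip i ` set (take k js). p j)"
    by (simp add: take_map)
  also have "(\<Sum>j\<in>skip i ` set (take k js). p j) = (1 - p i) * (\<Sum>j\<in>set (take k js). renormalized i p j)"
    by (simp add: sum.reindex[OF inj_on_subset[OF inj_skip]] ren sum_distrib_left)
  finally have "1 - (\<Sum>j\<in>set (take (Suc k) (i # map (skip i) js)). p j) =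
      (1 - p i) * (1 - (\<Sum>j\<in>set (take k js). renormalized i p j))"
    by (simp add: algebra_simps)
  then show "survival p (i # map (skip i) js) (Suc k) = survival (renormalized i p) js k"
    using pi k by (simp add: survival_def ren del: take_Suc_Cons)
qed

lemma pick_weight_Cons:
  assumes p: "mass_partition p"
  shows "pick_weight p (i # map (skip i) js) = p i * pick_weight (renormalized i p) js"
proof -
  have "i \<notin> set (map (skip i) js)" using range_skip[of i] by auto
  moreover have "distinct (map (skip i) js) = distinct js"
    by (simp add: distinct_map inj_on_subset[OF inj_skip])
  moreover have "(\<Prod>k<length js. 1 - survival p (i # map (skip i) js) (Suc k)) =
      (\<Prod>k<length js. 1 - survival (renormalized i p) js k)"
    by (intro prod.cong refl) (simp add: survival_Cons(2)[OF p])
  ultimately show ?thesis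
    by (simp add: pick_weight_def prod.lessThan_Suc_shift survival_Cons(1)[OF p] del: prod.lessThan_Suc)
qed

definition pick_term :: "nat \<Rightarrow> (nat \<Rightarrow> real set) \<Rightarrow> (nat \<Rightarrow> real) \<Rightarrow> nat list \<Rightarrow> ennreal" where
  "pick_term n B p is = of_bool (length is = n) * ennreal (pick_weight p is) *
     (\<Prod>k<n. indicator (B k) (survival p is k))"

text \<open>The recursion on the first pick agrees with the sum over all lists of picks: every list without
repetition of its head has a unique form \<open>i # map (skip i) js\<close>.\<close>

lemma picks_in_eq_sum:
  assumes "mass_partition p"
  shows "picks_in n B p = (\<integral>\<^sup>+ is. pick_term n B p is \<partial>count_space UNIV)"
  using assms
proof (induction n arbitrary: B p)
  case 0
  have "(\<integral>\<^sup>+ is. pick_term 0 B p is \<partial>count_space UNIV) = (\<integral>\<^sup>+ is. 1 * indicator {[] :: nat list} is \<partial>count_space UNIV)"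
    by (intro nn_integral_cong) (auto simp: pick_term_def pick_weight_def indicator_def)
  also have "\<dots> = 1" by simp
  finally show ?case by simp
next
  case (Suc n)
  let ?B = "\<lambda>i. B (Suc i)"
  define g where "g = (\<lambda>(i, js). i # map (skip i) js)"
  have "inj g"
    by (auto simp: g_def inj_def inj_map_eq_map[OF inj_skip])
  have zero: "pick_term (Suc n) B p is = 0" if "is \<notin> range g" for "is"
  proof (cases "is")
    case (Cons i js')
    have "i \<in> set js'"
    proof (rule ccontr)
      assume "i \<notin> set js'"
      then have "set js' \<subseteq> range (skip i)" by (auto simp: range_skip)
      then have "js' \<in> lists (range (skip i))" by auto
      then obtain js where "js' = map (skip i) js" by (auto simp: lists_image)
      with Cons that show False by (auto simp: g_def image_iff)
    qed
    then show ?thesis using Cons by (simp add: pick_term_def pick_weight_def)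
  qed (simp add: pick_term_def)
  have "(\<integral>\<^sup>+ is. pick_term (Suc n) B p is \<partial>count_space UNIV) =
      (\<integral>\<^sup>+ is. pick_term (Suc n) B p is \<partial>count_space (range g))"
    by (rule nn_integral_count_space_eq) (use zero in auto)
  also have "\<dots> = (\<integral>\<^sup>+ z. pick_term (Suc n) B p (g z) \<partial>count_space UNIV)"
    by (rule nn_integral_bij_count_space[symmetric]) (rule inj_on_imp_bij_betw[OF \<open>inj g\<close>])
  also have "\<dots> = (\<integral>\<^sup>+ i. \<integral>\<^sup>+ js. pick_term (Suc n) B p (g (i, js)) \<partial>count_space UNIV \<partial>count_space UNIV)"
    by (rule nn_integral_fst_count_space[symmetric])
  also have "\<dots> = (\<integral>\<^sup>+ i. ennreal (p i) * (indicator (B 0) (1 - p i) * picks_in n ?B (renormalized i p)) \<partial>count_space UNIV)"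
  proof (intro nn_integral_cong)
    fix i
    have pi: "0 < p i" using Suc.prems by (simp add: mass_partition_def)
    have t: "pick_term (Suc n) B p (g (i, js)) =
        (ennreal (p i) * indicator (B 0) (1 - p i)) * pick_term n ?B (renormalized i p) js" for js
    proof (cases "length js = n")
      case True
      have "(\<Prod>k<n. indicator (B (Suc k)) (survival p (i # map (skip i) js) (Suc k)) :: ennreal) =
          (\<Prod>k<n. indicator (B (Suc k)) (survival (renormalized i p) js k))"
        by (intro prod.cong refl) (simp add: survival_Cons(2)[OF Suc.prems] True)
      then show ?thesis
        using True pi pick_weight_nonneg[OF mass_partition_renormalized[OF Suc.prems]]
        by (simp add: pick_term_def g_def pick_weight_Cons[OF Suc.prems] survival_Cons(1)[OF Suc.prems]
            prod.lessThan_Suc_shift ennreal_mult mult_ac del: prod.lessThan_Suc)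
    qed (simp add: pick_term_def g_def)
    have "(\<integral>\<^sup>+ js. pick_term (Suc n) B p (g (i, js)) \<partial>count_space UNIV) =
        (ennreal (p i) * indicator (B 0) (1 - p i)) * picks_in n ?B (renormalized i p)"
      unfolding t Suc.IH[OF mass_partition_renormalized[OF Suc.prems]]
      by (rule nn_integral_cmult) simp
    then show "(\<integral>\<^sup>+ js. pick_term (Suc n) B p (g (i, js)) \<partial>count_space UNIV) =
        ennreal (p i) * (indicator (B 0) (1 - p i) * picks_in n ?B (renormalized i p))"
      by (simp add: mult.assoc)
  qed
  also have "\<dots> = picks_in (Suc n) B p"
    by (simp add: nn_integral_count_space_nat)
  finally show ?case by simp
qed

lemma survival_measurable [measurable]: "(\<lambda>p. survival p is k) \<in> borel_measurable seq_space"
proof -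
  have [measurable]: "(\<lambda>p. p k) \<in> borel_measurable seq_space" for k by (rule seq_measurable_coord)
  show ?thesis unfolding survival_def by measurable
qed

lemma pick_weight_measurable [measurable]: "(\<lambda>p. pick_weight p is) \<in> borel_measurable seq_space"
  unfolding pick_weight_def by (cases "distinct is") simp_all

locale size_biased_pick = prob_space Q for Q :: "'q measure" +
  fixes P Pt :: "'q \<Rightarrow> nat \<Rightarrow> real" and I :: "nat \<Rightarrow> 'q \<Rightarrow> nat"
  assumes P_measurable [measurable]: "P \<in> measurable Q seq_space"
    and partition: "AE \<omega> in Q. mass_partition (P \<omega>)"
    and sample: "size_biased_sample Q P I Pt"
begin

lemma I_measurable [measurable]: "I k \<in> measurable Q (count_space UNIV)"
  using sample by (simp add: size_biased_sample_def)

lemma Pt_eq: "\<omega> \<in> space Q \<Longrightarrow> Pt \<omega> k = P \<omega> (I k \<omega>)"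
  using sample by (simp add: size_biased_sample_def)

abbreviation picked :: "nat list \<Rightarrow> 'q \<Rightarrow> bool" where
  "picked is \<omega> \<equiv> (\<forall>k<length is. I k \<omega> = is ! k)"

text \<open>On the event that the earlier picks are those in the list, the conditional probability that defines
size-biased sampling is a function of the partition alone, and as the masses sum to one, the remaining mass is a
finite expression in it.\<close>

lemma next_pick:
  assumes D [measurable]: "D \<in> sets seq_space"
  shows "(\<integral>\<^sup>+ \<omega>. indicator D (P \<omega>) * of_bool (picked (is @ [i]) \<omega>) \<partial>Q) =
    (\<integral>\<^sup>+ \<omega>. indicator D (P \<omega>) * (if i \<in> set is then 0 else ennreal (P \<omega> i / (1 - (\<Sum>j\<in>set is. P \<omega> j)))) *
      of_bool (picked is \<omega>) \<partial>Q)"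
proof -
  let ?n = "length is"
  let ?S = "seq_space \<Otimes>\<^sub>M PiM {..<?n} (\<lambda>_. count_space UNIV :: nat measure)"
  let ?Y = "\<lambda>\<omega>. (P \<omega>, \<lambda>l\<in>{..<?n}. I l \<omega>)"
  let ?F = "generated_by Q ?S ?Y"
  let ?E = "{\<omega> \<in> space Q. I ?n \<omega> = i}"
  define q where "q \<omega> = (if i \<in> set is then 0 else P \<omega> i / (1 - (\<Sum>j\<in>set is. P \<omega> j)))" for \<omega>
  have [measurable]: "(\<lambda>\<omega>. P \<omega> j) \<in> borel_measurable Q" for j
    by (rule measurable_compose[OF P_measurable seq_measurable_coord])
  have [measurable]: "q \<in> borel_measurable Q" unfolding q_def by measurable
  have Y: "?Y \<in> measurable Q ?S" by measurable
  have sub: "subalgebra Q ?F"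
    using measurable_sets[OF Y] measurable_space[OF Y] by (auto simp: subalgebra_def sets_vimage_algebra2 Pi_iff)
  interpret F: finite_measure_subalgebra Q ?F
    by (unfold_locales) (rule sub)
  define A where "A = {\<omega> \<in> space Q. P \<omega> \<in> D \<and> picked is \<omega>}"
  have A_F: "A \<in> sets ?F"
  proof -
    have "PiE {..<?n} (\<lambda>l. {is ! l}) \<in> sets (PiM {..<?n} (\<lambda>_. count_space UNIV :: nat measure))"
      by (intro sets_PiM_I_finite) auto
    then have "D \<times> PiE {..<?n} (\<lambda>l. {is ! l}) \<in> sets ?S" by (intro pair_measureI) auto
    moreover have "A = ?Y -` (D \<times> PiE {..<?n} (\<lambda>l. {is ! l})) \<inter> space Q"
    proof -
      have "(\<lambda>l\<in>{..<?n}. I l \<omega>) \<in> PiE {..<?n} (\<lambda>l. {is ! l}) \<longleftrightarrow> picked is \<omega>" for \<omega>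
        unfolding restrict_PiE_iff by (simp add: Ball_def)
      then show ?thesis unfolding A_def vimage_def mem_Times_iff fst_conv snd_conv by blast
    qed
    ultimately show ?thesis by (simp only: in_vimage_algebra)
  qed
  have A [measurable]: "A \<in> sets Q" using A_F sub by (auto simp: subalgebra_def)
  have E [measurable]: "?E \<in> sets Q" by measurable
  have "AE \<omega> in Q. real_cond_exp Q ?F (indicator ?E) \<omega> =
      (if i \<in> (\<lambda>l. I l \<omega>) ` {..<?n} then 0 else P \<omega> i / (\<Sum>\<^sub>\<infinity>j\<in>- (\<lambda>l. I l \<omega>) ` {..<?n}. P \<omega> j))"
    using sample unfolding size_biased_sample_def by blast
  then have ce: "AE \<omega> in Q. \<omega> \<in> A \<longrightarrow> real_cond_exp Q ?F (indicator ?E) \<omega> = q \<omega>"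
    using partition
  proof eventually_elim
    case (elim \<omega>)
    show ?case
    proof
      assume "\<omega> \<in> A"
      then have "(\<lambda>l. I l \<omega>) ` {..<?n} = (\<lambda>l. is ! l) ` {..<?n}" by (intro image_cong) (auto simp: A_def)
      also have "\<dots> = set is" by (auto simp: set_conv_nth)
      finally have img: "(\<lambda>l. I l \<omega>) ` {..<?n} = set is" .
      have "(P \<omega> has_sum 1) UNIV"
        using elim(2) by (intro sums_nonneg_imp_has_sum) (auto simp: mass_partition_def intro: less_imp_le)
      moreover have "(P \<omega> has_sum (\<Sum>j\<in>set is. P \<omega> j)) (set is)" by (intro has_sum_finite) auto
      ultimately have "(P \<omega> has_sum (1 - (\<Sum>j\<in>set is. P \<omega> j))) (UNIV - set is)"
        by (rule has_sum_Diff) auto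
      then have "(\<Sum>\<^sub>\<infinity>j\<in>- set is. P \<omega> j) = 1 - (\<Sum>j\<in>set is. P \<omega> j)"
        by (simp add: Compl_eq_Diff_UNIV infsumI)
      then show "real_cond_exp Q ?F (indicator ?E) \<omega> = q \<omega>" using elim(1) unfolding img q_def by simp
    qed
  qed
  have q0: "AE \<omega> in Q. 0 \<le> q \<omega>"
    using partition
  proof eventually_elim
    case (elim \<omega>)
    then show ?case
      using mass_partition_finite_sum_less[OF elim, of "set is"] by (auto simp: q_def mass_partition_def less_imp_le)
  qed
  have intE: "integrable Q (indicator ?E :: 'q \<Rightarrow> real)" by (simp add: less_top[symmetric])
  have int_eq: "(\<integral>\<omega>\<in>A. indicator ?E \<omega> \<partial>Q) = (\<integral>\<omega>\<in>A. q \<omega> \<partial>Q)"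
  proof -
    have "(\<integral>\<omega>\<in>A. indicator ?E \<omega> \<partial>Q) = (\<integral>\<omega>\<in>A. real_cond_exp Q ?F (indicator ?E) \<omega> \<partial>Q)"
      by (rule F.real_cond_exp_intA[OF intE A_F])
    also have "\<dots> = (\<integral>\<omega>\<in>A. q \<omega> \<partial>Q)"
      by (rule set_lebesgue_integral_cong_AE) (use ce in auto)
    finally show ?thesis .
  qed
  have int_q: "integrable Q (\<lambda>\<omega>. indicator A \<omega> * q \<omega>)"
  proof -
    have "integrable Q (\<lambda>\<omega>. indicator A \<omega> *\<^sub>R real_cond_exp Q ?F (indicator ?E) \<omega>)"
      by (rule integrable_mult_indicator[OF A F.real_cond_exp_int(1)[OF intE]])
    moreover have "AE \<omega> in Q. indicator A \<omega> *\<^sub>R real_cond_exp Q ?F (indicator ?E) \<omega> = indicator A \<omega> * q \<omega>"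
      using ce by eventually_elim (auto simp: indicator_def)
    ultimately show ?thesis by (subst (asm) integrable_cong_AE) auto
  qed
  have "(\<integral>\<^sup>+ \<omega>. indicator D (P \<omega>) * of_bool (picked (is @ [i]) \<omega>) \<partial>Q) = (\<integral>\<^sup>+ \<omega>. indicator (A \<inter> ?E) \<omega> \<partial>Q)"
  proof (intro nn_integral_cong)
    fix \<omega> assume "\<omega> \<in> space Q"
    have "picked (is @ [i]) \<omega> \<longleftrightarrow> picked is \<omega> \<and> I ?n \<omega> = i"
      by (auto simp: nth_append less_Suc_eq)
    then show "indicator D (P \<omega>) * of_bool (picked (is @ [i]) \<omega>) = (indicator (A \<inter> ?E) \<omega> :: ennreal)"
      using \<open>\<omega> \<in> space Q\<close> by (auto simp: A_def indicator_def)
  qed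
  also have "\<dots> = ennreal (\<integral>\<omega>\<in>A. indicator ?E \<omega> \<partial>Q)"
    by (simp add: set_lebesgue_integral_def indicator_inter_arith[symmetric] emeasure_eq_measure)
  also have "\<dots> = (\<integral>\<^sup>+ \<omega>. ennreal (indicator A \<omega> * q \<omega>) \<partial>Q)"
    unfolding int_eq unfolding set_lebesgue_integral_def real_scaleR_def
    by (rule nn_integral_eq_integral[symmetric, OF int_q]) (use q0 in \<open>auto elim: eventually_mono\<close>)
  also have "\<dots> = (\<integral>\<^sup>+ \<omega>. indicator D (P \<omega>) * (if i \<in> set is then 0 else ennreal (P \<omega> i / (1 - (\<Sum>j\<in>set is. P \<omega> j)))) *
      of_bool (picked is \<omega>) \<partial>Q)"
    by (intro nn_integral_cong) (auto simp: A_def q_def indicator_def)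
  finally show ?thesis .
qed

lemma picked_weight:
  assumes [measurable]: "G \<in> borel_measurable seq_space"
  shows "(\<integral>\<^sup>+ \<omega>. G (P \<omega>) * of_bool (picked is \<omega>) \<partial>Q) = (\<integral>\<^sup>+ \<omega>. G (P \<omega>) * ennreal (pick_weight (P \<omega>) is) \<partial>Q)"
  using assms
proof (induction "is" arbitrary: G rule: rev_induct)
  case Nil
  then show ?case by (simp add: pick_weight_def)
next
  case (snoc i "is")
  let ?q = "\<lambda>p. if i \<in> set is then 0 else ennreal (p i / (1 - (\<Sum>j\<in>set is. p j)))"
  have [measurable]: "(\<lambda>p. p j) \<in> borel_measurable seq_space" for j by (rule seq_measurable_coord)
  have pm [measurable]: "Measurable.pred Q (picked is')" for is' by measurable
  show ?case
  proof (rule nn_integral_through_eqI[OF P_measurable _ _ _ snoc.prems])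
    fix D :: "(nat \<Rightarrow> real) set" assume D [measurable]: "D \<in> sets seq_space"
    have "(\<integral>\<^sup>+ \<omega>. indicator D (P \<omega>) * of_bool (picked (is @ [i]) \<omega>) \<partial>Q) =
        (\<integral>\<^sup>+ \<omega>. (indicator D (P \<omega>) * ?q (P \<omega>)) * of_bool (picked is \<omega>) \<partial>Q)"
      by (rule next_pick[OF D])
    also have "\<dots> = (\<integral>\<^sup>+ \<omega>. (indicator D (P \<omega>) * ?q (P \<omega>)) * ennreal (pick_weight (P \<omega>) is) \<partial>Q)"
      by (rule snoc.IH) measurable
    also have "\<dots> = (\<integral>\<^sup>+ \<omega>. indicator D (P \<omega>) * ennreal (pick_weight (P \<omega>) (is @ [i])) \<partial>Q)"
    proof (rule nn_integral_cong_AE, use partition in eventually_elim)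
      fix \<omega> assume p: "mass_partition (P \<omega>)"
      show "indicator D (P \<omega>) * ?q (P \<omega>) * ennreal (pick_weight (P \<omega>) is) =
          indicator D (P \<omega>) * ennreal (pick_weight (P \<omega>) (is @ [i]))"
        using pick_weight_nonneg[OF p] by (simp add: pick_weight_snoc ennreal_mult' mult_ac)
    qed
    finally show "(\<integral>\<^sup>+ \<omega>. indicator D (P \<omega>) * of_bool (picked (is @ [i]) \<omega>) \<partial>Q) = \<dots>" .
  qed measurable
qed

text \<open>The factors in the stick-breaking form of the sample, which \<open>AE_Pt_eq_survivals\<close> recovers.\<close>

definition survivals :: "'q \<Rightarrow> nat \<Rightarrow> real" where
  "survivals \<omega> k = 1 - Pt \<omega> k / (1 - (\<Sum>l<k. Pt \<omega> l))"

lemma Pt_measurable [measurable]: "(\<lambda>\<omega>. Pt \<omega> k) \<in> borel_measurable Q"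
proof -
  have "(\<lambda>\<omega>. P \<omega> (I k \<omega>)) \<in> borel_measurable Q"
    by (rule measurable_compose_countable'[where I = UNIV and g = "I k"])
       (auto intro: measurable_compose[OF P_measurable seq_measurable_coord])
  then show ?thesis by (subst measurable_cong[OF Pt_eq]) auto
qed

lemma survivals_measurable [measurable]: "(\<lambda>\<omega>. survivals \<omega> k) \<in> borel_measurable Q"
  unfolding survivals_def by measurable

text \<open>Lists with a repetition have weight zero, and there are only countably many lists.\<close>

lemma AE_distinct: "AE \<omega> in Q. \<forall>n. distinct (map (\<lambda>k. I k \<omega>) [0..<n])"
proof -
  have "AE \<omega> in Q. \<not> distinct is \<longrightarrow> \<not> picked is \<omega>" for "is"
  proof (cases "distinct is")
    case False
    have "(\<integral>\<^sup>+ \<omega>. 1 * of_bool (picked is \<omega>) \<partial>Q) = (\<integral>\<^sup>+ \<omega>. 1 * ennreal (pick_weight (P \<omega>) is) \<partial>Q)"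
      by (rule picked_weight) simp
    then have "(\<integral>\<^sup>+ \<omega>. of_bool (picked is \<omega>) \<partial>Q) = 0" using False by (simp add: pick_weight_def)
    then have "AE \<omega> in Q. (of_bool (picked is \<omega>) :: ennreal) = 0"
      by (subst (asm) nn_integral_0_iff_AE) measurable
    then show ?thesis by eventually_elim (simp split: if_splits)
  qed simp
  then have "AE \<omega> in Q. \<forall>is. \<not> distinct is \<longrightarrow> \<not> picked is \<omega>" by (simp add: AE_all_countable)
  then show ?thesis
  proof eventually_elim
    case (elim \<omega>)
    have "picked (map (\<lambda>k. I k \<omega>) [0..<n]) \<omega>" for n by simp
    with elim show ?case by blast
  qed
qed

lemma sum_Pt:
  assumes "\<omega> \<in> space Q" "distinct (map (\<lambda>k. I k \<omega>) [0..<n])"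
  shows "(\<Sum>l<n. Pt \<omega> l) = (\<Sum>j\<in>(\<lambda>l. I l \<omega>) ` {..<n}. P \<omega> j)"
  using assms by (subst sum.reindex) (auto simp: distinct_map Pt_eq atLeast0LessThan)

lemma survivals_eq:
  assumes "\<omega> \<in> space Q" "distinct is" "picked is \<omega>" "k < length is"
  shows "survivals \<omega> k = survival (P \<omega>) is k"
proof -
  have m: "map (\<lambda>l. I l \<omega>) [0..<k] = take k is"
    using assms by (intro nth_equalityI) auto
  have "(\<Sum>l<k. Pt \<omega> l) = (\<Sum>j\<in>(\<lambda>l. I l \<omega>) ` {..<k}. P \<omega> j)"
    by (rule sum_Pt) (use assms in \<open>auto simp: m\<close>)
  also have "(\<lambda>l. I l \<omega>) ` {..<k} = set (take k is)"
    unfolding m[symmetric] by (simp add: atLeast0LessThan)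
  finally show ?thesis using assms by (simp add: survivals_def survival_def Pt_eq)
qed

theorem survivals_law:
  assumes B [measurable]: "\<And>i. B i \<in> sets borel"
  shows "emeasure Q {\<omega> \<in> space Q. \<forall>k<n. survivals \<omega> k \<in> B k} = (\<integral>\<^sup>+ \<omega>. picks_in n B (P \<omega>) \<partial>Q)"
proof -
  let ?G = "\<lambda>is p. of_bool (length is = n) * (\<Prod>k<n. indicator (B k) (survival p is k)) :: ennreal"
  have [measurable]: "?G is \<in> borel_measurable seq_space" for "is"
  proof -
    have "(\<lambda>p. \<Prod>k<n. indicator (B k) (survival p is k) :: ennreal) \<in> borel_measurable seq_space"
      by (rule borel_measurable_prod_ennreal)
         (rule measurable_compose[OF survival_measurable borel_measurable_indicator[OF B]])
    then show ?thesis by (cases "length is = n") simp_all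
  qed
  have pm [measurable]: "Measurable.pred Q (picked is')" for is' by measurable
  have "emeasure Q {\<omega> \<in> space Q. \<forall>k<n. survivals \<omega> k \<in> B k} =
      (\<integral>\<^sup>+ \<omega>. indicator {\<omega> \<in> space Q. \<forall>k<n. survivals \<omega> k \<in> B k} \<omega> \<partial>Q)"
    by (rule nn_integral_indicator[symmetric]) measurable
  also have "\<dots> = (\<integral>\<^sup>+ \<omega>. (\<integral>\<^sup>+ is. ?G is (P \<omega>) * of_bool (picked is \<omega>) \<partial>count_space UNIV) \<partial>Q)"
  proof (rule nn_integral_cong_AE)
    have "AE \<omega> in Q. \<omega> \<in> space Q" by (rule AE_space)
    then show "AE \<omega> in Q. indicator {\<omega> \<in> space Q. \<forall>k<n. survivals \<omega> k \<in> B k} \<omega> =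
        (\<integral>\<^sup>+ is. ?G is (P \<omega>) * of_bool (picked is \<omega>) \<partial>count_space UNIV)"
      using AE_distinct
    proof eventually_elim
      case (elim \<omega>)
      let ?is = "map (\<lambda>k. I k \<omega>) [0..<n]"
      have iff: "picked is \<omega> \<and> length is = n \<longleftrightarrow> is = ?is" for "is"
      proof
        assume "picked is \<omega> \<and> length is = n"
        then show "is = ?is" by (intro nth_equalityI) simp_all
      next
        assume e: "is = ?is"
        show "picked is \<omega> \<and> length is = n" unfolding e by simp
      qed
      have "?G is (P \<omega>) * of_bool (picked is \<omega>) = ?G ?is (P \<omega>) * indicator {?is} is" for "is"
      proof (cases "is = ?is")
        case True
        show ?thesis unfolding True by simp
      next
        case False
        then have "\<not> (picked is \<omega> \<and> length is = n)" using iff by blast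
        then have "of_bool (length is = n) * (of_bool (picked is \<omega>) :: ennreal) = 0" by auto
        then have "?G is (P \<omega>) * of_bool (picked is \<omega>) = 0"
          by (metis (no_types, lifting) mult.assoc mult.commute mult_zero_left)
        then show ?thesis using False by simp
      qed
      then have "(\<integral>\<^sup>+ is. ?G is (P \<omega>) * of_bool (picked is \<omega>) \<partial>count_space UNIV) = ?G ?is (P \<omega>)"
        by simp
      also have "\<dots> = (\<Prod>k<n. indicator (B k) (survivals \<omega> k))"
        using elim by (auto intro!: prod.cong simp: survivals_eq[of \<omega> ?is])
      also have "\<dots> = indicator {\<omega> \<in> space Q. \<forall>k<n. survivals \<omega> k \<in> B k} \<omega>"
        using elim by (auto simp: indicator_def prod_zero_iff)
      finally show ?case by simp
    qed
  qed
  also have "\<dots> = (\<integral>\<^sup>+ is. (\<integral>\<^sup>+ \<omega>. ?G is (P \<omega>) * of_bool (picked is \<omega>) \<partial>Q) \<partial>count_space UNIV)"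
    by (rule nn_integral_count_space_nn_integral) auto
  also have "\<dots> = (\<integral>\<^sup>+ is. (\<integral>\<^sup>+ \<omega>. ?G is (P \<omega>) * ennreal (pick_weight (P \<omega>) is) \<partial>Q) \<partial>count_space UNIV)"
    by (intro nn_integral_cong picked_weight) measurable
  also have "\<dots> = (\<integral>\<^sup>+ \<omega>. (\<integral>\<^sup>+ is. ?G is (P \<omega>) * ennreal (pick_weight (P \<omega>) is) \<partial>count_space UNIV) \<partial>Q)"
    by (rule nn_integral_count_space_nn_integral[symmetric]) auto
  also have "\<dots> = (\<integral>\<^sup>+ \<omega>. picks_in n B (P \<omega>) \<partial>Q)"
    by (rule nn_integral_cong_AE, use partition in eventually_elim)
       (simp add: picks_in_eq_sum pick_term_def mult_ac)
  finally show ?thesis .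
qed

lemma AE_Pt_eq_survivals: "AE \<omega> in Q. \<forall>k. Pt \<omega> k = (1 - survivals \<omega> k) * (\<Prod>l<k. survivals \<omega> l)"
  using AE_space partition AE_distinct
proof eventually_elim
  case (elim \<omega>)
  have pos: "0 < 1 - (\<Sum>l<n. Pt \<omega> l)" for n
    using sum_Pt[OF elim(1), of n] elim mass_partition_finite_sum_less[OF elim(2), of "(\<lambda>l. I l \<omega>) ` {..<n}"] by auto
  have step: "(1 - (\<Sum>l<n. Pt \<omega> l)) * (1 - survivals \<omega> n) = Pt \<omega> n" for n
    using pos[of n] by (simp add: survivals_def)
  have rest: "1 - (\<Sum>l<n. Pt \<omega> l) = (\<Prod>l<n. survivals \<omega> l)" for n
  proof (induction n)
    case (Suc n)
    have "1 - (\<Sum>l<Suc n. Pt \<omega> l) = (1 - (\<Sum>l<n. Pt \<omega> l)) - Pt \<omega> n" by simp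
    also have "\<dots> = (1 - (\<Sum>l<n. Pt \<omega> l)) * survivals \<omega> n"
      unfolding step[symmetric, of n] by (simp add: algebra_simps)
    finally show ?case using Suc by simp
  qed simp
  show ?case using step rest by (metis mult.commute)
qed

end

section \<open>The stick-breaking representation\<close>

lemma seq_law_eqI:
  fixes X :: "'a \<Rightarrow> nat \<Rightarrow> real" and Y :: "'b \<Rightarrow> nat \<Rightarrow> real"
  assumes M: "prob_space M" and X: "X \<in> measurable M seq_space" and Y: "Y \<in> measurable N seq_space"
    and eq: "\<And>n B. (\<And>i. B i \<in> sets borel) \<Longrightarrow>
      emeasure M {\<omega> \<in> space M. \<forall>k<n. X \<omega> k \<in> B k} = emeasure N {\<omega> \<in> space N. \<forall>k<n. Y \<omega> k \<in> B k}"
  shows "distr M seq_space X = distr N seq_space Y"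
proof (rule measure_eqI_PiM_infinite)
  show "finite_measure (distr M seq_space X)"
    using prob_space.prob_space_distr[OF M X] by (simp add: prob_space_def)
  fix A :: "nat \<Rightarrow> real set" and J :: "nat set"
  assume J: "finite J" and A: "\<And>i. i \<in> J \<Longrightarrow> A i \<in> sets borel"
  define B where "B i = (if i \<in> J then A i else UNIV)" for i
  have B: "B i \<in> sets borel" for i using A by (simp add: B_def)
  obtain n where n: "J \<subseteq> {..<n}" using J finite_nat_iff_bounded by auto
  let ?E = "prod_emb UNIV (\<lambda>_. borel) J (Pi\<^sub>E J A) :: (nat \<Rightarrow> real) set"
  have E: "?E \<in> sets seq_space" using J A by (intro sets_PiM_I) auto
  have mem: "c \<in> ?E \<longleftrightarrow> (\<forall>k<n. c k \<in> B k)" for c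
    using n by (auto simp: prod_emb_def B_def PiE_iff subset_eq)
  have "emeasure (distr M seq_space X) ?E = emeasure M {\<omega> \<in> space M. \<forall>k<n. X \<omega> k \<in> B k}"
    unfolding emeasure_distr[OF X E]
    by (intro arg_cong[where f = "emeasure M"] set_eqI) (simp only: vimage_def mem Int_iff mem_Collect_eq conj_commute)
  also have "\<dots> = emeasure N {\<omega> \<in> space N. \<forall>k<n. Y \<omega> k \<in> B k}" by (rule eq[OF B])
  also have "\<dots> = emeasure (distr N seq_space Y) ?E"
    unfolding emeasure_distr[OF Y E]
    by (intro arg_cong[where f = "emeasure N"] set_eqI) (simp only: vimage_def mem Int_iff mem_Collect_eq conj_commute)
  finally show "emeasure (distr M seq_space X) ?E = emeasure (distr N seq_space Y) ?E" .
qed simp_all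

theorem theorem3p2:
  fixes \<alpha> lam :: real
    and M :: "'m measure" and X :: "real \<Rightarrow> 'm \<Rightarrow> real" and A :: "nat \<Rightarrow> 'm \<Rightarrow> real"
    and S :: "'m \<Rightarrow> real" and f :: "real \<Rightarrow> real" and PD_given :: "real \<Rightarrow> (nat \<Rightarrow> real) measure"
    and Q :: "'q measure" and P Pt :: "'q \<Rightarrow> nat \<Rightarrow> real" and I :: "nat \<Rightarrow> 'q \<Rightarrow> nat"
    and N :: "'n measure" and \<beta> e R W :: "nat \<Rightarrow> 'n \<Rightarrow> real"
  assumes \<alpha>: "0 < \<alpha>" "\<alpha> < 1" and lam: "0 < lam"
    \<comment> \<open>the stable subordinator, its ranked jumps on \<open>[0,1]\<close>, their sum, and PD\<open>(\<alpha>|t)\<close>\<close>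
    and X: "subordinator M (stable_levy_density \<alpha>) X"
    and A: "\<And>k. A k \<in> borel_measurable M"
      "AE \<omega> in M. ranked_jumps (\<lambda>t. X t \<omega>) (\<lambda>k. A k \<omega>)"
    and S: "positive_stable M \<alpha> S" "AE \<omega> in M. (\<lambda>k. A k \<omega>) sums S \<omega>"
    and f: "\<And>t. 0 \<le> f t" "distributed M lborel S (\<lambda>t. ennreal (f t))"
    and PD_given:
      "regular_conditional_law M seq_space (\<lambda>\<omega> k. A k \<omega> / S \<omega>) borel S PD_given"
    \<comment> \<open>the mass partition and a size-biased sample from it\<close>
    and Q: "prob_space Q"
    and P: "P \<in> measurable Q seq_space" "distr Q seq_space P = P1_law \<alpha> lam f PD_given"
    and Pt: "size_biased_sample Q P I Pt"
    \<comment> \<open>the variables of the stick-breaking representation\<close>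
    and N: "prob_space N"
    and e: "\<And>i. distributed N lborel (e i) (\<lambda>x. ennreal (exponential_density 1 x))"
      "prob_space.indep_vars N (\<lambda>_. borel) e UNIV"
    and R: "R = R_ratio \<alpha> lam e"
    and \<beta>: "\<And>k. distributed N lborel (\<beta> k) (\<lambda>x. ennreal (beta_density (1 - \<alpha>) \<alpha> x))"
      "prob_space.indep_vars N (\<lambda>_. borel) \<beta> UNIV"
      "prob_space.indep_var N seq_space (\<lambda>\<omega> k. \<beta> k \<omega>) seq_space (\<lambda>\<omega> k. R k \<omega>)"
    and W: "W = (\<lambda>k \<omega>. stick_factor (\<beta> k \<omega>) (R k \<omega>))"
  shows "distr Q seq_space Pt =
           distr N seq_space (\<lambda>\<omega> k. (1 - W k \<omega>) * (\<Prod>l<k. W l \<omega>)) \<and>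
         \<not> prob_space.indep_vars N (\<lambda>_. borel) W UNIV \<and>
         cond_indep_vars N (generated_by N seq_space (\<lambda>\<omega> k. R k \<omega>)) (\<lambda>_. borel) W UNIV \<and>
         (\<forall>k. regular_conditional_law N borel (W k)
            (PiM {..k} (\<lambda>_. borel)) (\<lambda>\<omega>. \<lambda>j\<in>{..k}. R j \<omega>)
            (\<lambda>r. distr N borel (\<lambda>\<omega>. stick_factor (\<beta> k \<omega>) (r k)))) \<and>
         (\<forall>k r. 0 < r \<and> r < 1 \<longrightarrow>
            distributed N lborel (\<lambda>\<omega>. stick_factor (\<beta> k \<omega>) r)
              (\<lambda>w. ennreal (stick_factor_density \<alpha> r w)))"
proof -
  from X interpret M: prob_space M by (simp add: subordinator_def)
  have "ranked_poisson M (levy_measure (stable_levy_density \<alpha>)) A"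
  proof (rule subordinator_ranked_poisson[OF X])
    show "AE \<omega> in M. (\<lambda>k. A k \<omega>) \<longlonglongrightarrow> 0"
      using S(2) by eventually_elim (intro summable_LIMSEQ_zero sums_summable)
  qed (use A stable_levy_measure_finite[OF \<alpha>] in auto)
  then interpret jumps: stable_jumps M \<alpha> A S
    by (intro stable_jumps.intro stable_jumps_axioms.intro \<alpha> S)
  interpret sticks: stick_breaking N \<alpha> lam e \<beta> R W
    by (intro stick_breaking.intro stick_breaking_axioms.intro N \<alpha> lam e R \<beta> W)
  have law: "distr Q seq_space P = jumps.tilted_law lam"
    using P(2) jumps.P1_law_eq_tilted_law[OF lam f PD_given] by simp
  have "AE p in distr Q seq_space P. mass_partition p"
    unfolding law by (rule jumps.AE_tilted_law_mass_partition)
  then have partition: "AE \<omega> in Q. mass_partition (P \<omega>)"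
    by (rule AE_distrD[OF P(1)])
  interpret picks: size_biased_pick Q P Pt I
    by (intro size_biased_pick.intro size_biased_pick_axioms.intro Q P(1) partition Pt)
  have mS: "picks.survivals \<in> measurable Q seq_space"
    by (intro seq_measurableI picks.survivals_measurable)
  have mW: "(\<lambda>\<omega> k. W k \<omega>) \<in> measurable N seq_space"
    by (intro seq_measurableI sticks.W_measurable)
  have survivals: "distr Q seq_space picks.survivals = distr N seq_space (\<lambda>\<omega> k. W k \<omega>)"
  proof (rule seq_law_eqI[OF Q mS mW])
    fix n and B :: "nat \<Rightarrow> real set" assume B: "\<And>i. B i \<in> sets borel"
    have "emeasure Q {\<omega> \<in> space Q. \<forall>k<n. picks.survivals \<omega> k \<in> B k} = (\<integral>\<^sup>+ \<omega>. picks_in n B (P \<omega>) \<partial>Q)"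
      by (rule picks.survivals_law[OF B])
    also have "\<dots> = (\<integral>\<^sup>+ p. picks_in n B p \<partial>distr Q seq_space P)"
      by (rule nn_integral_distr[symmetric, OF P(1)]) (simp add: picks_in_measurable B)
    also have "\<dots> = factors_in \<alpha> n B lam"
      unfolding law by (rule jumps.picks_in_tilted_law[OF lam B])
    also have "\<dots> = emeasure N {\<omega> \<in> space N. \<forall>k<n. W k \<omega> \<in> B k}"
      by (rule sticks.factors_law[OF B, symmetric])
    finally show "emeasure Q {\<omega> \<in> space Q. \<forall>k<n. picks.survivals \<omega> k \<in> B k} = \<dots>" .
  qed
  define stick where "stick w = (\<lambda>k. (1 - w k) * (\<Prod>l<k. w l))" for w :: "nat \<Rightarrow> real"
  have stick: "stick \<in> measurable seq_space seq_space"
    unfolding stick_def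
    by (intro seq_measurableI borel_measurable_times borel_measurable_diff borel_measurable_prod
        borel_measurable_const seq_measurable_coord)
  have mPt: "Pt \<in> measurable Q seq_space"
    by (intro seq_measurableI picks.Pt_measurable)
  have "distr Q seq_space Pt = distr Q seq_space (stick \<circ> picks.survivals)"
    using picks.AE_Pt_eq_survivals
    by (intro distr_cong_AE mPt measurable_comp[OF mS stick]) (auto simp: stick_def fun_eq_iff elim: eventually_mono)
  also have "\<dots> = distr N seq_space (stick \<circ> (\<lambda>\<omega> k. W k \<omega>))"
    unfolding distr_distr[OF stick mS, symmetric] distr_distr[OF stick mW, symmetric] survivals ..
  also have "\<dots> = distr N seq_space (\<lambda>\<omega> k. (1 - W k \<omega>) * (\<Prod>l<k. W l \<omega>))"
    by (simp add: stick_def o_def)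
  finally show ?thesis
    using sticks.factors_not_indep sticks.factors_cond_indep sticks.factor_regular_conditional_law
      sticks.stick_factor_distributed by blast
qed

end
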